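(* The following problem is in coNEXP: given two shape graphs $H$ and $K$, decide whether $L(H)\subseteq L(K)$.
   Context: Fix a finite set $\Sigma$ of edge labels. An interval $[n;m]$ with $n\in\mathbb N$, $m\in\mathbb N\cup\{\infty\}$, $n\le m$, denotes $\{i\in\mathbb N: n\le i\le m\}$. Define $[n_1;m_1]\oplus[n_2;m_2]=[n_1+n_2;m_1+m_2]$, the empty $\oplus$-sum being $[0;0]$; $\subseteq$ between intervals is set inclusion. The basic intervals are $[1;1]$, $[0;1]$, $[1;\infty]$, $[0;\infty]$. A graph is a tuple $G=(N_G,E_G,\mathsf{source}_G,\mathsf{target}_G,\mathsf{lab}_G,\mathsf{occur}_G)$ with finite sets $N_G$ of nodes and $E_G$ of edges, $\mathsf{source}_G,\mathsf{target}_G:E_G\to N_G$, $\mathsf{lab}_G:E_G\to\Sigma$, and $\mathsf{occur}_G$ assigning an interval to each edge. Let $\mathsf{out}_G(n)=\{e\in E_G:\mathsf{source}_G(e)=n\}$. A graph is simple if every edge has interval $[1;1]$ and no two distinct edges have the same source, target and label. A shape graph is a graph using only basic intervals. For graphs $G,H$, a relation $R\subseteq N_G\times N_H$ is a simulation if for every $(n,m)\in R$ there is a function $\lambda:\mathsf{out}_G(n)\to\mathsf{out}_H(m)$ such that for every $e\in\mathsf{out}_G(n)$: $\mathsf{lab}_G(e)=\mathsf{lab}_H(\lambda(e))$ and $(\mathsf{target}_G(e),\mathsf{target}_H(\lambda(e)))\in R$; and for every $f\in\mathsf{out}_H(m)$: $\bigoplus\{\mathsf{occur}_G(e): e\in\mathsf{out}_G(n),\lambda(e)=f\}\subseteq\mathsf{occur}_H(f)$.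 An embedding is a simulation whose domain is all of $N_G$; write $G\preccurlyeq H$ if one exists. $L(H)$ is the set of simple graphs $G$ with $G\preccurlyeq H$. *)

theory Defs
  imports
    "HOL-Library.Extended_Nat"
    "HOL-Library.Product_Plus"
    "HOL-Computational_Algebra.Polynomial"
begin

section \<open>Intervals\<close>

text \<open>The pair \<open>(n, m)\<close> with \<open>n \<le> m\<close> stands for the interval \<open>[n;m]\<close>. The operation \<open>\<oplus>\<close> is
  componentwise addition of pairs (\<open>HOL-Library.Product_Plus\<close>), so iterated \<open>\<oplus>\<close> is \<^const>\<open>sum\<close>
  and its empty case is \<open>(0, 0)\<close>.\<close>

type_synonym interval = "nat \<times> enat"

definition ivl_set :: "interval \<Rightarrow> nat set" where
  "ivl_set I = {i. fst I \<le> i \<and> enat i \<le> snd I}"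

definition basic_intervals :: "interval set" where
  "basic_intervals = {(1, 1), (0, 1), (1, \<infinity>), (0, \<infinity>)}"


section \<open>Graphs and embeddings\<close>

record ('n, 'e, 'l) graph =
  nodes :: "'n set"
  edges :: "'e set"
  source :: "'e \<Rightarrow> 'n"
  target :: "'e \<Rightarrow> 'n"
  lab :: "'e \<Rightarrow> 'l"
  occur :: "'e \<Rightarrow> interval"

definition is_graph :: "'l set \<Rightarrow> ('n, 'e, 'l) graph \<Rightarrow> bool" where
  "is_graph \<Sigma> G \<longleftrightarrow> finite (nodes G) \<and> finite (edges G) \<and>
     (\<forall>e \<in> edges G. source G e \<in> nodes G \<and> target G e \<in> nodes G \<and> lab G e \<in> \<Sigma> \<and>
        enat (fst (occur G e)) \<le> snd (occur G e))"

definition out :: "('n, 'e, 'l) graph \<Rightarrow> 'n \<Rightarrow> 'e set" where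
  "out G n = {e \<in> edges G. source G e = n}"

definition simple_graph :: "'l set \<Rightarrow> ('n, 'e, 'l) graph \<Rightarrow> bool" where
  "simple_graph \<Sigma> G \<longleftrightarrow> is_graph \<Sigma> G \<and>
     (\<forall>e \<in> edges G. occur G e = (1, 1)) \<and>
     (\<forall>e \<in> edges G. \<forall>f \<in> edges G.
        source G e = source G f \<and> target G e = target G f \<and> lab G e = lab G f \<longrightarrow> e = f)"

definition shape_graph :: "'l set \<Rightarrow> ('n, 'e, 'l) graph \<Rightarrow> bool" where
  "shape_graph \<Sigma> G \<longleftrightarrow> is_graph \<Sigma> G \<and> (\<forall>e \<in> edges G. occur G e \<in> basic_intervals)"

definition simulation ::
    "('n, 'e, 'l) graph \<Rightarrow> ('m, 'f, 'l) graph \<Rightarrow> ('n \<times> 'm) set \<Rightarrow> bool" where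
  "simulation G H R \<longleftrightarrow> R \<subseteq> nodes G \<times> nodes H \<and>
     (\<forall>(n, m) \<in> R. \<exists>\<phi>. \<phi> ` out G n \<subseteq> out H m \<and>
        (\<forall>e \<in> out G n. lab G e = lab H (\<phi> e) \<and> (target G e, target H (\<phi> e)) \<in> R) \<and>
        (\<forall>f \<in> out H m. ivl_set (\<Sum>e | e \<in> out G n \<and> \<phi> e = f. occur G e) \<subseteq> ivl_set (occur H f)))"

definition embedding ::
    "('n, 'e, 'l) graph \<Rightarrow> ('m, 'f, 'l) graph \<Rightarrow> ('n \<times> 'm) set \<Rightarrow> bool" where
  "embedding G H R \<longleftrightarrow> simulation G H R \<and> Domain R = nodes G"

definition embeds :: "('n, 'e, 'l) graph \<Rightarrow> ('m, 'f, 'l) graph \<Rightarrow> bool"  (infix "\<preceq>" 50) where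
  "G \<preceq> H \<longleftrightarrow> (\<exists>R. embedding G H R)"

text \<open>Graphs are finite, so natural numbers suffice as node and edge identities.\<close>

definition lang :: "'l set \<Rightarrow> ('m, 'f, 'l) graph \<Rightarrow> (nat, nat, 'l) graph set" where
  "lang \<Sigma> H = {G. simple_graph \<Sigma> G \<and> G \<preceq> H}"


section \<open>Nondeterministic multi-tape Turing machines\<close>

datatype direction = Move_Left | Stay | Move_Right

text \<open>States and tape symbols are initial segments of the naturals. Symbol \<open>0\<close> is the blank,
  \<open>1\<close> and \<open>2\<close> are the input bits. Given a state and the symbols under the heads, \<open>delta\<close> yields
  the possible successor states together with one action (symbol written, direction) per tape.\<close>

record ntm =
  num_tapes :: nat
  num_states :: nat
  num_symbols :: nat
  start :: nat
  accept :: nat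
  delta :: "nat \<Rightarrow> nat list \<Rightarrow> (nat \<times> (nat \<times> direction) list) set"

definition is_ntm :: "ntm \<Rightarrow> bool" where
  "is_ntm M \<longleftrightarrow> num_tapes M \<ge> 1 \<and> num_symbols M \<ge> 3 \<and>
     start M < num_states M \<and> accept M < num_states M \<and>
     (\<forall>q < num_states M. \<forall>ss. length ss = num_tapes M \<and> set ss \<subseteq> {..<num_symbols M} \<longrightarrow>
        (\<forall>(q', as) \<in> delta M q ss.
           q' < num_states M \<and> length as = num_tapes M \<and> fst ` set as \<subseteq> {..<num_symbols M})) \<and>
     (\<forall>ss. delta M (accept M) ss = {})"

text \<open>A tape consists of the head position and the contents of a two-way infinite tape.\<close>

type_synonym tape = "int \<times> (int \<Rightarrow> nat)"
type_synonym config = "nat \<times> tape list"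

definition read_tape :: "tape \<Rightarrow> nat" where
  "read_tape t = snd t (fst t)"

fun offset :: "direction \<Rightarrow> int" where
  "offset Move_Left = -1"
| "offset Stay = 0"
| "offset Move_Right = 1"

fun perform :: "nat \<times> direction \<Rightarrow> tape \<Rightarrow> tape" where
  "perform (b, d) (h, t) = (h + offset d, t(h := b))"

definition step :: "ntm \<Rightarrow> (config \<times> config) set" where
  "step M = {((q, ts), (q', map2 perform as ts)) | q ts q' as.
     (q', as) \<in> delta M q (map read_tape ts)}"

definition blank_tape :: tape where
  "blank_tape = (0, \<lambda>_. 0)"

definition input_tape :: "bool list \<Rightarrow> tape" where
  "input_tape w =
     (0, \<lambda>i. if 0 \<le> i \<and> i < int (length w) then (if w ! nat i then 2 else 1) else 0)"

definition init_config :: "ntm \<Rightarrow> bool list \<Rightarrow> config" where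
  "init_config M w = (start M, input_tape w # replicate (num_tapes M - 1) blank_tape)"

definition accepts :: "ntm \<Rightarrow> bool list \<Rightarrow> bool" where
  "accepts M w \<longleftrightarrow> (\<exists>c. (init_config M w, c) \<in> (step M)\<^sup>* \<and> fst c = accept M)"

text \<open>All computation paths, accepting or not, obey the time bound.\<close>

definition runs_in_time :: "ntm \<Rightarrow> (nat \<Rightarrow> nat) \<Rightarrow> bool" where
  "runs_in_time M T \<longleftrightarrow>
     (\<forall>w n c. (init_config M w, c) \<in> step M ^^ n \<longrightarrow> n \<le> T (length w))"

definition NTIME :: "(nat \<Rightarrow> nat) \<Rightarrow> bool list set set" where
  "NTIME T = {A. \<exists>M. is_ntm M \<and> runs_in_time M T \<and> A = {w. accepts M w}}"

definition NEXP :: "bool list set set" where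
  "NEXP = (\<Union>p :: nat poly. NTIME (\<lambda>n. 2 ^ poly p n))"

definition coNEXP :: "bool list set set" where
  "coNEXP = {A. - A \<in> NEXP}"


section \<open>The containment problem\<close>

text \<open>A graph is written as its number of nodes, its number of edges, and the list of its edges,
  with respect to some numbering of the nodes and some ordering of the edges. Since the length of
  a code is at least the number of nodes, writing node numbers in unary rather than in binary
  affects this length only polynomially. The codes \<open>c\<close> of the labels are fixed, as is the finite
  set of labels.\<close>

definition unary :: "nat \<Rightarrow> bool list" where
  "unary n = replicate n True @ [False]"

text \<open>Injective on \<^const>\<open>basic_intervals\<close>.\<close>

definition interval_code :: "interval \<Rightarrow> bool list" where
  "interval_code I = [fst I = 1, snd I = \<infinity>]"

definition edge_code ::
    "('l \<Rightarrow> nat) \<Rightarrow> ('n, 'e, 'l) graph \<Rightarrow> ('n \<Rightarrow> nat) \<Rightarrow> 'e \<Rightarrow> bool list" where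
  "edge_code c G num e = unary (num (source G e)) @ unary (num (target G e)) @
     unary (c (lab G e)) @ interval_code (occur G e)"

definition encodes :: "('l \<Rightarrow> nat) \<Rightarrow> bool list \<Rightarrow> ('n, 'e, 'l) graph \<Rightarrow> bool" where
  "encodes c w G \<longleftrightarrow> (\<exists>num es.
     bij_betw num (nodes G) {..<card (nodes G)} \<and> distinct es \<and> set es = edges G \<and>
     w = unary (card (nodes G)) @ unary (length es) @ concat (map (edge_code c G num) es))"

text \<open>Codes of graphs are self-delimiting, so a pair is coded by concatenation.\<close>

definition shape_containment :: "'l set \<Rightarrow> ('l \<Rightarrow> nat) \<Rightarrow> bool list set" where
  "shape_containment \<Sigma> c = {u @ v | u v. \<exists>(H :: (nat, nat, 'l) graph) (K :: (nat, nat, 'l) graph).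
     shape_graph \<Sigma> H \<and> shape_graph \<Sigma> K \<and> encodes c u H \<and> encodes c v K \<and>
     lang \<Sigma> H \<subseteq> lang \<Sigma> K}"

end

theory Submission imports Defs
begin

text \<open>Non-containment is shown to be definable by an existential second-order sentence over the numbers
  below \<open>N = 2 ^ ((n + 1)\<^sup>2)\<close>, where \<open>n\<close> is the length of the input: a machine guesses the relations as
  bit tables of length polynomial in \<open>N\<close> and evaluates the first-order part by nested loops.

  The sentence says that the input does not parse, or that the guessed relations describe a simple
  graph embedded in \<open>H\<close> that has a node simulated by no node of \<open>K\<close>. As intervals are basic, a node
  is simulated by another iff two matchings exist (one covers the required edges, one covers the
  edges that can only go to bounded edges), so by Hall's theorem non-simulation has a succinct witness.

  If there is a counterexample \<open>G\<close> at all, there is one with at most \<open>N\<close> nodes: merge nodes of \<open>G\<close>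
  with the same set of simulating nodes of \<open>H\<close> and the same stage of the approximation of the greatest
  simulation in \<open>K\<close>, and keep only the edges that the embedding and the Hall witnesses need, which are
  polynomially many per node.\<close>

section \<open>Hall's theorem\<close>

text \<open>The greatest simulation is a greatest fixed point, so refuting an embedding in
  \<open>K\<close> is an inductive matter, and a certificate must carry an order: a claim of
  non-simulation may rest only on claims at smaller numbers. The passage to a small counterexample
  has to preserve this order, not just the claims themselves.

  The value of \<open>N\<close> comes from a count. A kind is a pair of a set of nodes of
  \<open>H\<close> and a set of nodes of \<open>K\<close>, so there are at most 2^(2n) kinds; the
  number of copies that each kind needs is generously bounded by 2 * 2^(n*n), and the product is
  2^((n+1)^2). The square in the exponent is also convenient for the machine, which obtains
  \<open>N\<close> by doubling inside two nested loops of length n + 1.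

  The detour through logic separates the concerns. Parsing, the two graphs and the certificate all
  go into one formula that depends only on the codes of the labels, while running times are analysed
  for a single evaluator of arbitrary formulas. Its time is a fixed power of \<open>N\<close>, and
  N^k = 2^(k (n+1)^2) is of the form that \<open>NEXP\<close> asks for.\<close>

theorem Hall_marriage:
  assumes "finite I" and "\<And>i. i \<in> I \<Longrightarrow> finite (A i)"
    and "\<And>J. J \<subseteq> I \<Longrightarrow> card J \<le> card (\<Union>(A ` J))"
  shows "\<exists>f. inj_on f I \<and> (\<forall>i \<in> I. f i \<in> A i)"
  using assms
proof (induction "card I" arbitrary: I A rule: less_induct)
  case (less I A)
  show ?case
  proof (cases "I = {}")
    case False
    then obtain i where i: "i \<in> I" by auto
    have fin: "finite (\<Union>(A ` J))" if "J \<subseteq> I" for J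
      using that less.prems(1,2) finite_subset by (intro finite_UN_I) blast+
    \<comment> \<open>The Halmos-Vaughan argument. If a proper nonempty \<open>J\<close> is tight,
      match \<open>J\<close> within its neighbourhood and the rest outside it. Otherwise every
      proper nonempty subset has a spare element, so \<open>i\<close> may take any element of
      \<open>A i\<close>.\<close>
    show ?thesis
    proof (cases "\<exists>J. J \<subset> I \<and> J \<noteq> {} \<and> card (\<Union>(A ` J)) = card J")
      case True
      then obtain J where J: "J \<subset> I" "J \<noteq> {}" "card (\<Union>(A ` J)) = card J" by blast
      let ?U = "\<Union>(A ` J)" and ?B = "\<lambda>i. A i - \<Union>(A ` J)"
      have fJ: "finite J" using J less.prems(1) finite_subset by blast
      have "card J < card I" using J less.prems(1) psubset_card_mono by blast
      then have "\<exists>f. inj_on f J \<and> (\<forall>i \<in> J. f i \<in> A i)"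
      proof (rule less.hyps[OF _ fJ])
        show "finite (A i)" if "i \<in> J" for i using that J less.prems(2) by auto
        show "card K \<le> card (\<Union>(A ` K))" if "K \<subseteq> J" for K using that J less.prems(3)[of K] by auto
      qed
      then obtain f where f: "inj_on f J" "\<forall>i \<in> J. f i \<in> A i" by blast
      have c1: "card (I - J) < card I" using J less.prems(1) by (intro psubset_card_mono) auto
      \<comment> \<open>Hall's condition for \<open>K \<union> J\<close>, minus the tight set
        \<open>J\<close>.\<close>
      have c2: "card K \<le> card (\<Union>(?B ` K))" if K: "K \<subseteq> I - J" for K
      proof -
        have fK: "finite K" using K less.prems(1) finite_subset by blast
        have "card (K \<union> J) \<le> card (\<Union>(A ` (K \<union> J)))"
          using K J by (intro less.prems(3)) auto
        also have "\<Union>(A ` (K \<union> J)) = \<Union>(?B ` K) \<union> ?U" by auto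
        also have "card \<dots> \<le> card (\<Union>(?B ` K)) + card ?U" by (rule card_Un_le)
        finally have "card (K \<union> J) \<le> card (\<Union>(?B ` K)) + card J" using J(3) by simp
        moreover have "card (K \<union> J) = card K + card J"
          using K fK fJ by (intro card_Un_disjoint) auto
        ultimately show ?thesis by simp
      qed
      have "\<exists>g. inj_on g (I - J) \<and> (\<forall>i \<in> I - J. g i \<in> ?B i)"
        by (rule less.hyps[OF c1 _ _ c2]) (use less.prems(1,2) in auto)
      then obtain g where g: "inj_on g (I - J)" "\<forall>i \<in> I - J. g i \<in> ?B i" by blast
      let ?h = "\<lambda>i. if i \<in> J then f i else g i"
      have "inj_on ?h I"
      proof (rule inj_onI)
        fix x y assume *: "x \<in> I" "y \<in> I" "?h x = ?h y"
        have hU: "?h i \<in> ?U \<longleftrightarrow> i \<in> J" if "i \<in> I" for i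
        proof (cases "i \<in> J")
          case True
          then have "f i \<in> ?U" using f(2) by blast
          then show ?thesis using True by (simp only: if_True)
        next
          case False
          then have "g i \<notin> ?U" using g(2) that by blast
          then show ?thesis using False by (simp only: if_False simp_thms)
        qed
        show "x = y"
        proof (cases "x \<in> J \<longleftrightarrow> y \<in> J")
          case True
          then show ?thesis using * inj_onD[OF f(1), of x y] inj_onD[OF g(1), of x y] by (cases "x \<in> J") simp_all
        next
          case False
          then have False using hU[OF *(1)] hU[OF *(2)] unfolding *(3) by blast
          then show ?thesis ..
        qed
      qed
      moreover have "\<forall>i \<in> I. ?h i \<in> A i" using f g by auto
      ultimately show ?thesis by blast
    next
      case False
      have "card {i} \<le> card (\<Union>(A ` {i}))" using i by (intro less.prems(3)) auto
      then have "A i \<noteq> {}" by auto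
      then obtain x where x: "x \<in> A i" by blast
      let ?B = "\<lambda>j. A j - {x}"
      have c1: "card (I - {i}) < card I" using i less.prems(1) by (intro psubset_card_mono) auto
      have c2: "card K \<le> card (\<Union>(?B ` K))" if K: "K \<subseteq> I - {i}" for K
      proof (cases "K = {}")
        case nonempty: False
        have "K \<subset> I" using K i by auto
        then have "card K \<noteq> card (\<Union>(A ` K))" using False nonempty by metis
        moreover have "card K \<le> card (\<Union>(A ` K))"
          by (rule less.prems(3)) (use \<open>K \<subset> I\<close> in blast)
        moreover have "card (\<Union>(A ` K)) - 1 \<le> card (\<Union>(A ` K) - {x})"
          using diff_card_le_card_Diff[of "{x}" "\<Union>(A ` K)"] by simp
        ultimately have "card K \<le> card (\<Union>(A ` K) - {x})" by linarith
        also have "\<Union>(A ` K) - {x} = \<Union>(?B ` K)" by auto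
        finally show ?thesis .
      qed simp
      have "\<exists>g. inj_on g (I - {i}) \<and> (\<forall>j \<in> I - {i}. g j \<in> ?B j)"
        by (rule less.hyps[OF c1 _ _ c2]) (use less.prems(1,2) in auto)
      then obtain g where g: "inj_on g (I - {i})" "\<forall>j \<in> I - {i}. g j \<in> ?B j" by blast
      have "inj_on (g(i := x)) I"
        using g by (auto simp: inj_on_def)
      moreover have "\<forall>j \<in> I. (g(i := x)) j \<in> A j" using g x by auto
      ultimately show ?thesis by blast
    qed
  qed simp
qed

text \<open>Hall's theorem applied on both sides gives two matchings; they are merged as in the proof of
  the Cantor-Bernstein theorem (this is the Mendelsohn-Dulmage theorem).\<close>

theorem assignment_exists:
  fixes A :: "'e \<Rightarrow> 'f set"
  assumes E: "finite E" and F: "finite F" "\<And>e. e \<in> E \<Longrightarrow> A e \<subseteq> F" "Q \<subseteq> F" "P \<subseteq> F"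
    and under: "\<And>X. X \<subseteq> Q \<Longrightarrow> card X \<le> card {e \<in> E. A e \<inter> X \<noteq> {}}"
    and over: "\<And>X. X \<subseteq> P \<Longrightarrow> card {e \<in> E. A e \<subseteq> X} \<le> card X"
  shows "\<exists>\<phi>. (\<forall>e \<in> E. \<phi> e \<in> A e) \<and> (\<forall>f \<in> Q. \<exists>e \<in> E. \<phi> e = f) \<and>
    (\<forall>f \<in> P. \<forall>e \<in> E. \<forall>e' \<in> E. \<phi> e = f \<longrightarrow> \<phi> e' = f \<longrightarrow> e = e')"
proof -
  define E0 where "E0 = {e \<in> E. A e \<subseteq> P}"
  have "\<exists>g. inj_on g E0 \<and> (\<forall>e \<in> E0. g e \<in> A e)"
  proof (rule Hall_marriage)
    fix J assume J: "J \<subseteq> E0"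
    have "card J \<le> card {e \<in> E. A e \<subseteq> \<Union>(A ` J)}"
      using J E by (intro card_mono) (auto simp: E0_def)
    also have "\<dots> \<le> card (\<Union>(A ` J))"
      using J by (intro over) (auto simp: E0_def)
    finally show "card J \<le> card (\<Union>(A ` J))" .
  qed (use E F in \<open>auto simp: E0_def intro: finite_subset\<close>)
  then obtain g where g: "inj_on g E0" "\<And>e. e \<in> E0 \<Longrightarrow> g e \<in> A e" by blast
  have "\<exists>k. inj_on k Q \<and> (\<forall>f \<in> Q. k f \<in> {e \<in> E. f \<in> A e})"
  proof (rule Hall_marriage)
    fix J assume J: "J \<subseteq> Q"
    have "{e \<in> E. A e \<inter> J \<noteq> {}} = (\<Union>f \<in> J. {e \<in> E. f \<in> A e})" by auto
    then show "card J \<le> card (\<Union>f \<in> J. {e \<in> E. f \<in> A e})" using under[OF J] by simp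
  qed (use E F in \<open>auto intro: finite_subset\<close>)
  then obtain k where k: "inj_on k Q" "\<And>f. f \<in> Q \<Longrightarrow> k f \<in> E" "\<And>f. f \<in> Q \<Longrightarrow> f \<in> A (k f)" by auto
  define U where "U = lfp (\<lambda>U. Q - g ` (E0 - k ` U))"
  have U: "U = Q - g ` (E0 - k ` U)"
    unfolding U_def by (rule lfp_unfold) (intro monoI Diff_mono image_mono order_refl)
  have U_iff: "f \<in> U \<longleftrightarrow> f \<in> Q \<and> f \<notin> g ` (E0 - k ` U)" for f
    by (subst U) simp
  then have UQ: "U \<subseteq> Q" by blast
  have inv: "inv_into U k (k f) = f" if "f \<in> U" for f
    using that UQ k(1) by (meson inj_on_subset inv_into_f_f)
  \<comment> \<open>An edge outside \<open>E0\<close> has a choice outside \<open>P\<close>, where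
    collisions do no harm.\<close>
  define \<phi> where "\<phi> = (\<lambda>e. if e \<in> k ` U then inv_into U k e else if e \<in> E0 then g e else SOME f. f \<in> A e - P)"
  have free: "(SOME f. f \<in> A e - P) \<in> A e - P" if "e \<in> E - E0" for e
    using that by (intro someI_ex[of "\<lambda>f. f \<in> A e - P"]) (auto simp: E0_def)
  have 1: "\<phi> e \<in> A e" if "e \<in> E" for e
    using that k UQ g(2)[of e] free[of e] by (auto simp: \<phi>_def inv subset_iff)
  have 2: "\<exists>e \<in> E. \<phi> e = f" if f_Q: "f \<in> Q" for f
  proof (cases "f \<in> U")
    case True
    then show ?thesis using that k by (intro bexI[of _ "k f"]) (auto simp: \<phi>_def inv)
  next
    case False
    then obtain e where "e \<in> E0 - k ` U" "f = g e" using U_iff[of f] f_Q by blast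
    then show ?thesis by (intro bexI[of _ e]) (auto simp: \<phi>_def E0_def)
  qed
  have 3: "(f \<in> U \<and> e = k f) \<or> (f \<notin> U \<and> e \<in> E0 \<and> g e = f)"
    if "f \<in> P" "e \<in> E" "\<phi> e = f" for e f
  proof (cases "e \<in> k ` U")
    case True
    then show ?thesis using that by (auto simp: \<phi>_def inv)
  next
    case False
    have "e \<in> E0"
    proof (rule ccontr)
      assume "e \<notin> E0"
      then have "\<phi> e \<in> A e - P" using free[of e] that(2) False by (simp add: \<phi>_def)
      then show False using that(1,3) by blast
    qed
    moreover have "g e \<notin> U" using U_iff[of "g e"] False \<open>e \<in> E0\<close> by blast
    ultimately show ?thesis using that(3) False by (simp add: \<phi>_def)
  qed
  have "e = e'" if "f \<in> P" "e \<in> E" "e' \<in> E" "\<phi> e = f" "\<phi> e' = f" for e e' f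
    using 3[OF that(1,2,4)] 3[OF that(1,3,5)] g(1) by (auto simp: inj_on_def)
  then show ?thesis using 1 2 by (intro exI[of _ \<phi>]) blast
qed

section \<open>Simulations as matchings\<close>

definition req :: "('n, 'e, 'l) graph \<Rightarrow> 'e \<Rightarrow> bool" where
  "req H f \<longleftrightarrow> fst (occur H f) = 1"

definition unb :: "('n, 'e, 'l) graph \<Rightarrow> 'e \<Rightarrow> bool" where
  "unb H f \<longleftrightarrow> snd (occur H f) = \<infinity>"

definition obeys ::
    "('n, 'e, 'l) graph \<Rightarrow> ('m, 'f, 'l) graph \<Rightarrow> 'n \<Rightarrow> 'm \<Rightarrow> ('e \<Rightarrow> 'f) \<Rightarrow> bool" where
  "obeys G H n m \<phi> \<longleftrightarrow> (\<forall>f \<in> out H m.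
     (req H f \<longrightarrow> (\<exists>e \<in> out G n. \<phi> e = f)) \<and>
     (\<not> unb H f \<longrightarrow> (\<forall>e \<in> out G n. \<forall>e' \<in> out G n. \<phi> e = f \<longrightarrow> \<phi> e' = f \<longrightarrow> e = e')))"

definition allowed ::
    "('n, 'e, 'l) graph \<Rightarrow> ('m, 'f, 'l) graph \<Rightarrow> ('n \<Rightarrow> 'm \<Rightarrow> bool) \<Rightarrow> 'm \<Rightarrow> 'e \<Rightarrow> 'f set" where
  "allowed G H R m e = {f \<in> out H m. lab G e = lab H f \<and> R (target G e) (target H f)}"

definition matches ::
    "('n, 'e, 'l) graph \<Rightarrow> ('m, 'f, 'l) graph \<Rightarrow> ('n \<Rightarrow> 'm \<Rightarrow> bool) \<Rightarrow> 'n \<Rightarrow> 'm \<Rightarrow> bool" where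
  "matches G H R n m \<longleftrightarrow> (\<exists>\<phi>. (\<forall>e \<in> out G n. \<phi> e \<in> allowed G H R m e) \<and> obeys G H n m \<phi>)"

text \<open>\<open>R\<close> and \<open>R'\<close> are compared only at targets of edges leaving
  \<open>n\<close>; inductions along edges know nothing more.\<close>

lemma matches_mono:
  assumes "matches G H R n m" and "\<And>e k. e \<in> out G n \<Longrightarrow> R (target G e) k \<Longrightarrow> R' (target G e) k"
  shows "matches G H R' n m"
  using assms unfolding matches_def allowed_def by (metis (mono_tags, lifting) mem_Collect_eq)

lemma sum_unit_interval:
  assumes "finite X" and "\<And>e. e \<in> X \<Longrightarrow> g e = (1 :: nat, 1 :: enat)"
  shows "sum g X = (card X, enat (card X))"
  using assms
proof (induction X rule: finite_induct)
  case empty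
  then show ?case by (simp add: zero_prod_def zero_enat_def)
next
  case (insert x X)
  then have "sum g (insert x X) = (1, 1) + (card X, enat (card X))" by simp
  also have "\<dots> = (Suc (card X), enat (Suc (card X)))" by (simp add: one_enat_def)
  finally show ?case using insert by simp
qed

text \<open>For a basic interval, containing a cardinality splits into two independent conditions,
  "not empty" and "at most one". This independence turns interval sums into a pair of matching
  conditions.\<close>

lemma card_in_basic:
  assumes "finite X" and "I \<in> basic_intervals"
  shows "ivl_set (card X, enat (card X)) \<subseteq> ivl_set I \<longleftrightarrow>
    (fst I = 1 \<longrightarrow> X \<noteq> {}) \<and> (snd I \<noteq> \<infinity> \<longrightarrow> (\<forall>e \<in> X. \<forall>e' \<in> X. e = e'))"
proof -
  have "ivl_set (card X, enat (card X)) = {card X}" by (auto simp: ivl_set_def)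
  moreover have "card X \<le> 1 \<longleftrightarrow> (\<forall>e \<in> X. \<forall>e' \<in> X. e = e')"
    using card_le_Suc0_iff_eq[OF assms(1)] by simp
  moreover have "1 \<le> card X \<longleftrightarrow> X \<noteq> {}" using assms(1) by (simp add: Suc_le_eq card_gt_0_iff)
  moreover have "card X \<in> ivl_set I \<longleftrightarrow> (fst I = 1 \<longrightarrow> 1 \<le> card X) \<and> (snd I \<noteq> \<infinity> \<longrightarrow> card X \<le> 1)"
    using assms(2) unfolding basic_intervals_def ivl_set_def by (auto simp: one_enat_def)
  ultimately show ?thesis by simp
qed

lemma finite_out: "is_graph \<Sigma> G \<Longrightarrow> finite (out G n)"
  unfolding is_graph_def out_def by (elim conjE) simp

lemma simulation_iff:
  fixes G :: "('n, 'e, 'l) graph" and H :: "('m, 'f, 'l) graph"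
  assumes G: "simple_graph \<Sigma> G" and H: "shape_graph \<Sigma> H"
  shows "simulation G H R \<longleftrightarrow> R \<subseteq> nodes G \<times> nodes H \<and>
    (\<forall>(n, m) \<in> R. matches G H (\<lambda>x y. (x, y) \<in> R) n m)"
proof -
  have "is_graph \<Sigma> G" using G unfolding simple_graph_def by (rule conjunct1)
  then have fin: "finite (out G n)" for n by (rule finite_out)
  have occ: "ivl_set (\<Sum>e | e \<in> out G n \<and> \<phi> e = f. occur G e) \<subseteq> ivl_set (occur H f) \<longleftrightarrow>
      (req H f \<longrightarrow> (\<exists>e \<in> out G n. \<phi> e = f)) \<and>
      (\<not> unb H f \<longrightarrow> (\<forall>e \<in> out G n. \<forall>e' \<in> out G n. \<phi> e = f \<longrightarrow> \<phi> e' = f \<longrightarrow> e = e'))"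
    if "f \<in> out H m" for n m f and \<phi> :: "'e \<Rightarrow> 'f"
  proof -
    let ?X = "{e. e \<in> out G n \<and> \<phi> e = f}"
    have X: "finite ?X" by (rule finite_subset[OF _ fin[of n]]) blast
    have "e \<in> edges G" if "e \<in> ?X" for e using that unfolding out_def by blast
    then have "occur G e = (1, 1)" if "e \<in> ?X" for e using that G unfolding simple_graph_def by blast
    then have "sum (occur G) ?X = (card ?X, enat (card ?X))" by (rule sum_unit_interval[OF X])
    moreover have "f \<in> edges H" using that unfolding out_def by blast
    then have "occur H f \<in> basic_intervals" using H unfolding shape_graph_def by blast
    ultimately show ?thesis using card_in_basic[OF X, of "occur H f"] unfolding req_def unb_def by auto
  qed
  have "(\<exists>\<phi>. \<phi> ` out G n \<subseteq> out H m \<and>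
        (\<forall>e \<in> out G n. lab G e = lab H (\<phi> e) \<and> (target G e, target H (\<phi> e)) \<in> R) \<and>
        (\<forall>f \<in> out H m. ivl_set (\<Sum>e | e \<in> out G n \<and> \<phi> e = f. occur G e) \<subseteq> ivl_set (occur H f))) \<longleftrightarrow>
      matches G H (\<lambda>x y. (x, y) \<in> R) n m" for n m
    unfolding matches_def obeys_def allowed_def using occ[of _ m]
    by (intro ex_cong1) (auto simp: image_subset_iff)
  then show ?thesis unfolding simulation_def by simp
qed

text \<open>The two obstructions of Hall's theorem: too few edges for the required ones of \<open>m\<close>, or too many
  for the bounded ones.\<close>

definition obstructed ::
    "('n, 'e, 'l) graph \<Rightarrow> ('m, 'f, 'l) graph \<Rightarrow> ('n \<Rightarrow> 'm \<Rightarrow> bool) \<Rightarrow> 'n \<Rightarrow> 'm \<Rightarrow> 'f set \<Rightarrow> bool" where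
  "obstructed G H R n m X \<longleftrightarrow> X \<subseteq> out H m \<and>
     ((\<forall>f \<in> X. req H f) \<and> card {e \<in> out G n. allowed G H R m e \<inter> X \<noteq> {}} < card X \<or>
      (\<forall>f \<in> X. \<not> unb H f) \<and> card X < card {e \<in> out G n. allowed G H R m e \<subseteq> X})"

lemma obstructed_not_matches:
  assumes fin: "finite (out G n)" "finite (out H m)" and X: "obstructed G H R n m X"
  shows "\<not> matches G H R n m"
proof
  assume "matches G H R n m"
  then obtain \<phi> where \<phi>: "\<And>e. e \<in> out G n \<Longrightarrow> \<phi> e \<in> allowed G H R m e" and r: "obeys G H n m \<phi>"
    unfolding matches_def by blast
  have XH: "X \<subseteq> out H m" and fX: "finite X"
    using X fin(2) finite_subset unfolding obstructed_def by blast+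
  consider (under) "\<forall>f \<in> X. req H f" "card {e \<in> out G n. allowed G H R m e \<inter> X \<noteq> {}} < card X"
    | (over) "\<forall>f \<in> X. \<not> unb H f" "card X < card {e \<in> out G n. allowed G H R m e \<subseteq> X}"
    using X unfolding obstructed_def by blast
  then show False
  proof cases
    case under
    have "X \<subseteq> \<phi> ` {e \<in> out G n. allowed G H R m e \<inter> X \<noteq> {}}"
    proof
      fix f assume f: "f \<in> X"
      then obtain e where e: "e \<in> out G n" "\<phi> e = f"
        using r XH under(1) unfolding obeys_def by blast
      then show "f \<in> \<phi> ` {e \<in> out G n. allowed G H R m e \<inter> X \<noteq> {}}" using \<phi>[OF e(1)] f by blast
    qed
    then have "card X \<le> card {e \<in> out G n. allowed G H R m e \<inter> X \<noteq> {}}"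
      using fin(1) by (intro surj_card_le) auto
    then show False using under(2) by simp
  next
    case over
    let ?Y = "{e \<in> out G n. allowed G H R m e \<subseteq> X}"
    have "inj_on \<phi> ?Y"
    proof (rule inj_onI)
      fix e e' assume *: "e \<in> ?Y" "e' \<in> ?Y" "\<phi> e = \<phi> e'"
      then have "\<phi> e \<in> X" using \<phi>[of e] by blast
      then have "\<phi> e \<in> out H m" "\<not> unb H (\<phi> e)" using XH over(1) by blast+
      then show "e = e'" using r * unfolding obeys_def by (metis (no_types, lifting) mem_Collect_eq)
    qed
    moreover have "\<phi> ` ?Y \<subseteq> X" using \<phi> by blast
    ultimately have "card ?Y \<le> card X" using fX by (rule card_inj_on_le)
    then show False using over(2) by simp
  qed
qed

lemma not_matches_obstructed:
  assumes fin: "finite (out G n)" "finite (out H m)" and "\<not> matches G H R n m"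
  obtains X where "obstructed G H R n m X"
proof (rule ccontr)
  assume "\<not> thesis"
  then have no: "\<not> obstructed G H R n m X" for X using that by blast
  have "\<exists>\<phi>. (\<forall>e \<in> out G n. \<phi> e \<in> allowed G H R m e) \<and> (\<forall>f \<in> {f \<in> out H m. req H f}. \<exists>e \<in> out G n. \<phi> e = f) \<and>
    (\<forall>f \<in> {f \<in> out H m. \<not> unb H f}. \<forall>e \<in> out G n. \<forall>e' \<in> out G n. \<phi> e = f \<longrightarrow> \<phi> e' = f \<longrightarrow> e = e')"
  proof (rule assignment_exists[OF fin(1), of "out H m"])
    fix X assume "X \<subseteq> {f \<in> out H m. req H f}"
    then have "X \<subseteq> out H m" "\<forall>f \<in> X. req H f" by blast+
    then show "card X \<le> card {e \<in> out G n. allowed G H R m e \<inter> X \<noteq> {}}"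
      using no[of X] unfolding obstructed_def by (simp add: not_less)
  next
    fix X assume "X \<subseteq> {f \<in> out H m. \<not> unb H f}"
    then have "X \<subseteq> out H m" "\<forall>f \<in> X. \<not> unb H f" by blast+
    then show "card {e \<in> out G n. allowed G H R m e \<subseteq> X} \<le> card X"
      using no[of X] unfolding obstructed_def by (simp add: not_less)
  qed (use fin in \<open>auto simp: allowed_def\<close>)
  then have "matches G H R n m" unfolding matches_def obeys_def by blast
  then show False using assms(3) by blast
qed

section \<open>Certificates of non-containment\<close>

text \<open>A counterexample to containment is described by relations over the numbers below \<open>N\<close>:
  \<open>I 1 [x, a, y]\<close> are its edges, labelled by codes; \<open>I 2\<close> is the embedding into \<open>H\<close> and
  \<open>I 3 [x, h, a, y, f]\<close> sends edge \<open>(x, a, y)\<close> to \<open>f\<close> when \<open>x\<close> is simulated by \<open>h\<close>.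
  \<open>I 4 [x, k]\<close> claims that \<open>x\<close> is not simulated by the node \<open>k\<close> of \<open>K\<close>; the evidence is a Hall
  obstruction \<open>I 6 [x, k, f]\<close> together with an injection \<open>I 7\<close> that compares cardinalities, and
  \<open>I 5 [x, k]\<close> tells which of the two kinds of obstruction it is. The claims are well founded
  because edges leaving such an \<open>x\<close> lead to smaller numbers.\<close>

definition edat :: "('l \<Rightarrow> nat) \<Rightarrow> (nat, nat, 'l) graph \<Rightarrow> nat \<Rightarrow> nat \<Rightarrow> nat \<Rightarrow> nat \<Rightarrow> bool" where
  "edat c G f s t l \<longleftrightarrow> f \<in> edges G \<and> source G f = s \<and> target G f = t \<and> c (lab G f) = l"

text \<open>The bounds on \<open>t\<close> and \<open>l\<close> are those of the quantifiers in the
  final formula. For a shape graph that is \<open>small\<close> they exclude no edge.\<close>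

definition outf :: "('l \<Rightarrow> nat) \<Rightarrow> nat \<Rightarrow> (nat, nat, 'l) graph \<Rightarrow> nat \<Rightarrow> nat \<Rightarrow> bool" where
  "outf c N G k f \<longleftrightarrow> (\<exists>t < N. \<exists>l < N. edat c G f k t l)"

text \<open>This is \<open>allowed\<close> for the complement of the claims in \<open>I 4\<close>.
  Correct claims leave every simulation inside that complement, so an obstruction to the complement
  obstructs all simulations.\<close>

definition allw :: "('l \<Rightarrow> nat) \<Rightarrow> nat \<Rightarrow> (nat, nat, 'l) graph \<Rightarrow> (nat \<Rightarrow> nat list \<Rightarrow> bool) \<Rightarrow>
    nat \<Rightarrow> nat \<Rightarrow> nat \<Rightarrow> nat \<Rightarrow> bool" where
  "allw c N G I k a y f \<longleftrightarrow> (\<exists>t < N. edat c G f k t a \<and> \<not> I 4 [y, t])"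

definition cex_H :: "('l \<Rightarrow> nat) \<Rightarrow> nat \<Rightarrow> (nat, nat, 'l) graph \<Rightarrow> (nat \<Rightarrow> nat list \<Rightarrow> bool) \<Rightarrow>
    nat \<Rightarrow> nat \<Rightarrow> bool" where
  "cex_H c N H I x h \<longleftrightarrow> h \<in> nodes H \<and>
     (\<forall>a < N. \<forall>y < N. I 1 [x, a, y] \<longrightarrow> (\<exists>f < N. I 3 [x, h, a, y, f] \<and>
        (\<exists>t < N. edat c H f h t a \<and> I 2 [y, t]) \<and> (\<forall>g < N. I 3 [x, h, a, y, g] \<longrightarrow> g = f))) \<and>
     (\<forall>f < N. outf c N H h f \<longrightarrow>
        (req H f \<longrightarrow> (\<exists>a < N. \<exists>y < N. I 1 [x, a, y] \<and> I 3 [x, h, a, y, f])) \<and>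
        (\<not> unb H f \<longrightarrow> (\<forall>a < N. \<forall>y < N. \<forall>b < N. \<forall>z < N.
           I 1 [x, a, y] \<and> I 3 [x, h, a, y, f] \<and> I 1 [x, b, z] \<and> I 3 [x, h, b, z, f] \<longrightarrow> a = b \<and> y = z)))"

text \<open>The inequality "fewer edges than elements" of the obstruction: each edge that may go
  into \<open>I 6\<close> owns an element of it that \<open>I 7\<close> shares with no other edge,
  and one element has no edge. \<open>I 7\<close> need not be functional.\<close>

definition cex_under :: "('l \<Rightarrow> nat) \<Rightarrow> nat \<Rightarrow> (nat, nat, 'l) graph \<Rightarrow> (nat \<Rightarrow> nat list \<Rightarrow> bool) \<Rightarrow>
    nat \<Rightarrow> nat \<Rightarrow> bool" where
  "cex_under c N K I x k \<longleftrightarrow> (\<forall>f < N. I 6 [x, k, f] \<longrightarrow> outf c N K k f \<and> req K f) \<and>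
     (\<forall>a < N. \<forall>y < N. I 1 [x, a, y] \<and> (\<exists>f < N. I 6 [x, k, f] \<and> allw c N K I k a y f) \<longrightarrow>
        (\<exists>f < N. I 6 [x, k, f] \<and> I 7 [x, k, a, y, f] \<and>
           (\<forall>b < N. \<forall>z < N. I 7 [x, k, b, z, f] \<longrightarrow> b = a \<and> z = y))) \<and>
     (\<exists>f < N. I 6 [x, k, f] \<and> (\<forall>a < N. \<forall>y < N. \<not> I 7 [x, k, a, y, f]))"

definition inside :: "('l \<Rightarrow> nat) \<Rightarrow> nat \<Rightarrow> (nat, nat, 'l) graph \<Rightarrow> (nat \<Rightarrow> nat list \<Rightarrow> bool) \<Rightarrow>
    nat \<Rightarrow> nat \<Rightarrow> nat \<Rightarrow> nat \<Rightarrow> bool" where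
  "inside c N K I x k a y \<longleftrightarrow> I 1 [x, a, y] \<and> (\<forall>f < N. allw c N K I k a y f \<longrightarrow> I 6 [x, k, f])"

text \<open>Here the comparison runs the other way: each element of the obstruction owns an edge
  confined to it, and one confined edge is left over.\<close>

definition cex_over :: "('l \<Rightarrow> nat) \<Rightarrow> nat \<Rightarrow> (nat, nat, 'l) graph \<Rightarrow> (nat \<Rightarrow> nat list \<Rightarrow> bool) \<Rightarrow>
    nat \<Rightarrow> nat \<Rightarrow> bool" where
  "cex_over c N K I x k \<longleftrightarrow> (\<forall>f < N. I 6 [x, k, f] \<longrightarrow> outf c N K k f \<and> \<not> unb K f) \<and>
     (\<forall>f < N. I 6 [x, k, f] \<longrightarrow> (\<exists>a < N. \<exists>y < N. inside c N K I x k a y \<and> I 7 [x, k, a, y, f] \<and>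
        (\<forall>g < N. I 7 [x, k, a, y, g] \<longrightarrow> g = f))) \<and>
     (\<exists>a < N. \<exists>y < N. inside c N K I x k a y \<and> (\<forall>f < N. \<not> I 7 [x, k, a, y, f]))"

definition cex :: "('l \<Rightarrow> nat) \<Rightarrow> nat \<Rightarrow> (nat, nat, 'l) graph \<Rightarrow> (nat, nat, 'l) graph \<Rightarrow>
    (nat \<Rightarrow> nat list \<Rightarrow> bool) \<Rightarrow> bool" where
  "cex c N H K I \<longleftrightarrow>
     (\<forall>x < N. \<forall>h < N. I 2 [x, h] \<longrightarrow> cex_H c N H I x h) \<and>
     (\<forall>x < N. \<forall>k < N. I 4 [x, k] \<longrightarrow> (\<forall>a < N. \<forall>y < N. I 1 [x, a, y] \<longrightarrow> y < x) \<and>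
        (I 5 [x, k] \<longrightarrow> cex_under c N K I x k) \<and> (\<not> I 5 [x, k] \<longrightarrow> cex_over c N K I x k)) \<and>
     (\<exists>x < N. (\<exists>h < N. I 2 [x, h]) \<and> (\<forall>k < N. k \<in> nodes K \<longrightarrow> I 4 [x, k]))"

lemma cex_H_D:
  assumes "cex_H c N H I x h"
  shows "\<lbrakk>a < N; y < N; I 1 [x, a, y]\<rbrakk> \<Longrightarrow> \<exists>f < N. I 3 [x, h, a, y, f] \<and>
      (\<exists>t < N. edat c H f h t a \<and> I 2 [y, t]) \<and> (\<forall>g < N. I 3 [x, h, a, y, g] \<longrightarrow> g = f)"
    and "\<lbrakk>f < N; outf c N H h f; req H f\<rbrakk> \<Longrightarrow> \<exists>a < N. \<exists>y < N. I 1 [x, a, y] \<and> I 3 [x, h, a, y, f]"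
    and "\<lbrakk>f < N; outf c N H h f; \<not> unb H f; a < N; y < N; b < N; z < N;
      I 1 [x, a, y]; I 3 [x, h, a, y, f]; I 1 [x, b, z]; I 3 [x, h, b, z, f]\<rbrakk> \<Longrightarrow> a = b \<and> y = z"
proof -
  note * = assms[unfolded cex_H_def, THEN conjunct2]
  show "\<lbrakk>a < N; y < N; I 1 [x, a, y]\<rbrakk> \<Longrightarrow> \<exists>f < N. I 3 [x, h, a, y, f] \<and>
      (\<exists>t < N. edat c H f h t a \<and> I 2 [y, t]) \<and> (\<forall>g < N. I 3 [x, h, a, y, g] \<longrightarrow> g = f)"
    using *[THEN conjunct1] by simp
  show "\<lbrakk>f < N; outf c N H h f; req H f\<rbrakk> \<Longrightarrow> \<exists>a < N. \<exists>y < N. I 1 [x, a, y] \<and> I 3 [x, h, a, y, f]"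
    using *[THEN conjunct2] by simp
  show "\<lbrakk>f < N; outf c N H h f; \<not> unb H f; a < N; y < N; b < N; z < N;
      I 1 [x, a, y]; I 3 [x, h, a, y, f]; I 1 [x, b, z]; I 3 [x, h, b, z, f]\<rbrakk> \<Longrightarrow> a = b \<and> y = z"
    using *[THEN conjunct2] by meson
qed

definition small :: "('l \<Rightarrow> nat) \<Rightarrow> nat \<Rightarrow> (nat, nat, 'l) graph \<Rightarrow> bool" where
  "small c N G \<longleftrightarrow> nodes G \<subseteq> {..<N} \<and> edges G \<subseteq> {..<N} \<and> (\<forall>f \<in> edges G. c (lab G f) < N)"

lemma shape_graphD:
  assumes "shape_graph \<Sigma> G" and "f \<in> edges G"
  shows "source G f \<in> nodes G" "target G f \<in> nodes G" "lab G f \<in> \<Sigma>"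
  using assms unfolding shape_graph_def is_graph_def by blast+

section \<open>From a certificate to a graph in the language of H and outside that of K\<close>

locale certificate =
  fixes \<Sigma> :: "'l set" and c :: "'l \<Rightarrow> nat" and N :: nat and H K :: "(nat, nat, 'l) graph"
    and I :: "nat \<Rightarrow> nat list \<Rightarrow> bool"
  assumes c: "inj_on c \<Sigma>" and H: "shape_graph \<Sigma> H" and K: "shape_graph \<Sigma> K"
    and smallH: "small c N H" and smallK: "small c N K" and cex: "cex c N H K I"
begin

definition "src e = fst (prod_decode e)"
definition "lb e = fst (prod_decode (snd (prod_decode e)))"
definition "tgt e = snd (prod_decode (snd (prod_decode e)))"
text \<open>Only numbers that \<open>I 2\<close> relates to a node of \<open>H\<close> become nodes,
  so the embedding in \<open>H\<close> is total by construction.\<close>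

definition "V = {x. x < N \<and> (\<exists>h < N. I 2 [x, h])}"
definition "Ed = {e. src e \<in> V \<and> lb e < N \<and> tgt e < N \<and> I 1 [src e, lb e, tgt e]}"

definition G :: "(nat, nat, 'l) graph" where
  "G = \<lparr>nodes = V, edges = Ed, source = src, target = tgt, lab = \<lambda>e. inv_into \<Sigma> c (lb e), occur = \<lambda>_. (1, 1)\<rparr>"

lemma G_simps [simp]:
  "nodes G = V" "edges G = Ed" "source G = src" "target G = tgt" "occur G e = (1, 1)"
  "lab G e = inv_into \<Sigma> c (lb e)"
  by (simp_all add: G_def)

lemma edge_eqI: "src e = src e' \<Longrightarrow> lb e = lb e' \<Longrightarrow> tgt e = tgt e' \<Longrightarrow> e = e'"
  unfolding src_def lb_def tgt_def by (metis prod_decode_inverse prod.collapse)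

lemma edge_ex: "\<exists>e. src e = x \<and> lb e = a \<and> tgt e = y"
  by (intro exI[of _ "prod_encode (x, prod_encode (a, y))"]) (simp add: src_def lb_def tgt_def)

lemma edge_in: "x \<in> V \<Longrightarrow> a < N \<Longrightarrow> y < N \<Longrightarrow> I 1 [x, a, y] \<Longrightarrow>
    \<exists>e \<in> out G x. lb e = a \<and> tgt e = y"
  using edge_ex[of x a y] by (auto simp: out_def Ed_def)

lemma nodeD: "x \<in> V \<Longrightarrow> x < N"
  by (simp add: V_def)

lemma outD: "e \<in> out G x \<Longrightarrow> src e = x \<and> x \<in> V \<and> lb e < N \<and> tgt e < N \<and> I 1 [x, lb e, tgt e]"
  by (auto simp: out_def Ed_def)

lemma cexHD: "x \<in> V \<Longrightarrow> h < N \<Longrightarrow> I 2 [x, h] \<Longrightarrow> cex_H c N H I x h"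
  using cex unfolding cex_def V_def by blast

lemma image_edge:
  assumes "e \<in> out G x" and "h < N" and "I 2 [x, h]"
  shows "\<exists>f. f < N \<and> I 3 [x, h, lb e, tgt e, f] \<and> f \<in> edges H \<and> source H f = h \<and>
    c (lab H f) = lb e \<and> I 2 [tgt e, target H f] \<and> (\<forall>g < N. I 3 [x, h, lb e, tgt e, g] \<longrightarrow> g = f)"
proof -
  note o = outD[OF assms(1)]
  then have "cex_H c N H I x h" using cexHD assms(2,3) by simp
  from cex_H_D(1)[OF this, of "lb e" "tgt e"] obtain f where f: "f < N" "I 3 [x, h, lb e, tgt e, f]"
    "\<forall>g < N. I 3 [x, h, lb e, tgt e, g] \<longrightarrow> g = f" "\<exists>t < N. edat c H f h t (lb e) \<and> I 2 [tgt e, t]"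
    using o by blast
  then show ?thesis unfolding edat_def by blast
qed

text \<open>\<open>Ed\<close> does not ask that targets be nodes. The node of \<open>H\<close> that
  simulates the source provides an edge of \<open>H\<close> with the same label code, and its target
  simulates the target.\<close>

lemma edge_props:
  assumes "e \<in> Ed"
  shows "tgt e \<in> V" "\<exists>f \<in> edges H. lb e = c (lab H f)"
proof -
  have e: "e \<in> out G (src e)" using assms by (simp add: out_def)
  then obtain h where "h < N" "I 2 [src e, h]" using outD unfolding V_def by blast
  then obtain f where f: "f \<in> edges H" "c (lab H f) = lb e" "I 2 [tgt e, target H f]"
    using image_edge[OF e] by blast
  have "target H f < N" using shape_graphD(2)[OF H f(1)] smallH unfolding small_def by blast
  then show "tgt e \<in> V" using f(3) outD[OF e] unfolding V_def by blast
  show "\<exists>f \<in> edges H. lb e = c (lab H f)" using f by metis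
qed

lemma outH:
  assumes "f \<in> edges H"
  shows "f < N" "source H f = h \<Longrightarrow> outf c N H h f"
proof -
  show "f < N" using assms smallH unfolding small_def by blast
  have "target H f < N" "c (lab H f) < N"
    using shape_graphD(2)[OF H assms] assms smallH unfolding small_def by blast+
  then show "source H f = h \<Longrightarrow> outf c N H h f" using assms unfolding outf_def edat_def by blast
qed

text \<open>The guessed label code of an edge is that of an edge of \<open>H\<close>, hence in the
  range of \<open>c\<close>, where inverting \<open>c\<close> is safe.\<close>

lemma lab_iff: "e \<in> Ed \<Longrightarrow> l \<in> \<Sigma> \<Longrightarrow> inv_into \<Sigma> c (lb e) = l \<longleftrightarrow> lb e = c l"
  using edge_props(2)[of e] shape_graphD(3)[OF H] c
  by (metis imageI inv_into_f_f f_inv_into_f)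

lemma lab_in: "e \<in> Ed \<Longrightarrow> inv_into \<Sigma> c (lb e) \<in> \<Sigma>"
  using edge_props(2)[of e] shape_graphD(3)[OF H] by (metis imageI inv_into_into)

lemma finite_Ed: "finite Ed"
proof -
  have "Ed \<subseteq> (\<lambda>(x, a, y). prod_encode (x, prod_encode (a, y))) ` ({..<N} \<times> {..<N} \<times> {..<N})"
  proof
    fix e assume "e \<in> Ed"
    then have "src e < N" "lb e < N" "tgt e < N" by (auto simp: Ed_def V_def)
    moreover have "e = prod_encode (src e, prod_encode (lb e, tgt e))"
      by (simp add: src_def lb_def tgt_def)
    ultimately show "e \<in> (\<lambda>(x, a, y). prod_encode (x, prod_encode (a, y))) ` ({..<N} \<times> {..<N} \<times> {..<N})"
      by (intro image_eqI[of _ _ "(src e, lb e, tgt e)"]) auto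
  qed
  then show ?thesis by (rule finite_subset) simp
qed

lemma is_graph_G: "is_graph \<Sigma> G"
proof -
  have "finite V" by (simp add: V_def)
  moreover have "src e \<in> V" if "e \<in> Ed" for e using that by (simp add: Ed_def)
  ultimately show ?thesis
    unfolding is_graph_def using finite_Ed edge_props(1) lab_in by (simp add: one_enat_def)
qed

lemma simple_G: "simple_graph \<Sigma> G"
proof -
  have "e = f" if "e \<in> Ed" "f \<in> Ed" "src e = src f" "tgt e = tgt f"
    "inv_into \<Sigma> c (lb e) = inv_into \<Sigma> c (lb f)" for e f
  proof -
    have "lb e = c (inv_into \<Sigma> c (lb f))" using lab_iff[OF that(1) lab_in[OF that(2)]] that(5) by simp
    also have "\<dots> = lb f" using lab_iff[OF that(2) lab_in[OF that(2)]] by simp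
    finally show ?thesis using edge_eqI that by blast
  qed
  then show ?thesis unfolding simple_graph_def using is_graph_G by simp
qed

lemma embeds_H: "G \<preceq> H"
proof -
  define R where "R = {(x, h). x \<in> V \<and> h < N \<and> I 2 [x, h]}"
  have "matches G H (\<lambda>x y. (x, y) \<in> R) x h" if R: "(x, h) \<in> R" for x h
  proof -
    have x: "x \<in> V" "h < N" "I 2 [x, h]" using R by (auto simp: R_def)
    define \<phi> where "\<phi> = (\<lambda>e. SOME f. f < N \<and> I 3 [x, h, lb e, tgt e, f] \<and> f \<in> edges H \<and>
      source H f = h \<and> c (lab H f) = lb e \<and> I 2 [tgt e, target H f] \<and>
      (\<forall>g < N. I 3 [x, h, lb e, tgt e, g] \<longrightarrow> g = f))"
    have \<phi>: "\<phi> e < N \<and> I 3 [x, h, lb e, tgt e, \<phi> e] \<and> \<phi> e \<in> edges H \<and>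
      source H (\<phi> e) = h \<and> c (lab H (\<phi> e)) = lb e \<and> I 2 [tgt e, target H (\<phi> e)] \<and>
      (\<forall>g < N. I 3 [x, h, lb e, tgt e, g] \<longrightarrow> g = \<phi> e)" if "e \<in> out G x" for e
      unfolding \<phi>_def by (rule someI_ex) (rule image_edge[OF that x(2,3)])
    have 1: "\<phi> e \<in> allowed G H (\<lambda>x y. (x, y) \<in> R) h e" if e: "e \<in> out G x" for e
    proof -
      have eE: "e \<in> Ed" using e by (simp add: out_def)
      note p = \<phi>[OF e]
      have "target H (\<phi> e) < N" using shape_graphD(2)[OF H] p smallH unfolding small_def by blast
      then have "(tgt e, target H (\<phi> e)) \<in> R" using edge_props(1)[OF eE] p by (simp add: R_def)
      moreover have "inv_into \<Sigma> c (lb e) = lab H (\<phi> e)"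
        using lab_iff[OF eE] shape_graphD(3)[OF H] p by metis
      ultimately show ?thesis using p by (simp add: allowed_def out_def[of H])
    qed
    have cx: "cex_H c N H I x h" using cexHD x by blast
    have 2: "obeys G H x h \<phi>"
      unfolding obeys_def
    proof (intro ballI conjI impI)
      fix f assume f: "f \<in> out H h" and r: "req H f"
      have fE: "f \<in> edges H" "source H f = h" using f by (auto simp: out_def)
      have fN: "f < N" "outf c N H h f" using outH fE by blast+
      then obtain a y where a: "a < N" "y < N" "I 1 [x, a, y]" "I 3 [x, h, a, y, f]"
        using cex_H_D(2)[OF cx _ _ r] by blast
      then obtain e where "e \<in> out G x" "lb e = a" "tgt e = y" using edge_in x(1) by blast
      then show "\<exists>e \<in> out G x. \<phi> e = f" using \<phi> a fN(1) by metis
    next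
      fix f e e' assume f: "f \<in> out H h" and r: "\<not> unb H f" and e: "e \<in> out G x" "e' \<in> out G x"
        "\<phi> e = f" "\<phi> e' = f"
      have fE: "f \<in> edges H" "source H f = h" using f by (auto simp: out_def)
      have fN: "f < N" "outf c N H h f" using outH fE by blast+
      have "lb e = lb e' \<and> tgt e = tgt e'"
        by (rule cex_H_D(3)[OF cx fN r]) (use outD[OF e(1)] outD[OF e(2)] \<phi>[OF e(1)] \<phi>[OF e(2)] e(3,4) in simp_all)
      then show "e = e'" using outD[OF e(1)] outD[OF e(2)] edge_eqI[of e e'] by simp
    qed
    show ?thesis unfolding matches_def using 1 2 by blast
  qed
  moreover have "R \<subseteq> nodes G \<times> nodes H"
    using cexHD unfolding R_def cex_H_def by auto
  ultimately have "simulation G H R"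
    unfolding simulation_iff[OF simple_G H] by blast
  moreover have "Domain R = nodes G" unfolding R_def by (auto simp: V_def)
  ultimately show ?thesis unfolding embeds_def embedding_def by blast
qed

text \<open>Choice turns \<open>I 7\<close> into an injection between the two sets to be compared,
  and the element that it misses makes the inequality strict.\<close>

lemma obstructed_K:
  assumes x: "x \<in> V" and k: "k < N" "I 4 [x, k]"
  shows "obstructed G K (\<lambda>y t. \<not> I 4 [y, t]) x k {f. f < N \<and> I 6 [x, k, f]}"
proof -
  let ?X = "{f. f < N \<and> I 6 [x, k, f]}" and ?A = "allowed G K (\<lambda>y t. \<not> I 4 [y, t]) k"
  have A: "f \<in> ?A e \<longleftrightarrow> f < N \<and> allw c N K I k (lb e) (tgt e) f" if e: "e \<in> out G x" for e f
  proof -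
    have eE: "e \<in> Ed" using e by (simp add: out_def)
    show ?thesis
    proof (cases "f \<in> edges K")
      case True
      then have f: "f < N" "target K f < N"
        using shape_graphD(2)[OF K] smallK unfolding small_def by blast+
      have "inv_into \<Sigma> c (lb e) = lab K f \<longleftrightarrow> lb e = c (lab K f)"
        by (rule lab_iff[OF eE shape_graphD(3)[OF K True]])
      moreover have "f \<in> out K k \<longleftrightarrow> source K f = k" using True by (simp add: out_def)
      ultimately have "f \<in> ?A e \<longleftrightarrow> source K f = k \<and> lb e = c (lab K f) \<and> \<not> I 4 [tgt e, target K f]"
        by (simp add: allowed_def)
      also have "\<dots> \<longleftrightarrow> f < N \<and> allw c N K I k (lb e) (tgt e) f"
      proof
        assume "source K f = k \<and> lb e = c (lab K f) \<and> \<not> I 4 [tgt e, target K f]"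
        then have "edat c K f k (target K f) (lb e) \<and> \<not> I 4 [tgt e, target K f]"
          using True by (simp add: edat_def)
        then show "f < N \<and> allw c N K I k (lb e) (tgt e) f"
          using f unfolding allw_def by blast
      next
        assume "f < N \<and> allw c N K I k (lb e) (tgt e) f"
        then show "source K f = k \<and> lb e = c (lab K f) \<and> \<not> I 4 [tgt e, target K f]"
          unfolding allw_def edat_def by auto
      qed
      finally show ?thesis .
    next
      case False
      then show ?thesis by (simp add: allowed_def allw_def edat_def out_def)
    qed
  qed
  have fin: "finite (out G x)" by (rule finite_out[OF is_graph_G])
  have outK: "f \<in> out K k" if "outf c N K k f" for f
    using that unfolding outf_def edat_def by (auto simp: out_def)
  have cexK: "(I 5 [x, k] \<longrightarrow> cex_under c N K I x k) \<and> (\<not> I 5 [x, k] \<longrightarrow> cex_over c N K I x k)"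
    using cex k nodeD[OF x] unfolding cex_def by blast
  show ?thesis
  proof (cases "I 5 [x, k]")
    case True
    then have u: "cex_under c N K I x k" using cexK by blast
    let ?Y = "{e \<in> out G x. ?A e \<inter> ?X \<noteq> {}}"
    have "\<exists>f. f < N \<and> I 6 [x, k, f] \<and> I 7 [x, k, lb e, tgt e, f] \<and>
      (\<forall>b < N. \<forall>z < N. I 7 [x, k, b, z, f] \<longrightarrow> b = lb e \<and> z = tgt e)" if "e \<in> ?Y" for e
    proof -
      have e: "e \<in> out G x" "\<exists>f. f \<in> ?A e \<and> f \<in> ?X" using that by blast+
      then have "\<exists>f < N. I 6 [x, k, f] \<and> allw c N K I k (lb e) (tgt e) f" using A[OF e(1)] by blast
      then show ?thesis using u outD[OF e(1)] unfolding cex_under_def by blast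
    qed
    then have "\<forall>e \<in> ?Y. \<exists>f. f < N \<and> I 6 [x, k, f] \<and> I 7 [x, k, lb e, tgt e, f] \<and>
      (\<forall>b < N. \<forall>z < N. I 7 [x, k, b, z, f] \<longrightarrow> b = lb e \<and> z = tgt e)" by (intro ballI)
    from bchoice[OF this] obtain j where "\<forall>e \<in> ?Y. j e < N \<and> I 6 [x, k, j e] \<and>
      I 7 [x, k, lb e, tgt e, j e] \<and> (\<forall>b < N. \<forall>z < N. I 7 [x, k, b, z, j e] \<longrightarrow> b = lb e \<and> z = tgt e)" ..
    note j = bspec[OF this]
    obtain f0 where f0: "f0 \<in> ?X" "\<forall>a < N. \<forall>y < N. \<not> I 7 [x, k, a, y, f0]"
      using u unfolding cex_under_def by blast
    have "inj_on j ?Y"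
    proof (rule inj_onI)
      fix e e' assume e: "e \<in> ?Y" "e' \<in> ?Y" "j e = j e'"
      then have o: "e \<in> out G x" "e' \<in> out G x" by blast+
      have "I 7 [x, k, lb e', tgt e', j e]" using j[OF e(2)] e(3) by simp
      then have "lb e' = lb e \<and> tgt e' = tgt e" using j[OF e(1)] outD[OF o(2)] by blast
      then show "e = e'" using outD[OF o(1)] outD[OF o(2)] edge_eqI[of e e'] by simp
    qed
    moreover have "j ` ?Y \<subseteq> ?X - {f0}"
    proof
      fix f assume "f \<in> j ` ?Y"
      then obtain e where e: "e \<in> ?Y" "f = j e" by blast
      then have "e \<in> out G x" by blast
      then show "f \<in> ?X - {f0}" using j[OF e(1)] f0(2) outD[of e x] e(2) by blast
    qed
    ultimately have "card ?Y \<le> card (?X - {f0})" by (intro card_inj_on_le) auto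
    also have "\<dots> < card ?X" using f0(1) by (intro psubset_card_mono) auto
    finally show ?thesis
      using u outK unfolding cex_under_def obstructed_def by blast
  next
    case False
    then have u: "cex_over c N K I x k" using cexK by blast
    let ?Y = "{e \<in> out G x. ?A e \<subseteq> ?X}"
    have in_Y: "\<exists>e \<in> ?Y. lb e = a \<and> tgt e = y" if ay: "a < N" "y < N" "inside c N K I x k a y" for a y
    proof -
      have "I 1 [x, a, y]" using ay(3) unfolding inside_def by blast
      then obtain e where e: "e \<in> out G x" "lb e = a" "tgt e = y" using edge_in[OF x ay(1,2)] by blast
      then have "?A e \<subseteq> ?X" using A[OF e(1)] ay(3) e(2,3) unfolding inside_def by auto
      then show ?thesis using e by blast
    qed
    have "\<exists>e \<in> ?Y. I 7 [x, k, lb e, tgt e, f] \<and> (\<forall>g < N. I 7 [x, k, lb e, tgt e, g] \<longrightarrow> g = f)"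
      if f_X: "f \<in> ?X" for f
    proof -
      obtain a y where a: "a < N" "y < N" "inside c N K I x k a y" "I 7 [x, k, a, y, f]"
        "\<forall>g < N. I 7 [x, k, a, y, g] \<longrightarrow> g = f"
        using u f_X unfolding cex_over_def by blast
      obtain e where e: "e \<in> ?Y" "lb e = a" "tgt e = y" using in_Y[OF a(1-3)] by blast
      show ?thesis by (rule bexI[OF _ e(1)]) (use a e in simp)
    qed
    then have "\<forall>f \<in> ?X. \<exists>e. e \<in> ?Y \<and> I 7 [x, k, lb e, tgt e, f] \<and>
      (\<forall>g < N. I 7 [x, k, lb e, tgt e, g] \<longrightarrow> g = f)" unfolding Bex_def by (intro ballI)
    from bchoice[OF this] obtain j where "\<forall>f \<in> ?X. j f \<in> ?Y \<and> I 7 [x, k, lb (j f), tgt (j f), f] \<and>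
      (\<forall>g < N. I 7 [x, k, lb (j f), tgt (j f), g] \<longrightarrow> g = f)" ..
    note j = bspec[OF this]
    obtain a0 y0 where 0: "a0 < N" "y0 < N" "inside c N K I x k a0 y0" "\<forall>f < N. \<not> I 7 [x, k, a0, y0, f]"
      using u unfolding cex_over_def by blast
    obtain e0 where e0: "e0 \<in> ?Y" "lb e0 = a0" "tgt e0 = y0" using in_Y[OF 0(1-3)] by blast
    have "inj_on j ?X"
    proof (rule inj_onI)
      fix f f' assume f: "f \<in> ?X" "f' \<in> ?X" "j f = j f'"
      then have "f' < N" by blast
      moreover have "I 7 [x, k, lb (j f), tgt (j f), f']" using j[OF f(2)] f(3) by simp
      ultimately show "f = f'" using j[OF f(1)] by blast
    qed
    moreover have "j ` ?X \<subseteq> ?Y - {e0}"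
    proof
      fix e assume "e \<in> j ` ?X"
      then obtain f where f: "f \<in> ?X" "e = j f" by blast
      have "e \<noteq> e0"
      proof
        assume "e = e0"
        then have "I 7 [x, k, a0, y0, f]" using j[OF f(1)] f(2) e0 by simp
        then show False using 0(4) f(1) by blast
      qed
      then show "e \<in> ?Y - {e0}" using j[OF f(1)] f(2) by blast
    qed
    moreover have fY: "finite ?Y" using fin by simp
    ultimately have "card ?X \<le> card (?Y - {e0})" by (intro card_inj_on_le) auto
    also have "\<dots> < card ?Y" using e0(1) fY by (intro psubset_card_mono) auto
    finally show ?thesis
      using u outK unfolding cex_over_def obstructed_def by blast
  qed
qed

lemma not_embeds_K: "\<not> G \<preceq> K"
proof
  assume "G \<preceq> K"
  then obtain R where R: "simulation G K R" "Domain R = V"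
    unfolding embeds_def embedding_def by auto
  have sim: "R \<subseteq> V \<times> nodes K" "\<And>x k. (x, k) \<in> R \<Longrightarrow> matches G K (\<lambda>x y. (x, y) \<in> R) x k"
    using R(1) unfolding simulation_iff[OF simple_G K] by auto
  have "is_graph \<Sigma> K" using K unfolding shape_graph_def by (rule conjunct1)
  note fin = finite_out[OF is_graph_G] finite_out[OF this]
  \<comment> \<open>A claim at \<open>x\<close> sends all edges of \<open>x\<close> to smaller
    numbers. There the induction hypothesis puts \<open>R\<close> inside the complement of the
    claims, so the obstruction to the complement also refutes the matching that \<open>R\<close>
    would need at \<open>x\<close>.\<close>
  have *: "\<not> I 4 [x, k]" if "(x, k) \<in> R" for x k
    using that
  proof (induction x arbitrary: k rule: less_induct)
    case (less x)
    have x: "x \<in> V" and k: "k < N" using less.prems sim(1) smallK unfolding small_def by blast+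
    show ?case
    proof
      assume I4: "I 4 [x, k]"
      have "matches G K (\<lambda>y t. \<not> I 4 [y, t]) x k"
      proof (rule matches_mono[OF sim(2)[OF less.prems]])
        fix e t assume e: "e \<in> out G x" "(target G e, t) \<in> R"
        have "tgt e < x" using outD[OF e(1)] cex I4 k nodeD[OF x] unfolding cex_def by blast
        then show "\<not> I 4 [target G e, t]" using less.IH e(2) by simp
      qed
      then show False using obstructed_not_matches[OF fin obstructed_K[OF x k I4]] by blast
    qed
  qed
  obtain x where x: "x < N" "\<exists>h < N. I 2 [x, h]" "\<forall>k < N. k \<in> nodes K \<longrightarrow> I 4 [x, k]"
    using cex unfolding cex_def by blast
  then have "x \<in> Domain R" using R(2) by (simp add: V_def)
  then obtain k where "(x, k) \<in> R" by blast
  moreover have "k < N" "k \<in> nodes K" using \<open>(x, k) \<in> R\<close> sim(1) smallK unfolding small_def by blast+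
  ultimately show False using * x(3) by blast
qed

lemma not_contained: "\<not> lang \<Sigma> H \<subseteq> lang \<Sigma> K"
  using simple_G embeds_H not_embeds_K unfolding lang_def by blast

end

section \<open>Small counterexamples\<close>

text \<open>The comparisons demanded by \<open>cex_under\<close> and \<open>cex_over\<close>, for
  edges and elements of any type, before the nodes of the small graph have been numbered.\<close>

definition under_ev :: "'e set \<Rightarrow> ('e \<Rightarrow> 'f set) \<Rightarrow> 'f set \<Rightarrow> ('e \<Rightarrow> 'f \<Rightarrow> bool) \<Rightarrow> bool" where
  "under_ev W A X J \<longleftrightarrow> (\<forall>e \<in> W. A e \<inter> X \<noteq> {} \<longrightarrow> (\<exists>f \<in> X. J e f \<and> (\<forall>e' \<in> W. J e' f \<longrightarrow> e' = e))) \<and>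
     (\<exists>f \<in> X. \<forall>e \<in> W. \<not> J e f)"

definition over_ev :: "'e set \<Rightarrow> ('e \<Rightarrow> 'f set) \<Rightarrow> 'f set \<Rightarrow> ('e \<Rightarrow> 'f \<Rightarrow> bool) \<Rightarrow> bool" where
  "over_ev W A X J \<longleftrightarrow> (\<forall>f \<in> X. \<exists>e \<in> W. A e \<subseteq> X \<and> J e f \<and> (\<forall>g. J e g \<longrightarrow> g = f)) \<and>
     (\<exists>e \<in> W. A e \<subseteq> X \<and> (\<forall>f. \<not> J e f))"

lemma card_less_inj:
  assumes "finite X" "finite Y" "card X < card Y"
  shows "\<exists>j. inj_on j X \<and> j ` X \<subset> Y"
proof -
  obtain j where j: "j ` X \<subseteq> Y" "inj_on j X"
    using card_le_inj[OF assms(1,2)] assms(3) by auto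
  moreover have "j ` X \<noteq> Y" using card_image[OF j(2)] assms(3) by auto
  ultimately show ?thesis by blast
qed

lemma under_evI:
  assumes "finite W" "finite X" "card {e \<in> W. A e \<inter> X \<noteq> {}} < card X"
  shows "\<exists>J. under_ev W A X J"
proof -
  let ?Y = "{e \<in> W. A e \<inter> X \<noteq> {}}"
  obtain j where j: "inj_on j ?Y" "j ` ?Y \<subset> X"
    using card_less_inj[OF _ assms(2,3)] assms(1) by auto
  let ?J = "\<lambda>e f. e \<in> ?Y \<and> f = j e"
  have "\<exists>f \<in> X. ?J e f \<and> (\<forall>e' \<in> W. ?J e' f \<longrightarrow> e' = e)" if "e \<in> W" "A e \<inter> X \<noteq> {}" for e
    using that j by (intro bexI[of _ "j e"]) (auto dest: inj_onD)
  moreover obtain f where "f \<in> X" "f \<notin> j ` ?Y" using j(2) by blast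
  then have "\<exists>f \<in> X. \<forall>e \<in> W. \<not> ?J e f" by (intro bexI[of _ f]) auto
  ultimately have "under_ev W A X ?J" unfolding under_ev_def by blast
  then show ?thesis by blast
qed

lemma over_evI:
  assumes "finite W" "finite X" "card X < card {e \<in> W. A e \<subseteq> X}"
  shows "\<exists>J. over_ev W A X J"
proof -
  let ?Y = "{e \<in> W. A e \<subseteq> X}"
  obtain j where j: "inj_on j X" "j ` X \<subset> ?Y"
    using card_less_inj[OF assms(2) _ assms(3)] assms(1) by auto
  let ?J = "\<lambda>e f. f \<in> X \<and> e = j f"
  have "\<exists>e \<in> W. A e \<subseteq> X \<and> ?J e f \<and> (\<forall>g. ?J e g \<longrightarrow> g = f)" if "f \<in> X" for f
  proof -
    have "j f \<in> ?Y" using j(2) that by blast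
    then show ?thesis using that j(1) by (intro bexI[of _ "j f"]) (auto dest: inj_onD)
  qed
  moreover obtain e where "e \<in> ?Y" "e \<notin> j ` X" using j(2) by blast
  then have "\<exists>e \<in> W. A e \<subseteq> X \<and> (\<forall>f. \<not> ?J e f)" by (intro bexI[of _ e]) auto
  ultimately have "over_ev W A X ?J" unfolding over_ev_def by blast
  then show ?thesis by blast
qed

text \<open>Deleting edges preserves a shortage, so nothing has to be kept for it; an excess over
  \<open>X\<close> is witnessed by \<open>card X + 1\<close> edges. The claim is for all
  \<open>W'\<close> above \<open>W\<close> because the edges kept for the other nodes of
  \<open>H\<close> and \<open>K\<close> are present as well.\<close>

lemma keep_obstruction:
  assumes fin: "finite (out G n)" "finite (out K k)" and X: "obstructed G K R n k X"
  shows "\<exists>W. W \<subseteq> out G n \<and> card W \<le> card (out K k) + 1 \<and> (\<forall>W'. W \<subseteq> W' \<and> W' \<subseteq> out G n \<longrightarrow>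
    (\<forall>f \<in> X. req K f) \<and> (\<exists>J. under_ev W' (allowed G K R k) X J) \<or>
    (\<forall>f \<in> X. \<not> unb K f) \<and> (\<exists>J. over_ev W' (allowed G K R k) X J))"
proof -
  let ?A = "allowed G K R k"
  have XK: "X \<subseteq> out K k" using X unfolding obstructed_def by blast
  then have fX: "finite X" using fin(2) finite_subset by blast
  consider (under) "\<forall>f \<in> X. req K f" "card {e \<in> out G n. ?A e \<inter> X \<noteq> {}} < card X"
    | (over) "\<forall>f \<in> X. \<not> unb K f" "card X < card {e \<in> out G n. ?A e \<subseteq> X}"
    using X unfolding obstructed_def by blast
  then show ?thesis
  proof cases
    case under
    have "\<exists>J. under_ev W' ?A X J" if W': "W' \<subseteq> out G n" for W'
    proof (rule under_evI[OF finite_subset[OF W' fin(1)] fX])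
      have "card {e \<in> W'. ?A e \<inter> X \<noteq> {}} \<le> card {e \<in> out G n. ?A e \<inter> X \<noteq> {}}"
        using W' fin(1) by (intro card_mono) auto
      then show "card {e \<in> W'. ?A e \<inter> X \<noteq> {}} < card X" using under(2) by simp
    qed
    then show ?thesis using under(1) by (intro exI[of _ "{}"]) simp
  next
    case over
    then have "Suc (card X) \<le> card {e \<in> out G n. ?A e \<subseteq> X}" by simp
    then obtain W where W: "W \<subseteq> {e \<in> out G n. ?A e \<subseteq> X}" "card W = Suc (card X)"
      by (rule obtain_subset_with_card_n)
    have "\<exists>J. over_ev W' ?A X J" if W': "W \<subseteq> W'" "W' \<subseteq> out G n" for W'
    proof (rule over_evI[OF finite_subset[OF W'(2) fin(1)] fX])
      have "card W \<le> card {e \<in> W'. ?A e \<subseteq> X}"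
      proof (rule card_mono)
        show "finite {e \<in> W'. ?A e \<subseteq> X}" using finite_subset[OF W'(2) fin(1)] by simp
        show "W \<subseteq> {e \<in> W'. ?A e \<subseteq> X}" using W(1) W'(1) by blast
      qed
      then show "card X < card {e \<in> W'. ?A e \<subseteq> X}" using W(2) by simp
    qed
    moreover have "card X \<le> card (out K k)" using XK fin(2) by (intro card_mono)
    moreover have "W \<subseteq> out G n" using W(1) by blast
    ultimately show ?thesis using over(1) W(2) by (intro exI[of _ W]) simp
  qed
qed

text \<open>One edge for each required \<open>f\<close> suffices: the condition on bounded edges is
  inherited by subsets, so the same assignment works for every set of edges between \<open>W\<close>
  and \<open>out G n\<close>.\<close>

lemma keep_matching:
  assumes fin: "finite (out H h)" and m: "matches G H R n h"
  shows "\<exists>W \<phi>. W \<subseteq> out G n \<and> card W \<le> card (out H h) \<and>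
    (\<forall>e \<in> out G n. \<phi> e \<in> allowed G H R h e) \<and> (\<forall>f \<in> out H h. (req H f \<longrightarrow> (\<exists>e \<in> W. \<phi> e = f)) \<and>
      (\<not> unb H f \<longrightarrow> (\<forall>e \<in> out G n. \<forall>e' \<in> out G n. \<phi> e = f \<longrightarrow> \<phi> e' = f \<longrightarrow> e = e')))"
proof -
  obtain \<phi> where \<phi>: "\<forall>e \<in> out G n. \<phi> e \<in> allowed G H R h e" "obeys G H n h \<phi>"
    using m unfolding matches_def by blast
  have "\<forall>f \<in> {f \<in> out H h. req H f}. \<exists>e. e \<in> out G n \<and> \<phi> e = f"
    using \<phi>(2) unfolding obeys_def by blast
  from bchoice[OF this] obtain w where w: "\<forall>f \<in> {f \<in> out H h. req H f}. w f \<in> out G n \<and> \<phi> (w f) = f" ..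
  let ?W = "w ` {f \<in> out H h. req H f}"
  have "card ?W \<le> card {f \<in> out H h. req H f}" using fin by (intro card_image_le) simp
  also have "\<dots> \<le> card (out H h)" using fin by (intro card_mono) auto
  finally have "card ?W \<le> card (out H h)" .
  moreover have "?W \<subseteq> out G n" using w by blast
  moreover have "\<exists>e \<in> ?W. \<phi> e = f" if "f \<in> out H h" "req H f" for f
    using that w by (intro bexI[of _ "w f"]) auto
  ultimately show ?thesis using \<phi> unfolding obeys_def by (intro exI[of _ ?W] exI[of _ \<phi>]) blast
qed

text \<open>Elements of maximal rank receive the largest numbers. Such a numbering turns a drop in
  rank into the drop in numbers that certificates demand.\<close>

lemma rank_enumeration:
  fixes g :: "'a \<Rightarrow> nat"
  assumes "finite X"
  shows "\<exists>enc. inj_on enc X \<and> enc ` X \<subseteq> {..<card X} \<and>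
    (\<forall>x \<in> X. \<forall>y \<in> X. g x < g y \<longrightarrow> enc x < (enc y :: nat))"
  using assms
proof (induction "card X" arbitrary: X)
  case (Suc n)
  then have "X \<noteq> {}" by auto
  then obtain m where m: "m \<in> X" "\<forall>x \<in> X. g x \<le> g m"
    using Max_in[of "g ` X"] Max_ge[of "g ` X"] Suc.prems by fastforce
  have "n = card (X - {m})" using Suc.hyps(2) m(1) Suc.prems by simp
  then obtain enc where enc: "inj_on enc (X - {m})" "enc ` (X - {m}) \<subseteq> {..<n}"
    "\<forall>x \<in> X - {m}. \<forall>y \<in> X - {m}. g x < g y \<longrightarrow> enc x < enc y"
    using Suc.hyps(1)[of "X - {m}"] Suc.prems by auto
  let ?enc = "enc(m := n)"
  have less: "enc x < n" if "x \<in> X" "x \<noteq> m" for x using enc(2) that by auto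
  have "inj_on ?enc X"
    using enc(1) less by (auto simp: inj_on_def)
  moreover have "?enc ` X \<subseteq> {..<Suc n}" using less by (auto simp: less_Suc_eq)
  moreover have "?enc x < ?enc y" if "x \<in> X" "y \<in> X" "g x < g y" for x y
    using that enc(3) less[of x] m(2) by (cases "x = m"; cases "y = m") (auto simp: not_less[symmetric])
  ultimately show ?case using Suc.hyps(2) by (intro exI[of _ ?enc]) auto
qed auto

text \<open>The assumption \<open>N\<close> makes room for all pairs of a set of nodes of
  \<open>H\<close> and a set of nodes of \<open>K\<close>, times the number \<open>B\<close> of
  copies.\<close>

locale counterexample =
  fixes \<Sigma> :: "'l set" and c :: "'l \<Rightarrow> nat" and N :: nat and H K :: "(nat, nat, 'l) graph"
    and G :: "(nat, nat, 'l) graph" and RH :: "(nat \<times> nat) set"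
  assumes c: "inj_on c \<Sigma>" and H: "shape_graph \<Sigma> H" and K: "shape_graph \<Sigma> K"
    and smallH: "small c N H" and smallK: "small c N K"
    and G: "simple_graph \<Sigma> G" and RH: "embedding G H RH" and not_K: "\<not> G \<preceq> K"
    and N: "2 ^ (card (nodes H) + card (nodes K)) *
      (card (nodes H) * card (edges H) + card (nodes K) * (card (edges K) + 1) + 1) \<le> N"
begin

text \<open>A node keeps at most \<open>card (edges H)\<close> edges for each node of
  \<open>H\<close> and \<open>card (edges K) + 1\<close> for each node of \<open>K\<close>. The last
  summand makes \<open>B\<close> a strict bound, and positive.\<close>

definition "B = card (nodes H) * card (edges H) + card (nodes K) * (card (edges K) + 1) + 1"

definition "T n = {h. (n, h) \<in> RH}"

primrec SS :: "nat \<Rightarrow> nat \<Rightarrow> nat set" where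
  "SS 0 n = nodes K"
| "SS (Suc i) n = {k \<in> nodes K. matches G K (\<lambda>y t. t \<in> SS i y) n k}"

lemma graphG: "is_graph \<Sigma> G" using G unfolding simple_graph_def by (rule conjunct1)
lemma graphH: "is_graph \<Sigma> H" using H unfolding shape_graph_def by (rule conjunct1)
lemma graphK: "is_graph \<Sigma> K" using K unfolding shape_graph_def by (rule conjunct1)

lemmas fins = graphG[unfolded is_graph_def, THEN conjunct1] graphH[unfolded is_graph_def, THEN conjunct1]
  graphK[unfolded is_graph_def, THEN conjunct1] graphH[unfolded is_graph_def, THEN conjunct2, THEN conjunct1]
  graphK[unfolded is_graph_def, THEN conjunct2, THEN conjunct1]
  finite_out[OF graphG] finite_out[OF graphH] finite_out[OF graphK]

lemma target_G: "e \<in> out G n \<Longrightarrow> target G e \<in> nodes G"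
  using graphG unfolding is_graph_def out_def by blast

lemma SS_sub: "SS i n \<subseteq> nodes K"
  by (cases i) auto

lemma SS_Suc: "SS (Suc i) n \<subseteq> SS i n"
proof (induction i arbitrary: n)
  case (Suc i)
  have "matches G K (\<lambda>y t. t \<in> SS i y) n k" if "matches G K (\<lambda>y t. t \<in> SS (Suc i) y) n k" for k
    by (rule matches_mono[OF that]) (use Suc in blast)
  then show ?case by auto
qed auto

text \<open>The approximations decrease in finite sets, so at some stage they are stable at all
  nodes of \<open>G\<close> at once. The stable relation is a simulation, and if no approximation
  were empty it would embed \<open>G\<close> in \<open>K\<close>.\<close>

lemma SS_empty: "\<exists>n \<in> nodes G. \<exists>i. SS i n = {}"
proof (rule ccontr)
  assume "\<not> ?thesis"
  then have ne: "SS i n \<noteq> {}" if "n \<in> nodes G" for i n using that by blast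
  define f where "f = (\<lambda>i. \<Sum>n \<in> nodes G. card (SS i n))"
  have fS: "finite (SS i n)" for i n using SS_sub fins(3) finite_subset by blast
  have "\<exists>i. f i \<le> f (Suc i)"
  proof (rule ccontr)
    assume "\<not> ?thesis"
    then have "f (Suc i) < f i" for i by (simp add: not_le)
    then have "\<forall>i. (f (Suc i), f i) \<in> {(x, y). x < y}" by simp
    then show False using wf_less[unfolded wf_iff_no_infinite_down_chain] by blast
  qed
  then obtain i where i: "f i \<le> f (Suc i)" by blast
  have eq: "SS (Suc i) n = SS i n" if n: "n \<in> nodes G" for n
  proof (rule ccontr)
    assume "SS (Suc i) n \<noteq> SS i n"
    then have "card (SS (Suc i) n) < card (SS i n)"
      using SS_Suc fS by (intro psubset_card_mono) blast+
    then have "f (Suc i) < f i"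
      unfolding f_def using n fins(1) SS_Suc fS by (intro sum_strict_mono_ex1) (auto intro!: card_mono)
    then show False using i by simp
  qed
  define R where "R = {(n, k). n \<in> nodes G \<and> k \<in> SS i n}"
  have "matches G K (\<lambda>x y. (x, y) \<in> R) n k" if "(n, k) \<in> R" for n k
  proof -
    have "k \<in> SS (Suc i) n" using that eq unfolding R_def by blast
    then have "matches G K (\<lambda>y t. t \<in> SS i y) n k" by simp
    then show ?thesis by (rule matches_mono) (use target_G in \<open>simp add: R_def\<close>)
  qed
  moreover have "R \<subseteq> nodes G \<times> nodes K" using SS_sub unfolding R_def by blast
  ultimately have "simulation G K R" unfolding simulation_iff[OF G K] by blast
  moreover have "Domain R = nodes G" unfolding R_def using ne by auto
  ultimately show False using not_K unfolding embeds_def embedding_def by blast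
qed

text \<open>\<open>SS i n\<close> is the \<open>i\<close>-th approximation from above of the set of nodes of \<open>K\<close> that simulate \<open>n\<close>. A
  node of the small counterexample is a kind, that is, the set of nodes of \<open>H\<close> that simulate some node
  \<open>n\<close> together with an approximation at \<open>n\<close>; \<open>rep\<close> chooses \<open>n\<close> with the approximation as early as
  possible. Passing from stage \<open>i\<close> to stage \<open>i - 1\<close> along the edges of the representative keeps
  non-simulation well founded; merging nodes that agree on the limit of \<open>SS\<close> would not.\<close>

definition "Kd = {(T n, SS i n) | n i. n \<in> nodes G}"
definition "rk \<kappa> = (LEAST i. \<exists>n \<in> nodes G. T n = fst \<kappa> \<and> SS i n \<subseteq> snd \<kappa>)"
definition "rep \<kappa> = (SOME n. n \<in> nodes G \<and> T n = fst \<kappa> \<and> SS (rk \<kappa>) n \<subseteq> snd \<kappa>)"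
definition "succ \<kappa> y = (T y, SS (rk \<kappa> - 1) y)"
definition "AK \<kappa> k = allowed G K (\<lambda>y t. t \<in> SS (rk \<kappa> - 1) y) k"

lemma T_sub: "T n \<subseteq> nodes H"
  using RH unfolding embedding_def simulation_def T_def by blast

lemma Kd_sub: "Kd \<subseteq> Pow (nodes H) \<times> Pow (nodes K)"
  using T_sub SS_sub unfolding Kd_def by blast

lemma finite_Kd: "finite Kd"
  by (rule finite_subset[OF Kd_sub]) (simp add: fins)

lemma card_Kd: "card Kd \<le> 2 ^ (card (nodes H) + card (nodes K))"
proof -
  have "card Kd \<le> card (Pow (nodes H) \<times> Pow (nodes K))"
    by (rule card_mono[OF _ Kd_sub]) (simp add: fins)
  then show ?thesis by (simp add: card_cartesian_product card_Pow fins power_add)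
qed

lemma rep:
  assumes "\<kappa> \<in> Kd"
  shows "rep \<kappa> \<in> nodes G" "T (rep \<kappa>) = fst \<kappa>" "SS (rk \<kappa>) (rep \<kappa>) \<subseteq> snd \<kappa>"
proof -
  have "\<exists>i. \<exists>n \<in> nodes G. T n = fst \<kappa> \<and> SS i n \<subseteq> snd \<kappa>"
    using assms unfolding Kd_def by fastforce
  then have "\<exists>n \<in> nodes G. T n = fst \<kappa> \<and> SS (rk \<kappa>) n \<subseteq> snd \<kappa>"
    unfolding rk_def by (rule LeastI_ex)
  then have "rep \<kappa> \<in> nodes G \<and> T (rep \<kappa>) = fst \<kappa> \<and> SS (rk \<kappa>) (rep \<kappa>) \<subseteq> snd \<kappa>"
    unfolding rep_def Bex_def by (rule someI_ex)
  then show "rep \<kappa> \<in> nodes G" "T (rep \<kappa>) = fst \<kappa>" "SS (rk \<kappa>) (rep \<kappa>) \<subseteq> snd \<kappa>" by simp_all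
qed

lemma succ_Kd: "y \<in> nodes G \<Longrightarrow> succ \<kappa> y \<in> Kd"
  unfolding succ_def Kd_def by blast

lemma rk_succ: "y \<in> nodes G \<Longrightarrow> rk (succ \<kappa> y) \<le> rk \<kappa> - 1"
  unfolding rk_def[of "succ \<kappa> y"] by (rule Least_le) (auto simp: succ_def)

text \<open>Stage 0 is all of \<open>nodes K\<close>, so a missing \<open>k\<close> forces a
  positive stage, and unfolding that stage once shows why \<open>k\<close> is missing.\<close>

lemma not_in_kind:
  assumes "\<kappa> \<in> Kd" and "k \<in> nodes K - snd \<kappa>"
  shows "rk \<kappa> > 0" "\<not> matches G K (\<lambda>y t. t \<in> SS (rk \<kappa> - 1) y) (rep \<kappa>) k"
proof -
  have k: "k \<notin> SS (rk \<kappa>) (rep \<kappa>)" "k \<in> nodes K" using rep(3)[OF assms(1)] assms(2) by blast+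
  show pos: "rk \<kappa> > 0"
  proof (rule ccontr)
    assume "\<not> rk \<kappa> > 0"
    then have "rk \<kappa> = 0" by simp
    then show False using k by simp
  qed
  then obtain r where "rk \<kappa> = Suc r" using gr0_conv_Suc by blast
  then show "\<not> matches G K (\<lambda>y t. t \<in> SS (rk \<kappa> - 1) y) (rep \<kappa>) k" using k by simp
qed

lemma sum_card_le:
  assumes "A \<subseteq> C" "finite C" "\<And>x. x \<in> A \<Longrightarrow> card (W x) \<le> b"
  shows "card (\<Union>x \<in> A. W x) \<le> card C * b"
proof -
  have "finite A" using assms finite_subset by blast
  then have "card (\<Union>x \<in> A. W x) \<le> (\<Sum>x \<in> A. card (W x))" by (rule card_UN_le)
  also have "\<dots> \<le> of_nat (card A) * b" by (rule sum_bounded_above) (use assms in blast)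
  also have "\<dots> \<le> card C * b" using assms by (simp add: card_mono)
  finally show ?thesis .
qed

text \<open>Everything a kind contributes to the certificate, with one set \<open>W\<close> of kept
  edges for all \<open>h\<close> and \<open>k\<close>: \<open>\<Phi>\<close> becomes relation 3,
  \<open>X\<close> relation 6, \<open>U\<close> relation 5 and \<open>J\<close> relation 7.\<close>

definition "evid \<kappa> W \<Phi> X U J \<longleftrightarrow> W \<subseteq> out G (rep \<kappa>) \<and> card W < B \<and>
    (\<forall>h \<in> fst \<kappa>. (\<forall>e \<in> W. \<Phi> h e \<in> allowed G H (\<lambda>x y. (x, y) \<in> RH) h e) \<and>
      (\<forall>f \<in> out H h. (req H f \<longrightarrow> (\<exists>e \<in> W. \<Phi> h e = f)) \<and>
        (\<not> unb H f \<longrightarrow> (\<forall>e \<in> W. \<forall>e' \<in> W. \<Phi> h e = f \<longrightarrow> \<Phi> h e' = f \<longrightarrow> e = e')))) \<and>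
    (\<forall>k \<in> nodes K - snd \<kappa>. X k \<subseteq> out K k \<and>
      (U k \<longrightarrow> (\<forall>f \<in> X k. req K f) \<and> under_ev W (AK \<kappa> k) (X k) (J k)) \<and>
      (\<not> U k \<longrightarrow> (\<forall>f \<in> X k. \<not> unb K f) \<and> over_ev W (AK \<kappa> k) (X k) (J k)))"

lemma local_evidence:
  assumes \<kappa>: "\<kappa> \<in> Kd"
  shows "\<exists>W \<Phi> X U J. evid \<kappa> W \<Phi> X U J"
proof -
  let ?n = "rep \<kappa>" and ?R = "\<lambda>x y. (x, y) \<in> RH"
  have "\<forall>h \<in> fst \<kappa>. \<exists>p. fst p \<subseteq> out G ?n \<and> card (fst p) \<le> card (out H h) \<and>
    (\<forall>e \<in> out G ?n. snd p e \<in> allowed G H ?R h e) \<and> (\<forall>f \<in> out H h. (req H f \<longrightarrow> (\<exists>e \<in> fst p. snd p e = f)) \<and>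
      (\<not> unb H f \<longrightarrow> (\<forall>e \<in> out G ?n. \<forall>e' \<in> out G ?n. snd p e = f \<longrightarrow> snd p e' = f \<longrightarrow> e = e')))"
  proof
    fix h assume "h \<in> fst \<kappa>"
    then have "(?n, h) \<in> RH" using rep(2)[OF \<kappa>] unfolding T_def by blast
    moreover have "simulation G H RH" using RH unfolding embedding_def by (rule conjunct1)
    ultimately have "matches G H ?R ?n h" unfolding simulation_iff[OF G H] by blast
    from keep_matching[OF fins(7) this]
    show "\<exists>p. fst p \<subseteq> out G ?n \<and> card (fst p) \<le> card (out H h) \<and>
      (\<forall>e \<in> out G ?n. snd p e \<in> allowed G H ?R h e) \<and> (\<forall>f \<in> out H h. (req H f \<longrightarrow> (\<exists>e \<in> fst p. snd p e = f)) \<and>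
      (\<not> unb H f \<longrightarrow> (\<forall>e \<in> out G ?n. \<forall>e' \<in> out G ?n. snd p e = f \<longrightarrow> snd p e' = f \<longrightarrow> e = e')))"
      by (simp only: split_paired_Ex fst_conv snd_conv)
  qed
  from bchoice[OF this] obtain p where "\<forall>h \<in> fst \<kappa>. fst (p h) \<subseteq> out G ?n \<and> card (fst (p h)) \<le> card (out H h) \<and>
    (\<forall>e \<in> out G ?n. snd (p h) e \<in> allowed G H ?R h e) \<and> (\<forall>f \<in> out H h. (req H f \<longrightarrow> (\<exists>e \<in> fst (p h). snd (p h) e = f)) \<and>
      (\<not> unb H f \<longrightarrow> (\<forall>e \<in> out G ?n. \<forall>e' \<in> out G ?n. snd (p h) e = f \<longrightarrow> snd (p h) e' = f \<longrightarrow> e = e')))" ..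
  note p = bspec[OF this]
  have "\<forall>k \<in> nodes K - snd \<kappa>. \<exists>q. fst q \<subseteq> out K k \<and> snd q \<subseteq> out G ?n \<and> card (snd q) \<le> card (out K k) + 1 \<and>
    (\<forall>W'. snd q \<subseteq> W' \<and> W' \<subseteq> out G ?n \<longrightarrow>
    (\<forall>f \<in> fst q. req K f) \<and> (\<exists>J. under_ev W' (AK \<kappa> k) (fst q) J) \<or>
    (\<forall>f \<in> fst q. \<not> unb K f) \<and> (\<exists>J. over_ev W' (AK \<kappa> k) (fst q) J))"
  proof
    fix k assume "k \<in> nodes K - snd \<kappa>"
    then obtain X where X: "obstructed G K (\<lambda>y t. t \<in> SS (rk \<kappa> - 1) y) ?n k X"
      using not_matches_obstructed[OF fins(6) fins(8) not_in_kind(2)[OF \<kappa>]] by blast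
    then have "X \<subseteq> out K k" unfolding obstructed_def by (rule conjunct1)
    with keep_obstruction[OF fins(6) fins(8) X]
    show "\<exists>q. fst q \<subseteq> out K k \<and> snd q \<subseteq> out G ?n \<and> card (snd q) \<le> card (out K k) + 1 \<and>
    (\<forall>W'. snd q \<subseteq> W' \<and> W' \<subseteq> out G ?n \<longrightarrow>
    (\<forall>f \<in> fst q. req K f) \<and> (\<exists>J. under_ev W' (AK \<kappa> k) (fst q) J) \<or>
    (\<forall>f \<in> fst q. \<not> unb K f) \<and> (\<exists>J. over_ev W' (AK \<kappa> k) (fst q) J))"
      unfolding AK_def split_paired_Ex fst_conv snd_conv by blast
  qed
  from bchoice[OF this] obtain q where "\<forall>k \<in> nodes K - snd \<kappa>. fst (q k) \<subseteq> out K k \<and> snd (q k) \<subseteq> out G ?n \<and>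
    card (snd (q k)) \<le> card (out K k) + 1 \<and> (\<forall>W'. snd (q k) \<subseteq> W' \<and> W' \<subseteq> out G ?n \<longrightarrow>
    (\<forall>f \<in> fst (q k). req K f) \<and> (\<exists>J. under_ev W' (AK \<kappa> k) (fst (q k)) J) \<or>
    (\<forall>f \<in> fst (q k). \<not> unb K f) \<and> (\<exists>J. over_ev W' (AK \<kappa> k) (fst (q k)) J))" ..
  note q = bspec[OF this]
  define W where "W = (\<Union>h \<in> fst \<kappa>. fst (p h)) \<union> (\<Union>k \<in> nodes K - snd \<kappa>. snd (q k))"
  have W: "W \<subseteq> out G ?n" unfolding W_def using p q by blast
  have out_le: "card (out H h) \<le> card (edges H)" "card (out K h) \<le> card (edges K)" for h
    using fins(4,5) by (auto intro!: card_mono simp: out_def)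
  have "card (\<Union>h \<in> fst \<kappa>. fst (p h)) \<le> card (nodes H) * card (edges H)"
  proof (rule sum_card_le[OF _ fins(2)])
    show "fst \<kappa> \<subseteq> nodes H" using rep(2)[OF \<kappa>] T_sub by blast
    show "card (fst (p h)) \<le> card (edges H)" if "h \<in> fst \<kappa>" for h
      using p[OF that] out_le(1)[of h] by linarith
  qed
  moreover have "card (\<Union>k \<in> nodes K - snd \<kappa>. snd (q k)) \<le> card (nodes K) * (card (edges K) + 1)"
  proof (rule sum_card_le[OF _ fins(3)])
    show "card (snd (q k)) \<le> card (edges K) + 1" if "k \<in> nodes K - snd \<kappa>" for k
      using q[OF that] out_le(2)[of k] by linarith
  qed blast
  moreover have "card W \<le> card (\<Union>h \<in> fst \<kappa>. fst (p h)) + card (\<Union>k \<in> nodes K - snd \<kappa>. snd (q k))"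
    unfolding W_def by (rule card_Un_le)
  ultimately have cW: "card W < B" unfolding B_def by linarith
  define U where "U = (\<lambda>k. (\<forall>f \<in> fst (q k). req K f) \<and> (\<exists>J. under_ev W (AK \<kappa> k) (fst (q k)) J))"
  define J where "J = (\<lambda>k. SOME J. if U k then under_ev W (AK \<kappa> k) (fst (q k)) J else over_ev W (AK \<kappa> k) (fst (q k)) J)"
  have ev: "fst (q k) \<subseteq> out K k \<and>
      (U k \<longrightarrow> (\<forall>f \<in> fst (q k). req K f) \<and> under_ev W (AK \<kappa> k) (fst (q k)) (J k)) \<and>
      (\<not> U k \<longrightarrow> (\<forall>f \<in> fst (q k). \<not> unb K f) \<and> over_ev W (AK \<kappa> k) (fst (q k)) (J k))"
    if k: "k \<in> nodes K - snd \<kappa>" for k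
  proof -
    have "snd (q k) \<subseteq> W" unfolding W_def using k by blast
    then have d: "(\<forall>f \<in> fst (q k). req K f) \<and> (\<exists>J. under_ev W (AK \<kappa> k) (fst (q k)) J) \<or>
        (\<forall>f \<in> fst (q k). \<not> unb K f) \<and> (\<exists>J. over_ev W (AK \<kappa> k) (fst (q k)) J)"
      using q[OF k] W by blast
    then have "\<exists>J. if U k then under_ev W (AK \<kappa> k) (fst (q k)) J else over_ev W (AK \<kappa> k) (fst (q k)) J"
      unfolding U_def by (cases "\<exists>J. under_ev W (AK \<kappa> k) (fst (q k)) J"; simp; blast)
    then have "if U k then under_ev W (AK \<kappa> k) (fst (q k)) (J k) else over_ev W (AK \<kappa> k) (fst (q k)) (J k)"
      unfolding J_def by (rule someI_ex)
    then show ?thesis using q[OF k] d by (cases "U k") (simp_all add: U_def, blast)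
  qed
  have mt: "(\<forall>e \<in> W. snd (p h) e \<in> allowed G H ?R h e) \<and>
      (\<forall>f \<in> out H h. (req H f \<longrightarrow> (\<exists>e \<in> W. snd (p h) e = f)) \<and>
        (\<not> unb H f \<longrightarrow> (\<forall>e \<in> W. \<forall>e' \<in> W. snd (p h) e = f \<longrightarrow> snd (p h) e' = f \<longrightarrow> e = e')))"
    if h: "h \<in> fst \<kappa>" for h
  proof -
    have "fst (p h) \<subseteq> W" unfolding W_def using h by blast
    then show ?thesis using p[OF h] W by (meson subsetD)
  qed
  show ?thesis
    by (rule exI[of _ W], rule exI[of _ "\<lambda>h. snd (p h)"], rule exI[of _ "\<lambda>k. fst (q k)"], rule exI[of _ U],
        rule exI[of _ J]) (use W cW ev mt in \<open>unfold evid_def, blast\<close>)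
qed

definition "wit \<kappa> = (SOME (W, \<Phi>, X, U, J). evid \<kappa> W \<Phi> X U J)"
definition "keep \<kappa> = fst (wit \<kappa>)"
definition "phi \<kappa> = fst (snd (wit \<kappa>))"
definition "obs \<kappa> = fst (snd (snd (wit \<kappa>)))"
definition "is_under \<kappa> = fst (snd (snd (snd (wit \<kappa>))))"
definition "inj_ev \<kappa> = snd (snd (snd (snd (wit \<kappa>))))"

lemma evid: "\<kappa> \<in> Kd \<Longrightarrow> evid \<kappa> (keep \<kappa>) (phi \<kappa>) (obs \<kappa>) (is_under \<kappa>) (inj_ev \<kappa>)"
proof -
  assume "\<kappa> \<in> Kd"
  then have "\<exists>p. case p of (W, \<Phi>, X, U, J) \<Rightarrow> evid \<kappa> W \<Phi> X U J"
    using local_evidence[of \<kappa>] by (simp only: split_paired_Ex prod.case)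
  then have "case wit \<kappa> of (W, \<Phi>, X, U, J) \<Rightarrow> evid \<kappa> W \<Phi> X U J"
    unfolding wit_def by (rule someI_ex)
  then show ?thesis
    unfolding keep_def phi_def obs_def is_under_def inj_ev_def by (simp add: case_prod_unfold)
qed

lemma keep_out: "\<kappa> \<in> Kd \<Longrightarrow> keep \<kappa> \<subseteq> out G (rep \<kappa>)"
  and card_keep: "\<kappa> \<in> Kd \<Longrightarrow> card (keep \<kappa>) < B"
  using evid[of \<kappa>] unfolding evid_def by blast+

lemma phi:
  assumes "\<kappa> \<in> Kd" "h \<in> fst \<kappa>"
  shows "e \<in> keep \<kappa> \<Longrightarrow> phi \<kappa> h e \<in> allowed G H (\<lambda>x y. (x, y) \<in> RH) h e"
    and "f \<in> out H h \<Longrightarrow> req H f \<Longrightarrow> \<exists>e \<in> keep \<kappa>. phi \<kappa> h e = f"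
    and "f \<in> out H h \<Longrightarrow> \<not> unb H f \<Longrightarrow> e \<in> keep \<kappa> \<Longrightarrow> e' \<in> keep \<kappa> \<Longrightarrow>
      phi \<kappa> h e = f \<Longrightarrow> phi \<kappa> h e' = f \<Longrightarrow> e = e'"
  using evid[OF assms(1)] assms(2) unfolding evid_def by blast+

lemma obs:
  assumes "\<kappa> \<in> Kd" "k \<in> nodes K - snd \<kappa>"
  shows "obs \<kappa> k \<subseteq> out K k"
    and "is_under \<kappa> k \<Longrightarrow> (\<forall>f \<in> obs \<kappa> k. req K f) \<and> under_ev (keep \<kappa>) (AK \<kappa> k) (obs \<kappa> k) (inj_ev \<kappa> k)"
    and "\<not> is_under \<kappa> k \<Longrightarrow> (\<forall>f \<in> obs \<kappa> k. \<not> unb K f) \<and> over_ev (keep \<kappa>) (AK \<kappa> k) (obs \<kappa> k) (inj_ev \<kappa> k)"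
  using evid[OF assms(1)] assms(2) unfolding evid_def by blast+

definition "copy \<kappa> = (SOME g. inj_on g (keep \<kappa>) \<and> g ` keep \<kappa> \<subseteq> {..<B})"

lemma copy:
  assumes "\<kappa> \<in> Kd"
  shows "inj_on (copy \<kappa>) (keep \<kappa>)" "copy \<kappa> ` keep \<kappa> \<subseteq> {..<B}"
proof -
  have "finite (keep \<kappa>)" using keep_out[OF assms] fins(6) by (rule finite_subset)
  then have "\<exists>g. inj_on g (keep \<kappa>) \<and> g ` keep \<kappa> \<subseteq> {..<B}"
    using card_le_inj[of "keep \<kappa>" "{..<B}"] card_keep[OF assms] by auto
  then have "inj_on (copy \<kappa>) (keep \<kappa>) \<and> copy \<kappa> ` keep \<kappa> \<subseteq> {..<B}"
    unfolding copy_def by (rule someI_ex)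
  then show "inj_on (copy \<kappa>) (keep \<kappa>)" "copy \<kappa> ` keep \<kappa> \<subseteq> {..<B}" by simp_all
qed

text \<open>Parallel edges are separated by giving every kind \<open>B\<close> copies.\<close>

definition "Z = Kd \<times> {..<B}"
definition "enc = (SOME enc. inj_on enc Z \<and> enc ` Z \<subseteq> {..<card Z} \<and>
    (\<forall>x \<in> Z. \<forall>y \<in> Z. rk (fst x) < rk (fst y) \<longrightarrow> enc x < (enc y :: nat)))"

lemma enc: "inj_on enc Z" "enc ` Z \<subseteq> {..<card Z}"
    "x \<in> Z \<Longrightarrow> y \<in> Z \<Longrightarrow> rk (fst x) < rk (fst y) \<Longrightarrow> enc x < enc y"
proof -
  have "finite Z" by (simp add: Z_def finite_Kd)
  from rank_enumeration[OF this, of "\<lambda>x. rk (fst x)"]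
  have *: "inj_on enc Z \<and> enc ` Z \<subseteq> {..<card Z} \<and>
    (\<forall>x \<in> Z. \<forall>y \<in> Z. rk (fst x) < rk (fst y) \<longrightarrow> enc x < (enc y :: nat))"
    unfolding enc_def by (rule someI_ex)
  then show "inj_on enc Z" "enc ` Z \<subseteq> {..<card Z}" by simp_all
  show "x \<in> Z \<Longrightarrow> y \<in> Z \<Longrightarrow> rk (fst x) < rk (fst y) \<Longrightarrow> enc x < enc y" using * by blast
qed

lemma enc_less: "z \<in> Z \<Longrightarrow> enc z < N"
proof -
  assume "z \<in> Z"
  then have "enc z < card Z" using enc(2) by blast
  also have "card Z = card Kd * B" by (simp add: Z_def card_cartesian_product)
  also have "\<dots> \<le> 2 ^ (card (nodes H) + card (nodes K)) * B" using card_Kd by (rule mult_right_mono) simp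
  also have "\<dots> \<le> N" using N by (simp only: B_def)
  finally show ?thesis .
qed

definition "kd x = fst (inv_into Z enc x)"
definition "nx \<kappa> e = enc (succ \<kappa> (target G e), copy \<kappa> e)"

lemma kd_enc: "(\<kappa>, i) \<in> Z \<Longrightarrow> kd (enc (\<kappa>, i)) = \<kappa>"
  unfolding kd_def using enc(1) by simp

lemma kd_in: "x \<in> enc ` Z \<Longrightarrow> kd x \<in> Kd"
  unfolding kd_def using inv_into_into[of x enc Z] by (auto simp: Z_def)

lemma nx_pair: "\<kappa> \<in> Kd \<Longrightarrow> e \<in> keep \<kappa> \<Longrightarrow> (succ \<kappa> (target G e), copy \<kappa> e) \<in> Z"
  using succ_Kd target_G keep_out copy(2) unfolding Z_def by blast

lemma nx_in: "\<kappa> \<in> Kd \<Longrightarrow> e \<in> keep \<kappa> \<Longrightarrow> nx \<kappa> e \<in> enc ` Z"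
  using nx_pair unfolding nx_def by blast

lemma nx_less: "\<kappa> \<in> Kd \<Longrightarrow> e \<in> keep \<kappa> \<Longrightarrow> nx \<kappa> e < N"
  using nx_pair enc_less unfolding nx_def by blast

lemma kd_nx: "\<kappa> \<in> Kd \<Longrightarrow> e \<in> keep \<kappa> \<Longrightarrow> kd (nx \<kappa> e) = succ \<kappa> (target G e)"
  using nx_pair kd_enc unfolding nx_def by blast

text \<open>Targets of the same kind differ in their copy number, so source and target determine a
  kept edge, whatever its label.\<close>

lemma nx_inj:
  assumes "\<kappa> \<in> Kd" "e \<in> keep \<kappa>" "e' \<in> keep \<kappa>" "nx \<kappa> e = nx \<kappa> e'"
  shows "e = e'"
proof -
  have "(succ \<kappa> (target G e), copy \<kappa> e) = (succ \<kappa> (target G e'), copy \<kappa> e')"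
    using inj_onD[OF enc(1)] assms nx_pair unfolding nx_def by blast
  then show ?thesis using inj_onD[OF copy(1)[OF assms(1)]] assms(2,3) by blast
qed

text \<open>A kind that misses some \<open>k\<close> has positive rank, and the targets of its kept
  edges are taken at the preceding stage, so their rank is strictly smaller. The copy numbers have
  no influence on this.\<close>

lemma nx_decreasing:
  assumes "x \<in> enc ` Z" "k \<in> nodes K - snd (kd x)" "e \<in> keep (kd x)"
  shows "nx (kd x) e < x"
proof -
  obtain \<kappa> i where x: "(\<kappa>, i) \<in> Z" "x = enc (\<kappa>, i)" using assms(1) by auto
  then have kx: "kd x = \<kappa>" "\<kappa> \<in> Kd" using kd_enc by (auto simp: Z_def)
  have "target G e \<in> nodes G" using target_G keep_out kx assms(3) by blast
  then have "rk (succ \<kappa> (target G e)) \<le> rk \<kappa> - 1" by (rule rk_succ)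
  moreover have "rk \<kappa> > 0" using not_in_kind(1) kx assms(2) by blast
  ultimately have "rk (succ \<kappa> (target G e)) < rk \<kappa>" by simp
  then have "enc (succ \<kappa> (target G e), copy \<kappa> e) < enc (\<kappa>, i)"
    using nx_pair[OF kx(2)] x(1) assms(3) kx(1) by (intro enc(3)) auto
  then show ?thesis unfolding kx(1) nx_def by (simp only: x(2))
qed

section \<open>The certificate of the small counterexample\<close>

definition "edge x a y e \<longleftrightarrow> e \<in> keep (kd x) \<and> a = c (lab G e) \<and> y = nx (kd x) e"

definition cert :: "nat \<Rightarrow> nat list \<Rightarrow> bool" where
  "cert i xs \<longleftrightarrow> xs ! 0 \<in> enc ` Z \<and>
    (if i = 1 then \<exists>e. edge (xs ! 0) (xs ! 1) (xs ! 2) e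
     else if i = 2 then xs ! 1 \<in> fst (kd (xs ! 0))
     else if i = 3 then \<exists>e. edge (xs ! 0) (xs ! 2) (xs ! 3) e \<and> xs ! 4 = phi (kd (xs ! 0)) (xs ! 1) e
     else if i = 4 then xs ! 1 \<in> nodes K - snd (kd (xs ! 0))
     else if i = 5 then is_under (kd (xs ! 0)) (xs ! 1)
     else if i = 6 then xs ! 2 \<in> obs (kd (xs ! 0)) (xs ! 1)
     else \<exists>e. edge (xs ! 0) (xs ! 2) (xs ! 3) e \<and> inj_ev (kd (xs ! 0)) (xs ! 1) e (xs ! 4))"

lemma cert_simps:
  "cert 1 [x, a, y] \<longleftrightarrow> x \<in> enc ` Z \<and> (\<exists>e. edge x a y e)"
  "cert 2 [x, h] \<longleftrightarrow> x \<in> enc ` Z \<and> h \<in> fst (kd x)"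
  "cert 3 [x, h, a, y, f] \<longleftrightarrow> x \<in> enc ` Z \<and> (\<exists>e. edge x a y e \<and> f = phi (kd x) h e)"
  "cert 4 [x, k] \<longleftrightarrow> x \<in> enc ` Z \<and> k \<in> nodes K - snd (kd x)"
  "cert 5 [x, k] \<longleftrightarrow> x \<in> enc ` Z \<and> is_under (kd x) k"
  "cert 6 [x, k, f] \<longleftrightarrow> x \<in> enc ` Z \<and> f \<in> obs (kd x) k"
  "cert 7 [x, k, a, y, f] \<longleftrightarrow> x \<in> enc ` Z \<and> (\<exists>e. edge x a y e \<and> inj_ev (kd x) k e f)"
  by (simp_all add: cert_def)

lemma edge_unique: "x \<in> enc ` Z \<Longrightarrow> edge x a y e \<Longrightarrow> edge x a' y e' \<Longrightarrow> e' = e"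
  using nx_inj kd_in unfolding edge_def by metis

lemma lab_mem: "e \<in> keep \<kappa> \<Longrightarrow> \<kappa> \<in> Kd \<Longrightarrow> lab G e \<in> \<Sigma>"
  using keep_out[of \<kappa>] graphG unfolding is_graph_def out_def by blast

lemma smallD:
  assumes "f \<in> out H h" shows "f < N" "target H f < N" "c (lab H f) < N" "f \<in> edges H" "source H f = h"
    "lab H f \<in> \<Sigma>"
proof -
  show f: "f \<in> edges H" "source H f = h" using assms by (auto simp: out_def)
  then show "f < N" "c (lab H f) < N" using smallH unfolding small_def by auto
  show "target H f < N" "lab H f \<in> \<Sigma>" using shape_graphD(2,3)[OF H f(1)] smallH unfolding small_def by auto
qed

lemma smallD':
  assumes "f \<in> out K h" shows "f < N" "target K f < N" "c (lab K f) < N" "f \<in> edges K" "source K f = h"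
    "lab K f \<in> \<Sigma>"
proof -
  show f: "f \<in> edges K" "source K f = h" using assms by (auto simp: out_def)
  then show "f < N" "c (lab K f) < N" using smallK unfolding small_def by auto
  show "target K f < N" "lab K f \<in> \<Sigma>" using shape_graphD(2,3)[OF K f(1)] smallK unfolding small_def by auto
qed

lemma outf_out: "outf c N H' h f \<Longrightarrow> f \<in> out H' h"
  unfolding outf_def edat_def out_def by blast

lemma outf_K: "f \<in> out K k \<Longrightarrow> outf c N K k f"
  using smallD'[of f k] unfolding outf_def edat_def by blast

lemma cert_H:
  assumes "cert 2 [x, h]"
  shows "cex_H c N H cert x h"
proof -
  have x: "x \<in> enc ` Z" "h \<in> fst (kd x)" using assms by (simp_all only: cert_simps)
  note \<kappa> = kd_in[OF x(1)]
  have "\<exists>f < N. cert 3 [x, h, a, y, f] \<and> (\<exists>t < N. edat c H f h t a \<and> cert 2 [y, t]) \<and>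
    (\<forall>g < N. cert 3 [x, h, a, y, g] \<longrightarrow> g = f)" if c1: "cert 1 [x, a, y]" for a y
  proof -
    obtain e where e: "edge x a y e" using c1 by (auto simp only: cert_simps simp_thms)
    then have e': "e \<in> keep (kd x)" "a = c (lab G e)" "y = nx (kd x) e" by (simp_all add: edge_def)
    let ?f = "phi (kd x) h e"
    have f: "?f \<in> out H h" "lab G e = lab H ?f" "(target G e, target H ?f) \<in> RH"
      using phi(1)[OF \<kappa> x(2) e'(1)] unfolding allowed_def by auto
    \<comment> \<open>The first component of a kind is the full set of simulating nodes at the
      target of \<open>e\<close>, so membership in \<open>RH\<close> carries over to the number
      \<open>y\<close> that stands for this target.\<close>
    have "target H ?f \<in> fst (kd y)"
      using f(3) kd_nx[OF \<kappa> e'(1)] e'(3) by (simp add: succ_def T_def)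
    then have "cert 2 [y, target H ?f]" using nx_in[OF \<kappa> e'(1)] e'(3) by (simp only: cert_simps simp_thms)
    moreover have "edat c H ?f h (target H ?f) a" using smallD[OF f(1)] f(2) e'(2) by (simp add: edat_def)
    moreover have "cert 3 [x, h, a, y, ?f]" using x(1) e by (auto simp only: cert_simps simp_thms)
    moreover have "g = ?f" if "cert 3 [x, h, a, y, g]" for g
      using that edge_unique[OF x(1) e] by (auto simp only: cert_simps simp_thms)
    ultimately show ?thesis using smallD[OF f(1)] by blast
  qed
  moreover have "\<exists>a < N. \<exists>y < N. cert 1 [x, a, y] \<and> cert 3 [x, h, a, y, f]"
    if f: "outf c N H h f" "req H f" for f
  proof -
    obtain e where e: "e \<in> keep (kd x)" "phi (kd x) h e = f"
      using phi(2)[OF \<kappa> x(2) outf_out[OF f(1)] f(2)] by blast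
    have "lab G e = lab H f" using phi(1)[OF \<kappa> x(2) e(1)] e(2) unfolding allowed_def by auto
    then have "c (lab G e) < N" using smallD(3)[OF outf_out[OF f(1)]] by simp
    moreover have "nx (kd x) e < N" by (rule nx_less[OF \<kappa> e(1)])
    moreover have "edge x (c (lab G e)) (nx (kd x) e) e" using e(1) by (simp add: edge_def)
    ultimately show ?thesis using x(1) e(2)
      by (intro exI[of _ "c (lab G e)"] exI[of _ "nx (kd x) e"]) (auto simp only: cert_simps simp_thms)
  qed
  moreover have "a = b \<and> y = z"
    if f: "outf c N H h f" "\<not> unb H f" and c3: "cert 3 [x, h, a, y, f]" "cert 3 [x, h, b, z, f]" for f a y b z
  proof -
    obtain e e' where e: "edge x a y e" "f = phi (kd x) h e" "edge x b z e'" "f = phi (kd x) h e'"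
      using c3 by (auto simp only: cert_simps simp_thms)
    have "e = e'"
      by (rule phi(3)[OF \<kappa> x(2) outf_out[OF f(1)] f(2)]) (use e in \<open>simp_all add: edge_def\<close>)
    then show ?thesis using e unfolding edge_def by simp
  qed
  moreover have "h \<in> nodes H" using x(2) Kd_sub \<kappa> by (metis PowD mem_Sigma_iff prod.collapse subsetD)
  ultimately show ?thesis unfolding cex_H_def by blast
qed

text \<open>The second component of the kind of \<open>y\<close> is the approximation at the
  preceding stage. A missing claim at \<open>y\<close> is therefore exactly the permission with
  which the obstruction at \<open>x\<close> was computed.\<close>

lemma allw_cert:
  assumes x: "x \<in> enc ` Z" and e: "edge x a y e" and f: "f \<in> out K k"
  shows "allw c N K cert k a y f \<longleftrightarrow> f \<in> AK (kd x) k e"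
proof -
  note \<kappa> = kd_in[OF x]
  have e': "e \<in> keep (kd x)" "a = c (lab G e)" "y = nx (kd x) e" using e by (simp_all add: edge_def)
  note s = smallD'[OF f]
  have "allw c N K cert k a y f \<longleftrightarrow> c (lab K f) = a \<and> \<not> cert 4 [y, target K f]"
  proof
    assume "allw c N K cert k a y f"
    then show "c (lab K f) = a \<and> \<not> cert 4 [y, target K f]" unfolding allw_def edat_def by metis
  next
    assume "c (lab K f) = a \<and> \<not> cert 4 [y, target K f]"
    then have "edat c K f k (target K f) a \<and> \<not> cert 4 [y, target K f]" using s by (simp add: edat_def)
    then show "allw c N K cert k a y f" using s(2) unfolding allw_def by blast
  qed
  also have "c (lab K f) = a \<longleftrightarrow> lab G e = lab K f"
    unfolding e'(2) inj_on_eq_iff[OF c s(6) lab_mem[OF e'(1) \<kappa>]] by (rule eq_commute)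
  also have "\<not> cert 4 [y, target K f] \<longleftrightarrow> target K f \<in> SS (rk (kd x) - 1) (target G e)"
  proof -
    have "cert 4 [y, target K f] \<longleftrightarrow> target K f \<in> nodes K - snd (kd y)"
      using nx_in[OF \<kappa> e'(1)] e'(3) by (simp only: cert_simps simp_thms)
    also have "snd (kd y) = SS (rk (kd x) - 1) (target G e)"
      using kd_nx[OF \<kappa> e'(1)] e'(3) by (simp add: succ_def)
    finally show ?thesis using shape_graphD(2)[OF K s(4)] by blast
  qed
  finally show ?thesis using f unfolding AK_def allowed_def by simp
qed

lemma allw_out: "allw c N K I k a y f \<Longrightarrow> f \<in> out K k"
  unfolding allw_def edat_def out_def by blast

lemma cert_under:
  assumes "cert 4 [x, k]" "cert 5 [x, k]"
  shows "cex_under c N K cert x k"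
proof -
  have x: "x \<in> enc ` Z" "k \<in> nodes K - snd (kd x)" "is_under (kd x) k"
    using assms by (simp_all only: cert_simps)
  note \<kappa> = kd_in[OF x(1)]
  let ?X = "obs (kd x) k" and ?J = "inj_ev (kd x) k"
  note X = obs(1)[OF \<kappa> x(2)] and ev = obs(2)[OF \<kappa> x(2,3)]
  have "outf c N K k f \<and> req K f" if "cert 6 [x, k, f]" for f
    using that X ev outf_K by (auto simp only: cert_simps simp_thms)
  moreover have "\<exists>f < N. cert 6 [x, k, f] \<and> cert 7 [x, k, a, y, f] \<and>
      (\<forall>b < N. \<forall>z < N. cert 7 [x, k, b, z, f] \<longrightarrow> b = a \<and> z = y)"
    if c1: "cert 1 [x, a, y]" "cert 6 [x, k, f']" "allw c N K cert k a y f'" for a y f'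
  proof -
    obtain e where e: "edge x a y e" using c1(1) by (auto simp only: cert_simps simp_thms)
    have "f' \<in> AK (kd x) k e" using allw_cert[OF x(1) e allw_out[OF c1(3)]] c1(3) by blast
    moreover have "f' \<in> ?X" using c1(2) by (simp only: cert_simps simp_thms)
    moreover have eW: "e \<in> keep (kd x)" using e by (simp add: edge_def)
    ultimately obtain f where f: "f \<in> ?X" "?J e f" "\<forall>e' \<in> keep (kd x). ?J e' f \<longrightarrow> e' = e"
      using ev unfolding under_ev_def by blast
    have "b = a \<and> z = y" if c7: "cert 7 [x, k, b, z, f]" for b z
    proof -
      obtain e' where e': "edge x b z e'" "?J e' f" using c7 by (auto simp only: cert_simps simp_thms)
      then have "e' \<in> keep (kd x)" by (simp add: edge_def)
      then have "e' = e" using f(3) e'(2) by blast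
      then show ?thesis using e e'(1) by (simp add: edge_def)
    qed
    moreover have "cert 7 [x, k, a, y, f]" "cert 6 [x, k, f]" using x(1) e f by (auto simp only: cert_simps simp_thms)
    moreover have "f < N" using X f(1) smallD'(1) by blast
    ultimately show ?thesis by blast
  qed
  moreover have "\<exists>f < N. cert 6 [x, k, f] \<and> (\<forall>a < N. \<forall>y < N. \<not> cert 7 [x, k, a, y, f])"
  proof -
    obtain f where f: "f \<in> ?X" "\<forall>e \<in> keep (kd x). \<not> ?J e f" using ev unfolding under_ev_def by blast
    then have "\<not> cert 7 [x, k, a, y, f]" for a y by (auto simp: cert_simps(7) edge_def)
    moreover have "cert 6 [x, k, f]" using f(1) x(1) by (simp only: cert_simps simp_thms)
    moreover have "f < N" using X f(1) smallD'(1) by blast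
    ultimately show ?thesis by blast
  qed
  ultimately show ?thesis unfolding cex_under_def by blast
qed

lemma cert_inside:
  assumes x: "x \<in> enc ` Z" "k \<in> nodes K - snd (kd x)" and e: "edge x a y e"
    and A: "AK (kd x) k e \<subseteq> obs (kd x) k"
  shows "inside c N K cert x k a y"
proof -
  have "cert 6 [x, k, f]" if "allw c N K cert k a y f" for f
    using allw_cert[OF x(1) e allw_out[OF that]] that A x(1) by (auto simp only: cert_simps simp_thms)
  moreover have "cert 1 [x, a, y]" using x(1) e by (auto simp only: cert_simps simp_thms)
  ultimately show ?thesis unfolding inside_def by blast
qed

lemma cert_over:
  assumes "cert 4 [x, k]" "\<not> cert 5 [x, k]"
  shows "cex_over c N K cert x k"
proof -
  have x: "x \<in> enc ` Z" "k \<in> nodes K - snd (kd x)" "\<not> is_under (kd x) k"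
    using assms by (simp_all only: cert_simps) blast
  note \<kappa> = kd_in[OF x(1)]
  let ?X = "obs (kd x) k" and ?J = "inj_ev (kd x) k" and ?A = "AK (kd x) k"
  note X = obs(1)[OF \<kappa> x(2)] and ev = obs(3)[OF \<kappa> x(2,3)]
  \<comment> \<open>The code of an arbitrary label may exceed \<open>N\<close>. A kept edge,
    however, is mapped to an edge of \<open>H\<close>, since some node of \<open>H\<close> simulates
    the representative, and labels occurring in \<open>H\<close> have small codes.\<close>
  have lbl: "c (lab G e) < N" if eW: "e \<in> keep (kd x)" for e
  proof -
    obtain n where n: "n \<in> nodes G" "T n = fst (kd x)" using rep[OF \<kappa>] by blast
    then have "n \<in> Domain RH" using RH unfolding embedding_def by blast
    then obtain h where "h \<in> fst (kd x)" using n(2) unfolding T_def by blast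
    then have "phi (kd x) h e \<in> out H h" "lab G e = lab H (phi (kd x) h e)"
      using phi(1)[OF \<kappa> _ eW] unfolding allowed_def by auto
    then show ?thesis using smallD(3) by simp
  qed
  have ex: "\<exists>a < N. \<exists>y < N. edge x a y e" if "e \<in> keep (kd x)" for e
    using lbl[OF that] nx_less[OF \<kappa> that] that unfolding edge_def by blast
  have "outf c N K k f \<and> \<not> unb K f" if "cert 6 [x, k, f]" for f
    using that X ev outf_K by (auto simp only: cert_simps simp_thms)
  moreover have "\<exists>a < N. \<exists>y < N. inside c N K cert x k a y \<and> cert 7 [x, k, a, y, f] \<and>
      (\<forall>g < N. cert 7 [x, k, a, y, g] \<longrightarrow> g = f)" if c6: "cert 6 [x, k, f]" for f
  proof -
    have "f \<in> ?X" using c6 by (simp only: cert_simps simp_thms)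
    then obtain e where e: "e \<in> keep (kd x)" "?A e \<subseteq> ?X" "?J e f" "\<forall>g. ?J e g \<longrightarrow> g = f"
      using ev unfolding over_ev_def by blast
    obtain a y where a: "a < N" "y < N" "edge x a y e" using ex[OF e(1)] by blast
    have "g = f" if "cert 7 [x, k, a, y, g]" for g
      using that edge_unique[OF x(1) a(3)] e(4) by (auto simp only: cert_simps simp_thms)
    moreover have "cert 7 [x, k, a, y, f]" using x(1) a(3) e(3) by (auto simp only: cert_simps simp_thms)
    ultimately show ?thesis using a(1,2) cert_inside[OF x(1,2) a(3) e(2)] by blast
  qed
  moreover have "\<exists>a < N. \<exists>y < N. inside c N K cert x k a y \<and> (\<forall>f < N. \<not> cert 7 [x, k, a, y, f])"
  proof -
    obtain e where e: "e \<in> keep (kd x)" "?A e \<subseteq> ?X" "\<forall>g. \<not> ?J e g"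
      using ev unfolding over_ev_def by blast
    obtain a y where a: "a < N" "y < N" "edge x a y e" using ex[OF e(1)] by blast
    have "\<not> cert 7 [x, k, a, y, f]" for f
      using edge_unique[OF x(1) a(3)] e(3) by (auto simp only: cert_simps simp_thms)
    then show ?thesis using a(1,2) cert_inside[OF x(1,2) a(3) e(2)] by blast
  qed
  ultimately show ?thesis unfolding cex_over_def by blast
qed

theorem cex_cert: "cex c N H K cert"
proof -
  have "y < x" if c1: "cert 4 [x, k]" "cert 1 [x, a, y]" for x k a y
  proof -
    obtain e where "edge x a y e" using c1(2) by (auto simp only: cert_simps simp_thms)
    then show ?thesis using nx_decreasing[of x k e] c1(1) by (simp add: cert_simps(4) edge_def)
  qed
  \<comment> \<open>The root is the kind of a node with an empty approximation: it claims
    non-simulation by every node of \<open>K\<close>.\<close>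
  moreover obtain n i where n: "n \<in> nodes G" "SS i n = {}" using SS_empty by blast
  define x where "x = enc ((T n, SS i n), 0)"
  have z: "((T n, SS i n), 0) \<in> Z" using n(1) by (auto simp: Z_def Kd_def B_def)
  then have x: "x \<in> enc ` Z" "x < N" "kd x = (T n, SS i n)"
    using enc_less kd_enc unfolding x_def by blast+
  have "n \<in> Domain RH" using RH n(1) unfolding embedding_def by blast
  then obtain h where h: "h \<in> T n" unfolding T_def by blast
  then have "h < N" using T_sub smallH unfolding small_def by blast
  moreover have "cert 2 [x, h]" using x h by (simp add: cert_simps(2))
  moreover have "cert 4 [x, k]" if "k \<in> nodes K" for k using x n(2) that by (simp add: cert_simps(4))
  ultimately show ?thesis
    unfolding cex_def using cert_H cert_under cert_over x(2) by blast
qed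

end

section \<open>Codes of graphs\<close>

text \<open>Parsing uses total functions of the position. That the field is properly closed by a
  \<open>False\<close> is said separately, by \<open>after w p \<le> length w\<close>.\<close>

definition ulen :: "bool list \<Rightarrow> nat \<Rightarrow> nat" where
  "ulen w p = length (takeWhile (\<lambda>b. b) (drop p w))"

definition after :: "bool list \<Rightarrow> nat \<Rightarrow> nat" where
  "after w p = p + ulen w p + 1"

text \<open>The code of an edge at \<open>p\<close> has its unary fields at \<open>p\<close>, \<open>fld2 w p\<close>, \<open>fld3 w p\<close> and its two
  interval bits at \<open>fldb w p\<close>. In the code of a graph at \<open>p\<close>, the first two fields are the numbers of
  nodes and edges, and the edges start at \<open>fld3 w p\<close>.\<close>

abbreviation "fld2 w p \<equiv> after w p"
abbreviation "fld3 w p \<equiv> after w (after w p)"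
abbreviation "fldb w p \<equiv> after w (after w (after w p))"

definition pos :: "bool list \<Rightarrow> nat \<Rightarrow> nat \<Rightarrow> nat" where
  "pos w p i = ((\<lambda>p. fldb w p + 2) ^^ i) p"

lemma pos_simps: "pos w p 0 = p" "pos w p (Suc i) = fldb w (pos w p i) + 2"
  by (simp_all add: pos_def)

text \<open>Positions increase along the fields, so this one inequality also ensures that the three
  unary fields before the interval bits are closed.\<close>

definition is_edge :: "bool list \<Rightarrow> nat \<Rightarrow> bool" where
  "is_edge w p \<longleftrightarrow> fldb w p + 1 < length w"

text \<open>The tests \<open>f < ulen w (fld2 w p)\<close> in \<open>occur\<close> make
  \<open>req\<close> and \<open>unb\<close> false for numbers that are not edges. The formulas
  \<open>fREQ\<close> and \<open>fUNB\<close> then agree with them at every number.\<close>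

definition dec :: "'l set \<Rightarrow> ('l \<Rightarrow> nat) \<Rightarrow> bool list \<Rightarrow> nat \<Rightarrow> (nat, nat, 'l) graph" where
  "dec \<Sigma> c w p = (let ps = pos w (fld3 w p) in
    \<lparr>nodes = {..<ulen w p}, edges = {..<ulen w (fld2 w p)},
     source = \<lambda>f. ulen w (ps f), target = \<lambda>f. ulen w (fld2 w (ps f)),
     lab = \<lambda>f. inv_into \<Sigma> c (ulen w (fld3 w (ps f))),
     occur = \<lambda>f. (if f < ulen w (fld2 w p) \<and> w ! fldb w (ps f) then 1 else 0,
       if f < ulen w (fld2 w p) \<and> w ! (fldb w (ps f) + 1) then \<infinity> else 1)\<rparr>)"

definition valid :: "'l set \<Rightarrow> ('l \<Rightarrow> nat) \<Rightarrow> bool list \<Rightarrow> nat \<Rightarrow> bool" where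
  "valid \<Sigma> c w p \<longleftrightarrow> fld3 w p \<le> length w \<and> (\<forall>i < ulen w (fld2 w p).
     is_edge w (pos w (fld3 w p) i) \<and> ulen w (pos w (fld3 w p) i) < ulen w p \<and>
     ulen w (fld2 w (pos w (fld3 w p) i)) < ulen w p \<and> ulen w (fld3 w (pos w (fld3 w p) i)) \<in> c ` \<Sigma>)"

definition code_end :: "bool list \<Rightarrow> nat \<Rightarrow> nat" where
  "code_end w p = pos w (fld3 w p) (ulen w (fld2 w p))"

lemma dec_simps:
  "nodes (dec \<Sigma> c w p) = {..<ulen w p}" "edges (dec \<Sigma> c w p) = {..<ulen w (fld2 w p)}"
  "source (dec \<Sigma> c w p) f = ulen w (pos w (fld3 w p) f)"
  "target (dec \<Sigma> c w p) f = ulen w (fld2 w (pos w (fld3 w p) f))"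
  "lab (dec \<Sigma> c w p) f = inv_into \<Sigma> c (ulen w (fld3 w (pos w (fld3 w p) f)))"
  "occur (dec \<Sigma> c w p) f = (if f < ulen w (fld2 w p) \<and> w ! fldb w (pos w (fld3 w p) f) then 1 else 0,
     if f < ulen w (fld2 w p) \<and> w ! (fldb w (pos w (fld3 w p) f) + 1) then \<infinity> else 1)"
  by (simp_all add: dec_def Let_def)

lemma takeWhile_unary: "takeWhile (\<lambda>b. b) xs = replicate (length (takeWhile (\<lambda>b. b) xs)) True"
  by (induction xs) auto

lemma drop_ulen:
  assumes "after w p \<le> length w"
  shows "drop p w = unary (ulen w p) @ drop (after w p) w"
proof -
  let ?v = "ulen w p"
  have v: "p + ?v < length w" using assms by (simp add: after_def)
  have d: "drop p w = replicate ?v True @ dropWhile (\<lambda>b. b) (drop p w)"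
    unfolding ulen_def by (metis takeWhile_dropWhile_id takeWhile_unary)
  have "dropWhile (\<lambda>b. b) (drop p w) = drop (p + ?v) w"
    by (metis add.commute drop_drop dropWhile_eq_drop ulen_def)
  moreover have "drop (p + ?v) w = w ! (p + ?v) # drop (after w p) w"
    using v by (simp add: Cons_nth_drop_Suc after_def)
  moreover have "\<not> w ! (p + ?v)"
    using calculation v hd_dropWhile[of "\<lambda>b. b" "drop p w"] by auto
  ultimately show ?thesis using d by (simp add: unary_def)
qed

lemma ulen_unary:
  assumes "drop p w = unary v @ r"
  shows "ulen w p = v" "after w p \<le> length w" "drop (after w p) w = r"
proof -
  show v: "ulen w p = v"
    unfolding ulen_def assms unary_def by (induction v) simp_all
  have "length w - p = v + 1 + length r" using arg_cong[OF assms, of length] by (simp add: unary_def)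
  then show le: "after w p \<le> length w" by (simp add: after_def v)
  have "drop (v + 1) (drop p w) = r" unfolding assms by (simp add: unary_def)
  then show "drop (after w p) w = r" by (simp add: after_def v add.commute add.left_commute)
qed

lemma after_gt: "p < after w p"
  by (simp add: after_def)

lemma drop_two:
  assumes "p + 1 < length w"
  shows "drop p w = [w ! p, w ! (p + 1)] @ drop (p + 2) w"
proof -
  have "drop p w = w ! p # drop (Suc p) w" using assms by (simp add: Cons_nth_drop_Suc)
  also have "drop (Suc p) w = w ! Suc p # drop (Suc (Suc p)) w" using assms by (simp add: Cons_nth_drop_Suc)
  finally show ?thesis by simp
qed

lemma drop_twoD:
  assumes "drop p w = [a, b] @ r"
  shows "p + 1 < length w" "w ! p = a" "w ! (p + 1) = b" "drop (p + 2) w = r"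
proof -
  have "length w - p = 2 + length r" using arg_cong[OF assms, of length] by simp
  then show l: "p + 1 < length w" by simp
  then show "w ! p = a" "w ! (p + 1) = b" "drop (p + 2) w = r"
    using drop_two[OF l] assms by auto
qed

lemma drop_edge:
  assumes "is_edge w p"
  shows "drop p w = unary (ulen w p) @ unary (ulen w (fld2 w p)) @ unary (ulen w (fld3 w p)) @
    [w ! fldb w p, w ! (fldb w p + 1)] @ drop (fldb w p + 2) w"
proof -
  have l: "fldb w p \<le> length w" "fld3 w p \<le> length w" "fld2 w p \<le> length w"
    using assms after_gt[of "fld3 w p" w] after_gt[of "fld2 w p" w] unfolding is_edge_def by linarith+
  show ?thesis
    using drop_ulen[OF l(3)] drop_ulen[OF l(2)] drop_ulen[OF l(1)] drop_two[of "fldb w p" w] assms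
    unfolding is_edge_def by simp
qed

lemma edge_unary:
  assumes "drop p w = unary s @ unary t @ unary l @ [a, b] @ r"
  shows "is_edge w p" "ulen w p = s" "ulen w (fld2 w p) = t" "ulen w (fld3 w p) = l"
    "w ! fldb w p = a" "w ! (fldb w p + 1) = b" "drop (fldb w p + 2) w = r"
proof -
  note 1 = ulen_unary[OF assms]
  note 2 = ulen_unary[OF 1(3)]
  note 3 = ulen_unary[OF 2(3)]
  note 4 = drop_twoD[OF 3(3)]
  show "is_edge w p" "ulen w p = s" "ulen w (fld2 w p) = t" "ulen w (fld3 w p) = l"
    "w ! fldb w p = a" "w ! (fldb w p + 1) = b" "drop (fldb w p + 2) w = r"
    using 1(1) 2(1) 3(1) 4 unfolding is_edge_def by simp_all
qed

lemma drop_code: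
  assumes v: "valid \<Sigma> c w p"
  shows "\<exists>u. drop p w = u @ drop (code_end w p) w \<and> encodes c u (dec \<Sigma> c w p)"
proof -
  let ?G = "dec \<Sigma> c w p" and ?p = "fld3 w p" and ?m = "ulen w (fld2 w p)"
  have l: "fld3 w p \<le> length w" "fld2 w p \<le> length w"
    using v after_gt[of "fld2 w p" w] unfolding valid_def by linarith+
  have e: "is_edge w (pos w ?p i)"
    "c (inv_into \<Sigma> c (ulen w (fld3 w (pos w ?p i)))) = ulen w (fld3 w (pos w ?p i))" if "i < ?m" for i
    using v that unfolding valid_def by (simp_all add: f_inv_into_f)
  have edge: "drop (pos w ?p i) w = edge_code c ?G (\<lambda>x. x) i @ drop (pos w ?p (Suc i)) w" if "i < ?m" for i
    using drop_edge[OF e(1)[OF that]]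
    by (simp add: edge_code_def e(2)[OF that] dec_simps interval_code_def pos_simps that)
  have "drop ?p w = concat (map (edge_code c ?G (\<lambda>x. x)) [0..<i]) @ drop (pos w ?p i) w" if "i \<le> ?m" for i
    using that
  proof (induction i)
    case (Suc i)
    then show ?case using edge[of i] by simp
  qed (simp add: pos_simps)
  from this[OF order_refl] have "drop p w =
    (unary (ulen w p) @ unary ?m @ concat (map (edge_code c ?G (\<lambda>x. x)) [0..<?m])) @ drop (code_end w p) w"
    using drop_ulen[OF l(1)] drop_ulen[OF l(2)] by (simp add: code_end_def)
  moreover have "encodes c (unary (ulen w p) @ unary ?m @ concat (map (edge_code c ?G (\<lambda>x. x)) [0..<?m])) ?G"
    unfolding encodes_def
    by (intro exI[of _ "\<lambda>x. x"] exI[of _ "[0..<?m]"]) (auto simp: dec_simps lessThan_atLeast0 bij_betw_def)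
  ultimately show ?thesis by blast
qed

lemma shape_dec:
  assumes v: "valid \<Sigma> c w p"
  shows "shape_graph \<Sigma> (dec \<Sigma> c w p)"
proof -
  have "inv_into \<Sigma> c (ulen w (fld3 w (pos w (fld3 w p) i))) \<in> \<Sigma>" if "i < ulen w (fld2 w p)" for i
    using v that unfolding valid_def by (auto intro: inv_into_into)
  then show ?thesis
    using v unfolding shape_graph_def is_graph_def valid_def
    by (auto simp: dec_simps basic_intervals_def zero_enat_def one_enat_def)
qed

lemma fields_less:
  assumes "is_edge w p"
  shows "p < length w" "ulen w p < length w" "ulen w (fld2 w p) < length w" "ulen w (fld3 w p) < length w"
    "fld2 w p < length w" "fld3 w p < length w" "fldb w p < length w"
  using assms unfolding is_edge_def after_def[of w "fld3 w p"] after_def[of w "fld2 w p"] after_def[of w p]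
  by (simp_all add: after_def)

text \<open>The first two unary fields with their terminators lie inside \<open>w\<close> from
  \<open>p\<close> on. The summand 2 is for the terminators; its slack is used in the final estimate
  of the size of a counterexample.\<close>

lemma small_dec:
  assumes v: "valid \<Sigma> c w p" and N: "length w < N"
  shows "small c N (dec \<Sigma> c w p)"
    and "card (nodes (dec \<Sigma> c w p)) + card (edges (dec \<Sigma> c w p)) + p + 2 \<le> length w"
proof -
  have "fld3 w p \<le> length w" using v unfolding valid_def by blast
  then show l: "card (nodes (dec \<Sigma> c w p)) + card (edges (dec \<Sigma> c w p)) + p + 2 \<le> length w"
    by (simp add: dec_simps after_def[of w "fld2 w p"]) (simp add: after_def)
  have "c (lab (dec \<Sigma> c w p) f) < N" if "f < ulen w (fld2 w p)" for f
  proof -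
    have "is_edge w (pos w (fld3 w p) f)" "ulen w (fld3 w (pos w (fld3 w p) f)) \<in> c ` \<Sigma>"
      using v that unfolding valid_def by blast+
    then show ?thesis using fields_less(4) N by (simp add: dec_simps f_inv_into_f) (metis less_trans)
  qed
  then show "small c N (dec \<Sigma> c w p)"
    using l N unfolding small_def by (auto simp: dec_simps)
qed

section \<open>Isomorphic shape graphs have the same language\<close>

definition iso :: "('n, 'e, 'l) graph \<Rightarrow> ('m, 'f, 'l) graph \<Rightarrow> ('n \<Rightarrow> 'm) \<Rightarrow> ('e \<Rightarrow> 'f) \<Rightarrow> bool" where
  "iso H H' \<alpha> \<beta> \<longleftrightarrow> bij_betw \<alpha> (nodes H) (nodes H') \<and> bij_betw \<beta> (edges H) (edges H') \<and>
     (\<forall>f \<in> edges H. source H' (\<beta> f) = \<alpha> (source H f) \<and> target H' (\<beta> f) = \<alpha> (target H f) \<and>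
        lab H' (\<beta> f) = lab H f \<and> occur H' (\<beta> f) = occur H f)"

lemma iso_sym:
  assumes H: "shape_graph \<Sigma> H" and i: "iso H H' \<alpha> \<beta>"
  shows "iso H' H (inv_into (nodes H) \<alpha>) (inv_into (edges H) \<beta>)"
proof -
  let ?a = "inv_into (nodes H) \<alpha>" and ?b = "inv_into (edges H) \<beta>"
  have \<alpha>: "bij_betw \<alpha> (nodes H) (nodes H')" and \<beta>: "bij_betw \<beta> (edges H) (edges H')"
    using i unfolding iso_def by blast+
  have "source H (?b f) = ?a (source H' f) \<and> target H (?b f) = ?a (target H' f) \<and>
     lab H (?b f) = lab H' f \<and> occur H (?b f) = occur H' f" if f: "f \<in> edges H'" for f
  proof -
    have b: "?b f \<in> edges H" "\<beta> (?b f) = f"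
      using f \<beta> unfolding bij_betw_def by (auto simp: inv_into_into f_inv_into_f)
    then have "source H' f = \<alpha> (source H (?b f))" "target H' f = \<alpha> (target H (?b f))"
      "lab H' f = lab H (?b f)" "occur H' f = occur H (?b f)"
      using i unfolding iso_def by metis+
    moreover have "source H (?b f) \<in> nodes H" "target H (?b f) \<in> nodes H"
      using H b(1) unfolding shape_graph_def is_graph_def by blast+
    ultimately show ?thesis using \<alpha> unfolding bij_betw_def by (simp add: inv_into_f_f)
  qed
  then show ?thesis unfolding iso_def using bij_betw_inv_into[OF \<alpha>] bij_betw_inv_into[OF \<beta>] by blast
qed

lemma iso_embeds:
  assumes G: "simple_graph \<Sigma> G" and H: "shape_graph \<Sigma> H" and H': "shape_graph \<Sigma> H'"
    and i: "iso H H' \<alpha> \<beta>" and emb: "G \<preceq> H"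
  shows "G \<preceq> H'"
proof -
  obtain R where R: "simulation G H R" "Domain R = nodes G"
    using emb unfolding embeds_def embedding_def by blast
  have sim: "R \<subseteq> nodes G \<times> nodes H" "\<And>n h. (n, h) \<in> R \<Longrightarrow> matches G H (\<lambda>x y. (x, y) \<in> R) n h"
    using R(1) unfolding simulation_iff[OF G H] by blast+
  have \<alpha>: "inj_on \<alpha> (nodes H)" "\<alpha> ` nodes H = nodes H'" and \<beta>: "inj_on \<beta> (edges H)" "\<beta> ` edges H = edges H'"
    using i unfolding iso_def bij_betw_def by blast+
  have b: "source H' (\<beta> f) = \<alpha> (source H f)" "target H' (\<beta> f) = \<alpha> (target H f)"
    "lab H' (\<beta> f) = lab H f" "occur H' (\<beta> f) = occur H f" if "f \<in> edges H" for f
    using i that unfolding iso_def by blast+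
  define R' where "R' = {(n, \<alpha> h) | n h. (n, h) \<in> R}"
  have out: "out H' (\<alpha> h) = \<beta> ` out H h" if h: "h \<in> nodes H" for h
  proof (intro equalityI subsetI)
    fix f' assume "f' \<in> out H' (\<alpha> h)"
    then have "f' \<in> edges H'" "source H' f' = \<alpha> h" unfolding out_def by simp_all
    then obtain f where f: "f \<in> edges H" "f' = \<beta> f" "\<alpha> (source H f) = \<alpha> h"
      using \<beta>(2) b(1) by (metis imageE)
    have "source H f \<in> nodes H" using H f(1) unfolding shape_graph_def is_graph_def by blast
    then have "source H f = h" using inj_onD[OF \<alpha>(1) f(3)] h by blast
    then show "f' \<in> \<beta> ` out H h" using f unfolding out_def by blast
  next
    fix f' assume "f' \<in> \<beta> ` out H h"
    then obtain f where f: "f \<in> edges H" "source H f = h" "f' = \<beta> f" unfolding out_def by blast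
    then have "f' \<in> edges H'" using \<beta>(2) by blast
    then show "f' \<in> out H' (\<alpha> h)" using b(1)[OF f(1)] f(2,3) unfolding out_def by simp
  qed
  have "matches G H' (\<lambda>x y. (x, y) \<in> R') n (\<alpha> h)" if nh: "(n, h) \<in> R" for n h
  proof -
    obtain \<phi> where \<phi>: "\<And>e. e \<in> out G n \<Longrightarrow> \<phi> e \<in> allowed G H (\<lambda>x y. (x, y) \<in> R) h e" "obeys G H n h \<phi>"
      using sim(2)[OF nh] unfolding matches_def by blast
    have hn: "h \<in> nodes H" using sim(1) nh by blast
    have oe: "f \<in> edges H" if "f \<in> out H h" for f using that unfolding out_def by blast
    have p: "\<phi> e \<in> out H h" "lab G e = lab H (\<phi> e)" "(target G e, target H (\<phi> e)) \<in> R" if "e \<in> out G n" for e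
      using \<phi>(1)[OF that] unfolding allowed_def by blast+
    have al: "\<beta> (\<phi> e) \<in> allowed G H' (\<lambda>x y. (x, y) \<in> R') (\<alpha> h) e" if e: "e \<in> out G n" for e
    proof -
      have "\<beta> (\<phi> e) \<in> out H' (\<alpha> h)" using p(1)[OF e] out[OF hn] by blast
      moreover have "lab G e = lab H' (\<beta> (\<phi> e))" using p(2)[OF e] b(3)[OF oe[OF p(1)[OF e]]] by simp
      moreover have "(target G e, target H' (\<beta> (\<phi> e))) \<in> R'"
        using p(3)[OF e] b(2)[OF oe[OF p(1)[OF e]]] unfolding R'_def by auto
      ultimately show ?thesis unfolding allowed_def by simp
    qed
    have ob: "obeys G H' n (\<alpha> h) (\<lambda>e. \<beta> (\<phi> e))"
      unfolding obeys_def
    proof (intro ballI conjI impI)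
      fix f' assume "f' \<in> out H' (\<alpha> h)" and r: "req H' f'"
      then obtain f where f: "f \<in> out H h" "f' = \<beta> f" using out[OF hn] by blast
      then have "req H f" using r b(4)[OF oe[OF f(1)]] unfolding req_def by simp
      then show "\<exists>e \<in> out G n. \<beta> (\<phi> e) = f'" using \<phi>(2) f unfolding obeys_def by blast
    next
      fix f' e e' assume "f' \<in> out H' (\<alpha> h)" and r: "\<not> unb H' f'" and e: "e \<in> out G n" "e' \<in> out G n"
        "\<beta> (\<phi> e) = f'" "\<beta> (\<phi> e') = f'"
      then obtain f where f: "f \<in> out H h" "f' = \<beta> f" using out[OF hn] by blast
      then have u: "\<not> unb H f" using r b(4)[OF oe[OF f(1)]] unfolding unb_def by simp
      have ef: "\<phi> e = f" "\<phi> e' = f"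
        using inj_onD[OF \<beta>(1) _ oe[OF p(1)[OF e(1)]] oe[OF f(1)]]
          inj_onD[OF \<beta>(1) _ oe[OF p(1)[OF e(2)]] oe[OF f(1)]] e(3,4) f(2) by simp_all
      show "e = e'"
        by (rule bspec[OF \<phi>(2)[unfolded obeys_def] f(1), THEN conjunct2, rule_format, OF u e(1,2) ef])
    qed
    show ?thesis
      unfolding matches_def by (rule exI[of _ "\<lambda>e. \<beta> (\<phi> e)"], intro conjI ballI al ob)
  qed
  moreover have "\<exists>h. m = \<alpha> h \<and> (n, h) \<in> R" if "(n, m) \<in> R'" for n m
    using that unfolding R'_def by blast
  ultimately have "\<forall>(n, m) \<in> R'. matches G H' (\<lambda>x y. (x, y) \<in> R') n m" by fastforce
  moreover have "R' \<subseteq> nodes G \<times> nodes H'" using sim(1) \<alpha>(2) unfolding R'_def by blast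
  ultimately have "simulation G H' R'" unfolding simulation_iff[OF G H'] by blast
  moreover have "Domain R' = nodes G" using R(2) unfolding R'_def by blast
  ultimately show ?thesis unfolding embeds_def embedding_def by blast
qed

lemma iso_lang:
  assumes "shape_graph \<Sigma> H" "shape_graph \<Sigma> H'" "iso H H' \<alpha> \<beta>"
  shows "lang \<Sigma> H = lang \<Sigma> H'"
  unfolding lang_def
  using iso_embeds[OF _ assms(1,2,3)] iso_embeds[OF _ assms(2,1) iso_sym[OF assms(1,3)]] by blast

text \<open>Converse of \<open>drop_code\<close>. Whatever numbering and order of edges a code used,
  parsing recovers an isomorphic graph and the end of the code, even when more input follows. In
  particular a word splits into two codes in only one way.\<close>

lemma encodes_valid:
  assumes c: "inj_on c \<Sigma>" and H: "shape_graph \<Sigma> H" and u: "encodes c u H" and d: "drop p w = u @ r"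
  shows "valid \<Sigma> c w p" "drop (code_end w p) w = r" "lang \<Sigma> H = lang \<Sigma> (dec \<Sigma> c w p)"
proof -
  obtain num es where num: "bij_betw num (nodes H) {..<card (nodes H)}" and es: "distinct es" "set es = edges H"
    and u: "u = unary (card (nodes H)) @ unary (length es) @ concat (map (edge_code c H num) es)"
    using u unfolding encodes_def by blast
  let ?n = "card (nodes H)" and ?m = "length es" and ?p = "fld3 w p" and ?G = "dec \<Sigma> c w p"
  note 1 = ulen_unary[OF d[unfolded u append_assoc]]
  note 2 = ulen_unary[OF 1(3)]
  have "drop (pos w ?p i) w = concat (map (edge_code c H num) (drop i es)) @ r" if "i \<le> ?m" for i
    using that
  proof (induction i)
    case 0
    then show ?case using 2(3) by (simp add: pos_simps)
  next
    case (Suc i)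
    then have "drop (pos w ?p i) w = concat (map (edge_code c H num) (es ! i # drop (Suc i) es)) @ r"
      by (simp add: Cons_nth_drop_Suc)
    then have "drop (pos w ?p i) w = unary (num (source H (es ! i))) @ unary (num (target H (es ! i))) @
      unary (c (lab H (es ! i))) @ [fst (occur H (es ! i)) = 1, snd (occur H (es ! i)) = \<infinity>] @
      concat (map (edge_code c H num) (drop (Suc i) es)) @ r"
      by (simp add: edge_code_def[of _ _ _ "es ! i"] interval_code_def)
    from edge_unary(7)[OF this] show ?case unfolding pos_simps .
  qed
  note dr = this
  from dr[OF order_refl] show "drop (code_end w p) w = r" by (simp add: code_end_def 2(1))
  have at: "drop (pos w ?p i) w = unary (num (source H (es ! i))) @ unary (num (target H (es ! i))) @
      unary (c (lab H (es ! i))) @ [fst (occur H (es ! i)) = 1, snd (occur H (es ! i)) = \<infinity>] @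
      concat (map (edge_code c H num) (drop (Suc i) es)) @ r" if "i < ?m" for i
    using dr[of i] that by (simp add: edge_code_def[of _ _ _ "es ! i"] interval_code_def flip: Cons_nth_drop_Suc)
  note E = edge_unary[OF at]
  have esE: "es ! i \<in> edges H" if "i < ?m" for i using that es(2) nth_mem by blast
  have nl: "num x < ?n" if "x \<in> nodes H" for x using num that unfolding bij_betw_def by blast
  have "valid \<Sigma> c w p"
    unfolding valid_def 1(1) 2(1)
  proof (intro conjI allI impI)
    show "fld3 w p \<le> length w" by (rule 2(2))
    fix i assume i: "i < ?m"
    show "is_edge w (pos w ?p i)" by (rule E(1)[OF i])
    show "ulen w (pos w ?p i) < ?n" "ulen w (fld2 w (pos w ?p i)) < ?n" "ulen w (fld3 w (pos w ?p i)) \<in> c ` \<Sigma>"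
      using E(2-4)[OF i] nl shape_graphD[OF H esE[OF i]] by simp_all
  qed
  then show v: "valid \<Sigma> c w p" .
  have "iso ?G H (inv_into (nodes H) num) (nth es)"
    unfolding iso_def
  proof (intro conjI ballI)
    show "bij_betw (inv_into (nodes H) num) (nodes ?G) (nodes H)"
      unfolding dec_simps 1(1) by (rule bij_betw_inv_into[OF num])
    show "bij_betw (nth es) (edges ?G) (edges H)"
      unfolding dec_simps 2(1) using bij_betw_nth[OF es(1), of "{..<?m}" "set es"] es(2) by simp
    fix f assume "f \<in> edges ?G"
    then have f: "f < ?m" by (simp add: dec_simps 2(1))
    note s = shape_graphD[OF H esE[OF f]]
    have inv: "inv_into (nodes H) num (num x) = x" if "x \<in> nodes H" for x
      using num that unfolding bij_betw_def by (simp add: inv_into_f_f)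
    show "source H (es ! f) = inv_into (nodes H) num (source ?G f)"
      using E(2)[OF f] inv[OF s(1)] by (simp add: dec_simps)
    show "target H (es ! f) = inv_into (nodes H) num (target ?G f)"
      using E(3)[OF f] inv[OF s(2)] by (simp add: dec_simps)
    show "lab H (es ! f) = lab ?G f"
      using E(4)[OF f] inv_into_f_f[OF c s(3)] by (simp add: dec_simps)
    have "occur H (es ! f) \<in> basic_intervals" using H esE[OF f] unfolding shape_graph_def by blast
    then show "occur H (es ! f) = occur ?G f"
      using E(5,6)[OF f] f unfolding dec_simps 2(1) basic_intervals_def by auto
  qed
  then show "lang \<Sigma> H = lang \<Sigma> ?G" using iso_lang[OF shape_dec[OF v] H] by metis
qed

section \<open>Programs for Turing machines\<close>

text \<open>\<open>Op i f\<close> performs on tape \<open>i\<close> any action that \<open>f\<close>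
  offers for the symbol read. Nondeterminism, and rejection by an empty offer, enter a program only
  here.\<close>

datatype prog =
    Op nat "nat \<Rightarrow> (nat \<times> direction) set"
  | Sq prog prog
  | Cond nat "nat set" prog prog
  | Loop nat "nat set" prog

type_synonym store = "nat \<Rightarrow> tape"

fun wf_prog :: "nat \<Rightarrow> prog \<Rightarrow> bool" where
  "wf_prog k (Op i f) \<longleftrightarrow> i < k \<and> (\<forall>s < 3. \<forall>(b, d) \<in> f s. b < 3)"
| "wf_prog k (Sq p q) \<longleftrightarrow> wf_prog k p \<and> wf_prog k q"
| "wf_prog k (Cond i B p q) \<longleftrightarrow> i < k \<and> wf_prog k p \<and> wf_prog k q"
| "wf_prog k (Loop i B p) \<longleftrightarrow> i < k \<and> wf_prog k p"

text \<open>A control state is the stack of programs still to be run. A transition yields the new stack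
  and the action on one tape; idle transitions rewrite the symbol under head \<open>0\<close>.\<close>

fun trns :: "prog list \<Rightarrow> (nat \<Rightarrow> nat) \<Rightarrow> (prog list \<times> nat \<times> nat \<times> direction) set" where
  "trns [] r = {}"
| "trns (Op i f # ks) r = {(ks, i, b, d) | b d. (b, d) \<in> f (r i)}"
| "trns (Sq p q # ks) r = {(p # q # ks, 0, r 0, Stay)}"
| "trns (Cond i B p q # ks) r = {((if r i \<in> B then p else q) # ks, 0, r 0, Stay)}"
| "trns (Loop i B p # ks) r =
     {(if r i \<in> B then p # Loop i B p # ks else ks, 0, r 0, Stay)}"

definition reads :: "store \<Rightarrow> nat \<Rightarrow> nat" where
  "reads \<sigma> i = read_tape (\<sigma> i)"

definition cstep :: "((prog list \<times> store) \<times> (prog list \<times> store)) set" where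
  "cstep = {((ks, \<sigma>), (ks', \<sigma>(i := perform (b, d) (\<sigma> i)))) | ks \<sigma> ks' i b d.
     (ks', i, b, d) \<in> trns ks (reads \<sigma>)}"

text \<open>The stacks that occur while \<open>p\<close> runs on top of \<open>ks\<close>, up to but
  excluding \<open>ks\<close> itself. A loop puts itself back on the stack, so the set is finite
  although runs may be long; it supplies the states of the machine.\<close>

fun conts :: "prog \<Rightarrow> prog list \<Rightarrow> prog list set" where
  "conts (Op i f) ks = {Op i f # ks}"
| "conts (Sq p q) ks = {Sq p q # ks} \<union> conts p (q # ks) \<union> conts q ks"
| "conts (Cond i B p q) ks = {Cond i B p q # ks} \<union> conts p ks \<union> conts q ks"
| "conts (Loop i B p) ks = {Loop i B p # ks} \<union> conts p (Loop i B p # ks)"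

lemma finite_conts: "finite (conts p ks)"
  by (induction p arbitrary: ks) auto

lemma conts_self: "p # ks \<in> conts p ks"
  by (cases p) auto

lemma conts_closed:
  assumes "s \<in> conts p ks" and "(s', i, b, d) \<in> trns s r"
  shows "s' = ks \<or> s' \<in> conts p ks"
  using assms
proof (induction p arbitrary: ks)
  case (Sq p q)
  then show ?case using conts_self[of p "q # ks"] conts_self[of q ks] by auto
next
  case (Cond j B p q)
  then show ?case using conts_self[of p ks] conts_self[of q ks] by auto
next
  case (Loop j B p)
  then show ?case using conts_self[of p "Loop j B p # ks"] by (auto split: if_splits)
qed auto

lemma conts_wf:
  "s \<in> conts p ks \<Longrightarrow> wf_prog k p \<Longrightarrow> list_all (wf_prog k) ks \<Longrightarrow> list_all (wf_prog k) s"
  by (induction p arbitrary: ks) auto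

lemma trns_wf:
  assumes "(s', i, b, d) \<in> trns s r" and "\<forall>q \<in> set s. wf_prog k q" and "k > 0"
    and "\<And>j. j < k \<Longrightarrow> r j < 3"
  shows "i < k \<and> b < 3"
proof (cases "\<exists>j f ks. s = Op j f # ks")
  case True
  then obtain j f ks where "s = Op j f # ks" by blast
  with assms(1,2,4) show ?thesis by fastforce
next
  case False
  with assms show ?thesis by (cases "(s, r)" rule: trns.cases) auto
qed

section \<open>Translation of programs to Turing machines\<close>

locale compiled =
  fixes k :: nat and P :: prog
  assumes k: "k > 0" and wf: "wf_prog k P"
begin

definition "Q = insert [] (conts P [])"
definition "idx = (SOME f. bij_betw f Q {..<card Q})"
definition "stk = inv_into Q idx"

definition act :: "nat \<Rightarrow> nat \<Rightarrow> direction \<Rightarrow> nat list \<Rightarrow> (nat \<times> direction) list" where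
  "act i b d ss = map (\<lambda>j. if j = i then (b, d) else (ss ! j, Stay)) [0..<k]"

definition M :: ntm where
  "M = \<lparr>num_tapes = k, num_states = card Q, num_symbols = 3, start = idx [P], accept = idx [],
     delta = \<lambda>q ss. {(idx s', act i b d ss) | s' i b d. (s', i, b, d) \<in> trns (stk q) (nth ss)}\<rparr>"

definition cfg :: "prog list \<times> store \<Rightarrow> config" where
  "cfg x = (idx (fst x), map (snd x) [0..<k])"

lemma finite_Q: "finite Q"
  by (simp add: Q_def finite_conts)

lemma bij_idx: "bij_betw idx Q {..<card Q}"
  unfolding idx_def using ex_bij_betw_finite_nat[OF finite_Q]
  by (intro someI_ex[of "\<lambda>f. bij_betw f Q {..<card Q}"]) (auto simp: atLeast0LessThan)

lemma idx_less: "s \<in> Q \<Longrightarrow> idx s < card Q"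
  using bij_idx by (auto simp: bij_betw_def)

lemma stk_idx: "s \<in> Q \<Longrightarrow> stk (idx s) = s"
  using bij_idx by (auto simp: bij_betw_def stk_def)

lemma stk_mem: "q < card Q \<Longrightarrow> stk q \<in> Q"
  using bij_idx unfolding stk_def bij_betw_def by (metis inv_into_into lessThan_iff)

lemma Q_closed: "s \<in> Q \<Longrightarrow> (s', i, b, d) \<in> trns s r \<Longrightarrow> s' \<in> Q"
  using conts_closed[of s P "[]" s' i b d r] by (cases s) (auto simp: Q_def)

lemma Q_wf: "s \<in> Q \<Longrightarrow> \<forall>q \<in> set s. wf_prog k q"
  using conts_wf[of s P "[]" k] wf by (auto simp: Q_def list_all_iff)

lemma start_Q: "[P] \<in> Q" "[] \<in> Q"
  using conts_self[of P "[]"] by (auto simp: Q_def)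

lemma is_ntm_M: "is_ntm M"
proof -
  have "q' < card Q \<and> length as = k \<and> fst ` set as \<subseteq> {..<3}"
    if q: "q < card Q" and ss: "length ss = k" "set ss \<subseteq> {..<3}"
      and d: "(q', as) \<in> delta M q ss" for q ss q' as
  proof -
    obtain s' i b d where *: "q' = idx s'" "as = act i b d ss" "(s', i, b, d) \<in> trns (stk q) (nth ss)"
      using d by (auto simp: M_def)
    have r: "ss ! j < 3" if "j < k" for j
      using ss that nth_mem[of j ss] by (auto simp: subset_iff)
    have "i < k \<and> b < 3"
      using trns_wf[OF *(3) Q_wf[OF stk_mem[OF q]] k] r by simp
    then show ?thesis
      using idx_less[OF Q_closed[OF stk_mem[OF q] *(3)]] * r by (auto simp: act_def)
  qed
  then have "\<forall>q < card Q. \<forall>ss. length ss = k \<and> set ss \<subseteq> {..<3} \<longrightarrow>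
      (\<forall>(q', as) \<in> delta M q ss. q' < card Q \<and> length as = k \<and> fst ` set as \<subseteq> {..<3})"
    by blast
  moreover have "delta M (accept M) ss = {}" for ss
    using start_Q by (simp add: M_def stk_idx)
  moreover have "num_tapes M = k" "num_states M = card Q" "num_symbols M = 3"
      "start M < card Q" "accept M < card Q"
    using start_Q idx_less by (auto simp: M_def)
  ultimately show ?thesis
    using k unfolding is_ntm_def by simp
qed

lemma perform_idle: "perform (read_tape t, Stay) t = t"
  by (cases t) (auto simp: read_tape_def)

lemma map_act:
  assumes "i < k"
  shows "map2 perform (act i b d (map read_tape (map \<sigma> [0..<k]))) (map \<sigma> [0..<k]) =
    map (\<sigma>(i := perform (b, d) (\<sigma> i))) [0..<k]"
  using assms by (intro nth_equalityI) (auto simp: act_def perform_idle)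

text \<open>A store has infinitely many tapes; well-formedness confines a program to the first
  \<open>k\<close>, which are all that the machine sees.\<close>

lemma trns_cong:
  assumes "\<forall>q \<in> set s. wf_prog k q" and "\<And>j. j < k \<Longrightarrow> r j = r' j"
  shows "trns s r = trns s r'"
  using assms k by (cases "(s, r)" rule: trns.cases) auto

lemma trns_tape:
  assumes "\<forall>q \<in> set s. wf_prog k q" and "(s', i, b, d) \<in> trns s r"
  shows "i < k"
  using assms k by (cases "(s, r)" rule: trns.cases) auto

lemma step_cfg:
  assumes "fst x \<in> Q"
  shows "(cfg x, c') \<in> step M \<longleftrightarrow> (\<exists>y. (x, y) \<in> cstep \<and> c' = cfg y)"
proof -
  obtain s \<sigma> where x: "x = (s, \<sigma>)" by (cases x)
  have s: "s \<in> Q" using assms x by simp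
  let ?ts = "map \<sigma> [0..<k]"
  have eq: "trns s (nth (map read_tape ?ts)) = trns s (reads \<sigma>)"
    by (rule trns_cong[OF Q_wf[OF s]]) (simp add: reads_def)
  have "(cfg x, c') \<in> step M \<longleftrightarrow> (\<exists>s' i b d. (s', i, b, d) \<in> trns s (reads \<sigma>) \<and>
      c' = (idx s', map2 perform (act i b d (map read_tape ?ts)) ?ts))"
    unfolding step_def cfg_def x M_def using eq s by (fastforce simp: stk_idx)
  also have "\<dots> \<longleftrightarrow> (\<exists>s' i b d. (s', i, b, d) \<in> trns s (reads \<sigma>) \<and>
      c' = cfg (s', \<sigma>(i := perform (b, d) (\<sigma> i))))"
    using map_act trns_tape[OF Q_wf[OF s]] unfolding cfg_def fst_conv snd_conv by metis
  also have "\<dots> \<longleftrightarrow> (\<exists>y. (x, y) \<in> cstep \<and> c' = cfg y)"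
    unfolding cstep_def x by blast
  finally show ?thesis .
qed

lemma cstep_Q: "(x, y) \<in> cstep \<Longrightarrow> fst x \<in> Q \<Longrightarrow> fst y \<in> Q"
  using Q_closed by (auto simp: cstep_def)

lemma csteps_Q: "(x, y) \<in> cstep ^^ n \<Longrightarrow> fst x \<in> Q \<Longrightarrow> fst y \<in> Q"
proof (induction n arbitrary: y)
  case (Suc n)
  then obtain z where "(x, z) \<in> cstep ^^ n" "(z, y) \<in> cstep" by (auto elim: relpow_Suc_E)
  with Suc show ?case using cstep_Q by blast
qed simp

lemma steps_cfg:
  assumes "fst x \<in> Q"
  shows "(cfg x, c') \<in> step M ^^ n \<longleftrightarrow> (\<exists>y. (x, y) \<in> cstep ^^ n \<and> c' = cfg y)"
proof (induction n arbitrary: c')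
  case (Suc n)
  have st: "(cfg y, c') \<in> step M \<longleftrightarrow> (\<exists>z. (y, z) \<in> cstep \<and> c' = cfg z)"
    if "(x, y) \<in> cstep ^^ n" for y
    using csteps_Q[OF that assms] by (rule step_cfg)
  have "(cfg x, c') \<in> step M ^^ Suc n \<longleftrightarrow>
      (\<exists>d. (cfg x, d) \<in> step M ^^ n \<and> (d, c') \<in> step M)"
    unfolding relpow.simps by blast
  also have "\<dots> \<longleftrightarrow> (\<exists>y. (x, y) \<in> cstep ^^ n \<and> (cfg y, c') \<in> step M)"
    unfolding Suc.IH by blast
  also have "\<dots> \<longleftrightarrow> (\<exists>y. (x, y) \<in> cstep ^^ n \<and> (\<exists>z. (y, z) \<in> cstep \<and> c' = cfg z))"
    using st by metis
  finally show ?case unfolding relpow.simps by blast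
qed (simp add: eq_commute)

end

text \<open>A run that is stuck with a nonempty stack counts as successful: this is how a program rejects.\<close>

inductive leads :: "prog list \<times> store \<Rightarrow> nat \<Rightarrow> (prog list \<times> store) set \<Rightarrow> bool" where
  leads_in: "x \<in> D \<Longrightarrow> leads x T D"
| leads_step: "fst x \<noteq> [] \<Longrightarrow> (\<And>y. (x, y) \<in> cstep \<Longrightarrow> leads y T D) \<Longrightarrow> leads x (Suc T) D"

lemma leads_mono: "leads x T D \<Longrightarrow> T \<le> T' \<Longrightarrow> leads x T' D"
proof (induction arbitrary: T' rule: leads.induct)
  case (leads_step x T D)
  then obtain T'' where T'': "T' = Suc T''" "T \<le> T''" by (cases T') auto
  with leads_step show ?case by (simp add: leads.leads_step)
qed (rule leads_in)

lemma leads_comp: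
  assumes "leads x T D" and "\<And>y. y \<in> D \<Longrightarrow> leads y T' D'"
  shows "leads x (T + T') D'"
  using assms
proof (induction rule: leads.induct)
  case (leads_in x D T)
  then show ?case using leads_mono[of x T' D' "T + T'"] by simp
qed (simp add: leads.leads_step)

lemma leads_bound:
  assumes "leads x T D" and "\<And>y z. y \<in> D \<Longrightarrow> (y, z) \<notin> cstep" and "(x, z) \<in> cstep ^^ n"
  shows "n \<le> T"
  using assms
proof (induction arbitrary: n rule: leads.induct)
  case (leads_in x D T)
  then show ?case by (cases n) (auto elim: relpow_E2)
next
  case (leads_step x T D)
  show ?case
  proof (cases n)
    case (Suc m)
    then obtain y where "(x, y) \<in> cstep" "(y, z) \<in> cstep ^^ m"
      using leads_step.prems(2) by (metis relpow_Suc_D2)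
    then show ?thesis using leads_step.IH leads_step.prems Suc by auto
  qed simp
qed

lemma leads_final:
  assumes "leads x T D" and "\<And>y z. y \<in> D \<Longrightarrow> (y, z) \<notin> cstep" and "(x, ([], \<sigma>)) \<in> cstep\<^sup>*"
  shows "([], \<sigma>) \<in> D"
  using assms
proof (induction rule: leads.induct)
  case (leads_in x D T)
  then show ?case by (metis converse_rtranclE)
next
  case (leads_step x T D)
  then obtain y where "(x, y) \<in> cstep" "(y, ([], \<sigma>)) \<in> cstep\<^sup>*"
    by (metis converse_rtranclE fst_conv)
  then show ?case using leads_step by auto
qed

text \<open>The set \<open>Y\<close> of final stores is exact, so that one notion yields both the time bound for all
  runs and the existence of an accepting run.\<close>

definition run :: "prog \<Rightarrow> store set \<Rightarrow> nat \<Rightarrow> store set \<Rightarrow> bool" where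
  "run p X T Y \<longleftrightarrow>
     (\<forall>ks. \<forall>\<sigma> \<in> X. leads (p # ks, \<sigma>) T ((\<lambda>\<sigma>'. (ks, \<sigma>')) ` Y)) \<and>
     (\<forall>ks. \<forall>\<sigma>' \<in> Y. \<exists>\<sigma> \<in> X. ((p # ks, \<sigma>), (ks, \<sigma>')) \<in> cstep\<^sup>*)"

lemma run_mono: "run p X T Y \<Longrightarrow> T \<le> T' \<Longrightarrow> run p X T' Y"
  unfolding run_def using leads_mono by blast

lemma cstep_iff:
  "((ks, \<sigma>), y) \<in> cstep \<longleftrightarrow>
    (\<exists>ks' i b d. (ks', i, b, d) \<in> trns ks (reads \<sigma>) \<and> y = (ks', \<sigma>(i := perform (b, d) (\<sigma> i))))"
  unfolding cstep_def by blast

lemma idle_upd: "\<sigma>(i := perform (reads \<sigma> i, Stay) (\<sigma> i)) = \<sigma>"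
  by (cases "\<sigma> i") (auto simp: reads_def read_tape_def fun_eq_iff)

lemma run_Op:
  assumes "Y = {\<sigma>(i := perform a (\<sigma> i)) | \<sigma> a. \<sigma> \<in> X \<and> a \<in> f (reads \<sigma> i)}"
  shows "run (Op i f) X 1 Y"
  unfolding run_def
proof (intro conjI allI ballI)
  fix ks \<sigma> assume "\<sigma> \<in> X"
  then show "leads (Op i f # ks, \<sigma>) 1 (Pair ks ` Y)"
    unfolding One_nat_def assms by (intro leads_step) (auto simp: cstep_iff intro!: leads_in)
next
  fix ks \<sigma>' assume "\<sigma>' \<in> Y"
  then obtain \<sigma> b d where "\<sigma> \<in> X" "(b, d) \<in> f (reads \<sigma> i)" "\<sigma>' = \<sigma>(i := perform (b, d) (\<sigma> i))"
    unfolding assms by auto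
  then show "\<exists>\<sigma> \<in> X. ((Op i f # ks, \<sigma>), (ks, \<sigma>')) \<in> cstep\<^sup>*"
    by (intro bexI[of _ \<sigma>] r_into_rtrancl) (auto simp: cstep_iff)
qed

lemma cstep_Sq: "((Sq p q # ks, \<sigma>), y) \<in> cstep \<longleftrightarrow> y = (p # q # ks, \<sigma>)"
  using idle_upd[of \<sigma> 0] by (auto simp: cstep_iff)

lemma cstep_Cond:
  "((Cond i B p q # ks, \<sigma>), y) \<in> cstep \<longleftrightarrow> y = ((if reads \<sigma> i \<in> B then p else q) # ks, \<sigma>)"
  using idle_upd[of \<sigma> 0] by (auto simp: cstep_iff)

lemma cstep_Loop:
  "((Loop i B p # ks, \<sigma>), y) \<in> cstep \<longleftrightarrow>
    y = (if reads \<sigma> i \<in> B then p # Loop i B p # ks else ks, \<sigma>)"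
  using idle_upd[of \<sigma> 0] by (auto simp: cstep_iff)

lemma run_Sq:
  assumes "run p X T Y" and "run q Y T' Z" and "T + T' < T''"
  shows "run (Sq p q) X T'' Z"
proof -
  have "run (Sq p q) X (Suc (T + T')) Z"
    unfolding run_def
  proof (intro conjI allI ballI)
    fix ks \<sigma> assume "\<sigma> \<in> X"
    then have "leads (p # q # ks, \<sigma>) (T + T') (Pair ks ` Z)"
      using assms(1,2) unfolding run_def by (blast intro: leads_comp)
    then show "leads (Sq p q # ks, \<sigma>) (Suc (T + T')) (Pair ks ` Z)"
      by (intro leads_step) (auto simp: cstep_Sq)
  next
    fix ks \<sigma>' assume "\<sigma>' \<in> Z"
    then obtain \<tau> where "\<tau> \<in> Y" "((q # ks, \<tau>), (ks, \<sigma>')) \<in> cstep\<^sup>*"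
      using assms(2) unfolding run_def by blast
    moreover from this obtain \<sigma> where "\<sigma> \<in> X" "((p # q # ks, \<sigma>), (q # ks, \<tau>)) \<in> cstep\<^sup>*"
      using assms(1) unfolding run_def by blast
    moreover have "((Sq p q # ks, \<sigma>), (p # q # ks, \<sigma>)) \<in> cstep"
      by (simp add: cstep_Sq)
    ultimately show "\<exists>\<sigma> \<in> X. ((Sq p q # ks, \<sigma>), (ks, \<sigma>')) \<in> cstep\<^sup>*"
      by (meson converse_rtrancl_into_rtrancl rtrancl_trans)
  qed
  then show ?thesis using assms(3) run_mono by (metis Suc_leI)
qed

lemma run_Cond:
  assumes "\<And>\<sigma>. \<sigma> \<in> X \<Longrightarrow> reads \<sigma> i \<in> B \<longleftrightarrow> c" and "run (if c then p else q) X T Y" and "T < T'"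
  shows "run (Cond i B p q) X T' Y"
proof -
  have "run (Cond i B p q) X (Suc T) Y"
    unfolding run_def
  proof (intro conjI allI ballI)
    fix ks \<sigma> assume "\<sigma> \<in> X"
    then show "leads (Cond i B p q # ks, \<sigma>) (Suc T) (Pair ks ` Y)"
      using assms(1,2) unfolding run_def by (intro leads_step) (auto simp: cstep_Cond)
  next
    fix ks \<sigma>' assume "\<sigma>' \<in> Y"
    then obtain \<sigma> where "\<sigma> \<in> X" "(((if c then p else q) # ks, \<sigma>), (ks, \<sigma>')) \<in> cstep\<^sup>*"
      using assms(2) unfolding run_def by blast
    moreover from this have "((Cond i B p q # ks, \<sigma>), ((if c then p else q) # ks, \<sigma>)) \<in> cstep"
      using assms(1) by (simp add: cstep_Cond)
    ultimately show "\<exists>\<sigma> \<in> X. ((Cond i B p q # ks, \<sigma>), (ks, \<sigma>')) \<in> cstep\<^sup>*"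
      by (meson converse_rtrancl_into_rtrancl)
  qed
  then show ?thesis using assms(3) run_mono by (metis Suc_leI)
qed

lemma run_Loop:
  assumes body: "\<And>j. j < v \<Longrightarrow> run p (X j) T (X (Suc j))"
    and "\<And>j \<sigma>. j < v \<Longrightarrow> \<sigma> \<in> X j \<Longrightarrow> reads \<sigma> i \<in> B" and "\<And>\<sigma>. \<sigma> \<in> X v \<Longrightarrow> reads \<sigma> i \<notin> B"
    and T': "v * (T + 1) < T'"
  shows "run (Loop i B p) (X 0) T' (X v)"
proof -
  \<comment> \<open>Induction from the end: \<open>j\<close> is the number of rounds still to be
    made, each with one test, and the last summand is the test that leaves the loop.\<close>
  have "run (Loop i B p) (X (v - j)) (j * (T + 1) + 1) (X v)" if "j \<le> v" for j
    using that
  proof (induction j)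
    case 0
    have "leads (Loop i B p # ks, \<sigma>) (Suc 0) (Pair ks ` X v)" if "\<sigma> \<in> X v" for ks \<sigma>
      using assms(3)[OF that] that by (intro leads_step) (auto simp: cstep_Loop intro: leads_in)
    moreover have "((Loop i B p # ks, \<sigma>), (ks, \<sigma>)) \<in> cstep" if "\<sigma> \<in> X v" for ks \<sigma>
      using assms(3)[OF that] by (simp add: cstep_Loop)
    ultimately show ?case unfolding run_def by (simp, blast)
  next
    case (Suc j)
    let ?i = "v - Suc j"
    have i: "?i < v" "Suc ?i = v - j" using Suc.prems by auto
    have IH: "run (Loop i B p) (X (Suc ?i)) (j * (T + 1) + 1) (X v)" using Suc i by simp
    note b = body[OF i(1)] and c = assms(2)[OF i(1)]
    have "leads (Loop i B p # ks, \<sigma>) (Suc (T + (j * (T + 1) + 1))) (Pair ks ` X v)"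
      if "\<sigma> \<in> X ?i" for ks \<sigma>
    proof -
      have "leads (p # Loop i B p # ks, \<sigma>) (T + (j * (T + 1) + 1)) (Pair ks ` X v)"
      proof (rule leads_comp)
        show "leads (p # Loop i B p # ks, \<sigma>) T (Pair (Loop i B p # ks) ` X (Suc ?i))"
          using b that unfolding run_def by blast
      next
        fix y assume "y \<in> Pair (Loop i B p # ks) ` X (Suc ?i)"
        then show "leads y (j * (T + 1) + 1) (Pair ks ` X v)"
          using IH unfolding run_def by blast
      qed
      then show ?thesis using c[OF that] by (intro leads_step) (auto simp: cstep_Loop)
    qed
    moreover have "\<exists>\<sigma> \<in> X ?i. ((Loop i B p # ks, \<sigma>), (ks, \<sigma>')) \<in> cstep\<^sup>*"
      if "\<sigma>' \<in> X v" for ks \<sigma>'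
    proof -
      obtain \<tau> where t: "\<tau> \<in> X (Suc ?i)" "((Loop i B p # ks, \<tau>), (ks, \<sigma>')) \<in> cstep\<^sup>*"
        using IH \<open>\<sigma>' \<in> X v\<close> unfolding run_def by blast
      then obtain \<sigma> where s: "\<sigma> \<in> X ?i"
        "((p # Loop i B p # ks, \<sigma>), (Loop i B p # ks, \<tau>)) \<in> cstep\<^sup>*"
        using b unfolding run_def by blast
      moreover have "((Loop i B p # ks, \<sigma>), (p # Loop i B p # ks, \<sigma>)) \<in> cstep"
        using c[OF s(1)] by (simp add: cstep_Loop)
      ultimately show ?thesis
        using t by (meson converse_rtrancl_into_rtrancl rtrancl_trans)
    qed
    ultimately show ?case unfolding run_def by (simp add: algebra_simps)
  qed
  from this[of v] have "run (Loop i B p) (X 0) (v * (T + 1) + 1) (X v)" by simp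
  then show ?thesis using T' by (auto elim: run_mono)
qed

definition init_store :: "bool list \<Rightarrow> store" where
  "init_store w = (\<lambda>_. blank_tape)(0 := input_tape w)"

lemma NEXP_run:
  fixes T :: "nat poly"
  assumes "k > 0" and "wf_prog k P"
    and r: "\<And>w. run P {init_store w} (2 ^ poly T (length w)) (Y w)"
  shows "{w. Y w \<noteq> {}} \<in> NEXP"
proof -
  interpret compiled k P by unfold_locales fact+
  have halt: "(y, z) \<notin> cstep" if "y \<in> Pair [] ` Y w" for y z w
    using that by (auto simp: cstep_iff)
  have init: "init_config M w = cfg ([P], init_store w)" for w
  proof -
    have "map (init_store w) [0..<k] = input_tape w # replicate (k - 1) blank_tape"
      using k by (intro nth_equalityI) (auto simp: init_store_def nth_Cons split: nat.split)
    then show ?thesis by (simp add: init_config_def cfg_def M_def)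
  qed
  have l: "leads ([P], init_store w) (2 ^ poly T (length w)) (Pair [] ` Y w)" for w
    using r unfolding run_def by blast
  have "runs_in_time M (\<lambda>n. 2 ^ poly T n)"
    unfolding runs_in_time_def
  proof (intro allI impI)
    fix w n c assume "(init_config M w, c) \<in> step M ^^ n"
    then obtain y where "(([P], init_store w), y) \<in> cstep ^^ n"
      using steps_cfg[of "([P], init_store w)"] start_Q unfolding init by auto
    then show "n \<le> 2 ^ poly T (length w)" using leads_bound[OF l[of w] halt[of _ w]] by blast
  qed
  moreover have "accepts M w \<longleftrightarrow> Y w \<noteq> {}" for w
  proof
    assume "accepts M w"
    then obtain c n where c: "(init_config M w, c) \<in> step M ^^ n" "fst c = idx []"
      unfolding accepts_def by (auto simp: rtrancl_power M_def)
    then obtain y where y: "(([P], init_store w), y) \<in> cstep ^^ n" "c = cfg y"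
      using steps_cfg[of "([P], init_store w)"] start_Q unfolding init by auto
    then have y_Q: "fst y \<in> Q" using csteps_Q start_Q by simp
    have "idx (fst y) = idx []" using c y by (simp add: cfg_def)
    then have "fst y = []" using stk_idx[OF y_Q] stk_idx[OF start_Q(2)] by simp
    then obtain \<sigma> where "y = ([], \<sigma>)" by (cases y) auto
    then have "(([P], init_store w), ([], \<sigma>)) \<in> cstep\<^sup>*" using y(1) by (auto simp: rtrancl_power)
    then show "Y w \<noteq> {}" using leads_final[OF l[of w] halt[of _ w]] by blast
  next
    assume "Y w \<noteq> {}"
    then obtain \<sigma> where "\<sigma> \<in> Y w" by auto
    then have "(([P], init_store w), ([], \<sigma>)) \<in> cstep\<^sup>*" using r unfolding run_def by blast
    then obtain n where "(([P], init_store w), ([], \<sigma>)) \<in> cstep ^^ n" by (auto simp: rtrancl_power)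
    then have "(init_config M w, cfg ([], \<sigma>)) \<in> step M ^^ n"
      unfolding init using steps_cfg[of "([P], init_store w)"] start_Q by auto
    then show "accepts M w"
      unfolding accepts_def by (auto simp: rtrancl_power cfg_def M_def)
  qed
  ultimately have "{w. Y w \<noteq> {}} \<in> NTIME (\<lambda>n. 2 ^ poly T n)"
    unfolding NTIME_def using is_ntm_M by (intro CollectI exI[of _ M]) auto
  then show ?thesis unfolding NEXP_def by (rule UN_I[OF UNIV_I])
qed

text \<open>A number is stored in unary; \<open>nump h v\<close> is the number \<open>v\<close> with the head at position \<open>h\<close>.\<close>

definition nump :: "int \<Rightarrow> nat \<Rightarrow> tape" where
  "nump h v = (h, \<lambda>i. if 0 \<le> i \<and> i < int v then 1 else 0)"

abbreviation num :: "nat \<Rightarrow> tape" where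
  "num \<equiv> nump 0"

section \<open>Building blocks on unary numbers\<close>

abbreviation det :: "prog \<Rightarrow> store \<Rightarrow> nat \<Rightarrow> store \<Rightarrow> bool" where
  "det p \<sigma> T \<tau> \<equiv> run p {\<sigma>} T {\<tau>}"

abbreviation Wr :: "nat \<Rightarrow> nat \<Rightarrow> direction \<Rightarrow> prog" where
  "Wr i b d \<equiv> Op i (\<lambda>_. {(b, d)})"

abbreviation Mv :: "nat \<Rightarrow> direction \<Rightarrow> prog" where
  "Mv i d \<equiv> Op i (\<lambda>s. {(s, d)})"

abbreviation skip :: prog where
  "skip \<equiv> Mv 0 Stay"

abbreviation Guess :: "nat \<Rightarrow> prog" where
  "Guess i \<equiv> Op i (\<lambda>_. {0, 1} \<times> {Move_Right})"

fun seqs :: "prog list \<Rightarrow> prog" where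
  "seqs [] = skip"
| "seqs (p # ps) = Sq p (seqs ps)"

text \<open>The first move left handles a head that stands on the blank just after the number. The
  loop then stops on the blank at -1, and the last move returns to 0.\<close>

definition rewind :: "nat \<Rightarrow> prog" where
  "rewind i = Sq (Mv i Move_Left) (Sq (Loop i {1} (Mv i Move_Left)) (Mv i Move_Right))"

text \<open>The head position is the loop counter, so the number on tape \<open>i\<close> survives
  the loop. The price is that nested loops need separate tapes.\<close>

definition For :: "nat \<Rightarrow> prog \<Rightarrow> prog" where
  "For i p = Sq (Loop i {1} (Sq p (Mv i Move_Right))) (rewind i)"

definition inc :: "nat \<Rightarrow> prog" where
  "inc i = Sq (Loop i {1} (Mv i Move_Right)) (Sq (Wr i 1 Stay) (rewind i))"

definition clear :: "nat \<Rightarrow> prog" where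
  "clear i = Sq (Loop i {1} (Mv i Move_Right))
     (Sq (Mv i Move_Left) (Sq (Loop i {1} (Wr i 0 Move_Left)) (Mv i Move_Right)))"

definition addto :: "nat \<Rightarrow> nat \<Rightarrow> prog" where
  "addto i j = For i (inc j)"

text \<open>Sets of final stores are exact, so they can be united; this lifts runs from single
  stores to all the stores that guessing may produce.\<close>

lemma run_UN:
  "(\<And>x. x \<in> A \<Longrightarrow> run p (X x) T (Y x)) \<Longrightarrow> run p (\<Union>x \<in> A. X x) T (\<Union>x \<in> A. Y x)"
proof -
  assume *: "\<And>x. x \<in> A \<Longrightarrow> run p (X x) T (Y x)"
  have "leads (p # ks, \<sigma>) (T + 0) (Pair ks ` (\<Union>x \<in> A. Y x))" if "x \<in> A" "\<sigma> \<in> X x" for ks \<sigma> x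
  proof (rule leads_comp)
    show "leads (p # ks, \<sigma>) T (Pair ks ` Y x)" using *[OF that(1)] that(2) unfolding run_def by blast
  qed (use that in \<open>auto intro!: leads_in\<close>)
  moreover have "\<exists>\<sigma> \<in> X x. ((p # ks, \<sigma>), (ks, \<sigma>')) \<in> cstep\<^sup>*" if "x \<in> A" "\<sigma>' \<in> Y x" for ks \<sigma>' x
    using *[OF that(1)] that(2) unfolding run_def by blast
  ultimately show ?thesis unfolding run_def by fastforce
qed

lemma run_image:
  "(\<And>x. x \<in> A \<Longrightarrow> run p {f x} T {g x}) \<Longrightarrow> run p (f ` A) T (g ` A)"
  using run_UN[of A p "\<lambda>x. {f x}" T "\<lambda>x. {g x}"] by (simp add: UNION_singleton_eq_range)

lemma det_Op: "f (reads \<sigma> i) = {a} \<Longrightarrow> \<tau> = \<sigma>(i := perform a (\<sigma> i)) \<Longrightarrow> det (Op i f) \<sigma> 1 \<tau>"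
  by (rule run_Op) (cases a, auto)

lemma perform_move: "perform (snd t (fst t), d) t = (fst t + offset d, snd t)"
  by (cases t) auto

lemma reads_nump: "\<sigma> i = nump h v \<Longrightarrow> reads \<sigma> i = (if 0 \<le> h \<and> h < int v then 1 else 0)"
  by (simp add: reads_def read_tape_def nump_def)

lemma det_Mv: "\<tau> = \<sigma>(i := (fst (\<sigma> i) + offset d, snd (\<sigma> i))) \<Longrightarrow> det (Mv i d) \<sigma> 1 \<tau>"
  by (rule det_Op[OF refl]) (simp add: reads_def read_tape_def perform_move)

lemma det_Mv_nump:
  "\<sigma> i = nump h v \<Longrightarrow> \<tau> = \<sigma>(i := nump (h + offset d) v) \<Longrightarrow> det (Mv i d) \<sigma> 1 \<tau>"
  by (rule det_Mv) (simp add: nump_def)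

lemma det_skip: "det skip \<sigma> 1 \<sigma>"
  by (rule det_Mv) simp

lemma det_Loop:
  assumes "\<And>j. j < v \<Longrightarrow> det p (s j) T (s (Suc j))"
    and "\<And>j. j < v \<Longrightarrow> reads (s j) i \<in> B" and "reads (s v) i \<notin> B"
    and "v * (T + 1) < T'" and "s 0 = \<sigma>" and "s v = \<tau>"
  shows "det (Loop i B p) \<sigma> T' \<tau>"
  using run_Loop[of v p "\<lambda>j. {s j}" T i B T'] assms by auto

lemma det_rewind:
  assumes "\<sigma> i = nump (int h) v" and "h \<le> v" and "2 * h + 5 < T"
  shows "det (rewind i) \<sigma> T (\<sigma>(i := num v))"
proof -
  let ?s = "\<lambda>j. \<sigma>(i := nump (int h - 1 - int j) v)"
  have "det (Loop i {1} (Mv i Move_Left)) (?s 0) (2 * h + 1) (?s h)"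
    using assms(2) by (intro det_Loop[where s = ?s and v = h and T = 1] det_Mv_nump)
      (auto simp: reads_nump algebra_simps)
  moreover have "det (Mv i Move_Left) \<sigma> 1 (?s 0)"
    using assms(1) by (rule det_Mv_nump) simp
  moreover have "det (Mv i Move_Right) (?s h) 1 (\<sigma>(i := num v))"
    by (rule det_Mv_nump[where v = v]) auto
  ultimately have "det (rewind i) \<sigma> (2 * h + 6) (\<sigma>(i := num v))"
    unfolding rewind_def by (intro run_Sq[OF _ run_Sq]) auto
  then show ?thesis using assms(3) by (auto elim: run_mono)
qed

lemma det_forward:
  assumes "\<sigma> i = num v" and "2 * v < T"
  shows "det (Loop i {1} (Mv i Move_Right)) \<sigma> T (\<sigma>(i := nump (int v) v))"
  using assms
  by (intro det_Loop[where s = "\<lambda>j. \<sigma>(i := nump (int j) v)" and v = v and T = 1] det_Mv_nump)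
    (auto simp: reads_nump algebra_simps)

text \<open>Time bounds are kept as powers of a number \<open>M \<ge> 16\<close> that bounds all stored numbers, so that
  sequencing raises the exponent by one and a loop raises it by two.\<close>

lemma pow_Sq: "(16::nat) \<le> M \<Longrightarrow> a < c \<Longrightarrow> b < c \<Longrightarrow> M ^ a + M ^ b < M ^ c"
proof -
  assume *: "16 \<le> M" "a < c" "b < c"
  then have "M ^ a \<le> M ^ (c - 1)" "M ^ b \<le> M ^ (c - 1)" by (intro power_increasing; simp)+
  moreover have "M ^ c = M * M ^ (c - 1)" using * by (cases c) auto
  moreover have "16 * M ^ (c - 1) \<le> M * M ^ (c - 1)" using * by (intro mult_right_mono) auto
  moreover have "M ^ (c - 1) > 0" using * by simp
  ultimately show ?thesis by linarith
qed

text \<open>The constants 10 and 12 leave slack for the moves and tests in each round and for the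
  final \<open>rewind\<close>.\<close>

lemma pow_For: "(16::nat) \<le> M \<Longrightarrow> v \<le> M \<Longrightarrow> c \<ge> 1 \<Longrightarrow> v * (M ^ c + 10) + 12 \<le> M ^ (c + 2)"
proof -
  assume *: "16 \<le> M" "v \<le> M" "c \<ge> 1"
  have "M ^ 1 \<le> M ^ c" using * by (intro power_increasing) auto
  then have M: "16 \<le> M ^ c" using * by simp
  have "v * (M ^ c + 10) + 12 \<le> M * (M ^ c + 10) + M" using * by (intro add_mono mult_right_mono) auto
  also have "\<dots> = M * (M ^ c + 11)" by (simp add: algebra_simps)
  also have "\<dots> \<le> M * (2 * M ^ c)" using M by (intro mult_left_mono) auto
  also have "\<dots> \<le> M * (M * M ^ c)" using * by (intro mult_left_mono mult_right_mono) auto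
  finally show ?thesis by simp
qed

lemma det_mono: "det p \<sigma> (M ^ a) \<tau> \<Longrightarrow> (16::nat) \<le> M \<Longrightarrow> a \<le> c \<Longrightarrow> det p \<sigma> (M ^ c) \<tau>"
  by (erule run_mono) (simp add: power_increasing)

lemma run_SqM:
  assumes "16 \<le> M" "run p X (M ^ a) Y" "run q Y (M ^ b) Z" "a < c" "b < c"
  shows "run (Sq p q) X (M ^ c) Z"
  using run_Sq[OF assms(2,3) pow_Sq] assms by blast

lemma det_CondM:
  assumes "16 \<le> M" "det (if reads \<sigma> i \<in> B then p else q) \<sigma> (M ^ a) \<tau>" "a < c"
  shows "det (Cond i B p q) \<sigma> (M ^ c) \<tau>"
proof (rule run_Cond[OF _ assms(2)])
  show "M ^ a < M ^ c" using assms(1,3) by (intro power_strict_increasing) auto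
qed simp

text \<open>The sets \<open>X j\<close> describe stores with the head of tape \<open>i\<close> at
  home; the position of the counter is added only around the body, so invariants never mention
  it.\<close>

lemma run_ForM:
  assumes M: "16 \<le> M" "v \<le> M" "c \<ge> 1"
    and i: "\<And>j \<sigma>. j \<le> v \<Longrightarrow> \<sigma> \<in> X j \<Longrightarrow> \<sigma> i = num v"
    and body: "\<And>j. j < v \<Longrightarrow> run p ((\<lambda>\<sigma>. \<sigma>(i := nump (int j) v)) ` X j) (M ^ c)
       ((\<lambda>\<sigma>. \<sigma>(i := nump (int j) v)) ` X (Suc j))"
  shows "run (For i p) (X 0) (M ^ (c + 2)) (X v)"
proof -
  define Y where "Y = (\<lambda>j. (\<lambda>\<sigma>. \<sigma>(i := nump (int j) v)) ` X j)"
  have "run (Loop i {1} (Sq p (Mv i Move_Right))) (Y 0) (v * (M ^ c + 3) + 1) (Y v)"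
  proof (rule run_Loop)
    fix j assume j: "j < v"
    have "run (Mv i Move_Right) ((\<lambda>\<sigma>. \<sigma>(i := nump (int j) v)) ` X (Suc j)) 1 (Y (Suc j))"
      unfolding Y_def by (intro run_image det_Mv_nump[where v = v]) (auto simp: algebra_simps)
    with body[OF j] show "run (Sq p (Mv i Move_Right)) (Y j) (M ^ c + 2) (Y (Suc j))"
      unfolding Y_def by (intro run_Sq) auto
  qed (auto simp: Y_def reads_nump algebra_simps)
  moreover have "run (rewind i) (Y v) (2 * v + 6) (X v)"
  proof -
    have "run (rewind i) ((\<lambda>\<sigma>. \<sigma>(i := nump (int v) v)) ` X v) (2 * v + 6) ((\<lambda>\<sigma>. \<sigma>) ` X v)"
    proof (rule run_image)
      fix \<sigma> assume "\<sigma> \<in> X v"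
      then have "(\<sigma>(i := nump (int v) v))(i := num v) = \<sigma>" using i[of v] by auto
      then show "det (rewind i) (\<sigma>(i := nump (int v) v)) (2 * v + 6) \<sigma>"
        using det_rewind[of "\<sigma>(i := nump (int v) v)" i v v "2 * v + 6"] by simp
    qed
    then show ?thesis by (simp add: Y_def)
  qed
  moreover have "Y 0 = X 0"
  proof -
    have "\<sigma>(i := num v) = \<sigma>" if "\<sigma> \<in> X 0" for \<sigma> using i[of 0 \<sigma>] that by auto
    then show ?thesis unfolding Y_def by (auto simp: image_iff)
  qed
  ultimately have "run (For i p) (X 0) (v * (M ^ c + 10) + 12) (X v)"
    unfolding For_def by (intro run_Sq[where Y = "Y v"]) (auto simp: algebra_simps)
  then show ?thesis using pow_For[OF M] by (auto elim: run_mono)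
qed

lemma det_ForM:
  assumes "16 \<le> M" "v \<le> M" "c \<ge> 1" "c + 2 \<le> c'"
    and "\<And>j. j \<le> v \<Longrightarrow> s j i = num v" and "s 0 = \<sigma>" and "s v = \<tau>"
    and "\<And>j. j < v \<Longrightarrow> det p ((s j)(i := nump (int j) v)) (M ^ c) ((s (Suc j))(i := nump (int j) v))"
  shows "det (For i p) \<sigma> (M ^ c') \<tau>"
proof (rule det_mono[OF _ assms(1,4)])
  show "det (For i p) \<sigma> (M ^ (c + 2)) \<tau>"
    using run_ForM[OF assms(1-3), of "\<lambda>j. {s j}" i p] assms(5-) by simp
qed

lemma det_inc:
  assumes "16 \<le> M" "\<sigma> i = num v" "v < M"
  shows "det (inc i) \<sigma> (M ^ 2) (\<sigma>(i := num (Suc v)))"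
proof -
  have w: "det (Wr i 1 Stay) (\<sigma>(i := nump (int v) v)) 1 (\<sigma>(i := nump (int v) (Suc v)))"
    by (rule det_Op) (auto simp: nump_def fun_eq_iff)
  have "det (rewind i) (\<sigma>(i := nump (int v) (Suc v))) (2 * v + 6) (\<sigma>(i := num (Suc v)))"
    using det_rewind[of "\<sigma>(i := nump (int v) (Suc v))" i v "Suc v"] by simp
  then have "det (inc i) \<sigma> (4 * v + 15) (\<sigma>(i := num (Suc v)))"
    unfolding inc_def using det_forward[of \<sigma> i v "2 * v + 1"] w assms
    by (intro run_Sq[OF _ run_Sq[OF w]]) auto
  moreover have "4 * v + 15 \<le> 16 * M" using assms by simp
  moreover have "16 * M \<le> M ^ 2" using assms by (simp add: power2_eq_square)
  ultimately show ?thesis by (meson run_mono le_trans)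
qed

lemma det_clear:
  assumes "16 \<le> M" "\<sigma> i = num v" "v \<le> M"
  shows "det (clear i) \<sigma> (M ^ 2) (\<sigma>(i := num 0))"
proof -
  let ?s = "\<lambda>j. \<sigma>(i := nump (int v - 1 - int j) (v - j))"
  have l: "det (Loop i {1} (Wr i 0 Move_Left)) (?s 0) (2 * v + 1) (?s v)"
  proof (rule det_Loop[where s = ?s and v = v and T = 1])
    fix j assume "j < v"
    then show "det (Wr i 0 Move_Left) (?s j) 1 (?s (Suc j))"
      by (intro det_Op) (auto simp: nump_def fun_eq_iff)
  qed (auto simp: reads_nump)
  have "det (Mv i Move_Left) (\<sigma>(i := nump (int v) v)) 1 (?s 0)"
    by (rule det_Mv_nump[where v = v]) auto
  moreover have "det (Mv i Move_Right) (?s v) 1 (\<sigma>(i := num 0))"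
    by (rule det_Mv_nump[where v = 0]) auto
  ultimately have "det (clear i) \<sigma> (4 * v + 15) (\<sigma>(i := num 0))"
    unfolding clear_def using det_forward[of \<sigma> i v "2 * v + 1"] assms
    by (intro run_Sq[OF _ run_Sq[OF _ run_Sq[OF l]]]) auto
  moreover have "4 * v + 15 \<le> 16 * M" using assms by simp
  moreover have "16 * M \<le> M ^ 2" using assms by (simp add: power2_eq_square)
  ultimately show ?thesis by (meson run_mono le_trans)
qed

lemma det_Op1: "16 \<le> M \<Longrightarrow> det p \<sigma> 1 \<tau> \<Longrightarrow> c \<ge> 1 \<Longrightarrow> det p \<sigma> (M ^ c) \<tau>"
  by (erule run_mono) simp

lemma det_addto:
  assumes "16 \<le> M" "i \<noteq> j" "\<sigma> i = num a" "\<sigma> j = num b" "a + b \<le> M"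
  shows "det (addto i j) \<sigma> (M ^ 4) (\<sigma>(j := num (a + b)))"
  unfolding addto_def
proof (rule det_ForM[where s = "\<lambda>t. \<sigma>(j := num (b + t))" and v = a and c = 2])
  fix t assume "t < a"
  then show "det (inc j) ((\<sigma>(j := num (b + t)))(i := nump (int t) a)) (M ^ 2)
      ((\<sigma>(j := num (b + Suc t)))(i := nump (int t) a))"
    using det_inc[of M "(\<sigma>(j := num (b + t)))(i := nump (int t) a)" j "b + t"] assms
    by (simp add: fun_upd_twist)
qed (use assms in \<open>auto simp: add.commute\<close>)

lemma det_write_flag:
  assumes "16 \<le> M" "\<sigma> i = num a" "a \<le> 1" "b \<le> 1" "c \<ge> 1"
  shows "det (Wr i b Stay) \<sigma> (M ^ c) (\<sigma>(i := num b))"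
  using assms by (intro det_Op1[OF _ det_Op]) (auto simp: nump_def fun_eq_iff le_Suc_eq)

section \<open>Guessing relations and evaluating formulas\<close>

text \<open>First-order formulas over \<open>{0..<N}\<close>, with addition, the bits of the input, and relation symbols.
  Variables are numbered from the outermost quantifier inwards.\<close>

datatype fm =
    Bit bool nat
  | Add nat nat nat
  | Rel nat "nat list"
  | Neg fm
  | Conj fm fm
  | Ex fm

fun sat :: "nat \<Rightarrow> bool list \<Rightarrow> (nat \<Rightarrow> nat list \<Rightarrow> bool) \<Rightarrow> nat list \<Rightarrow> fm \<Rightarrow> bool" where
  "sat N w I e (Bit b x) \<longleftrightarrow> e ! x < length w \<and> w ! (e ! x) = b"
| "sat N w I e (Add x y z) \<longleftrightarrow> e ! x + e ! y = e ! z"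
| "sat N w I e (Rel i xs) \<longleftrightarrow> I i (map (nth e) xs)"
| "sat N w I e (Neg \<phi>) \<longleftrightarrow> \<not> sat N w I e \<phi>"
| "sat N w I e (Conj \<phi> \<psi>) \<longleftrightarrow> sat N w I e \<phi> \<and> sat N w I e \<psi>"
| "sat N w I e (Ex \<phi>) \<longleftrightarrow> (\<exists>v < N. sat N w I (e @ [v]) \<phi>)"

fun wf_fm :: "(nat \<Rightarrow> nat) \<Rightarrow> nat \<Rightarrow> nat \<Rightarrow> fm \<Rightarrow> bool" where
  "wf_fm ar r k (Bit b x) \<longleftrightarrow> x < k"
| "wf_fm ar r k (Add x y z) \<longleftrightarrow> x < k \<and> y < k \<and> z < k"
| "wf_fm ar r k (Rel i xs) \<longleftrightarrow> i < r \<and> length xs = ar i \<and> (\<forall>x \<in> set xs. x < k)"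
| "wf_fm ar r k (Neg \<phi>) \<longleftrightarrow> wf_fm ar r k \<phi>"
| "wf_fm ar r k (Conj \<phi> \<psi>) \<longleftrightarrow> wf_fm ar r k \<phi> \<and> wf_fm ar r k \<psi>"
| "wf_fm ar r k (Ex \<phi>) \<longleftrightarrow> wf_fm ar r (Suc k) \<phi>"

fun rank :: "fm \<Rightarrow> nat" where
  "rank (Neg \<phi>) = rank \<phi>"
| "rank (Conj \<phi> \<psi>) = max (rank \<phi>) (rank \<psi>)"
| "rank (Ex \<phi>) = Suc (rank \<phi>)"
| "rank _ = 0"

text \<open>Horner's scheme: the tuple read as digits in base \<open>N\<close>. Tuples of one length
  with entries below \<open>N\<close> thus get distinct addresses.\<close>

definition hor :: "nat \<Rightarrow> nat list \<Rightarrow> nat" where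
  "hor N xs = foldl (\<lambda>a x. a * N + x) 0 xs"

lemma hor_snoc: "hor N (xs @ [x]) = hor N xs * N + x"
  by (simp add: hor_def)

lemma hor_less: "\<forall>x \<in> set xs. x < N \<Longrightarrow> hor N xs < N ^ length xs"
proof (induction xs rule: rev_induct)
  case (snoc x xs)
  then have "hor N xs * N + x < Suc (hor N xs) * N" by simp
  also have "\<dots> \<le> N ^ length xs * N" using snoc by (intro mult_right_mono) auto
  finally show ?case by (simp add: hor_snoc mult.commute)
qed (simp add: hor_def)

lemma hor_inj:
  "length xs = length ys \<Longrightarrow> \<forall>x \<in> set xs. x < N \<Longrightarrow> \<forall>y \<in> set ys. y < N \<Longrightarrow> hor N xs = hor N ys \<Longrightarrow> xs = ys"
proof (induction xs arbitrary: ys rule: rev_induct)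
  case (snoc x xs)
  then obtain y zs where ys: "ys = zs @ [y]" by (cases ys rule: rev_cases) auto
  have "hor N xs * N + x = hor N zs * N + y" using snoc.prems ys by (simp add: hor_snoc)
  moreover have "x < N" "y < N" using snoc.prems ys by auto
  ultimately have "hor N xs = hor N zs" "x = y"
    by (metis add.commute div_mult_self3 div_less add_cancel_right_left mult.commute bot_nat_0.not_eq_extremum less_nat_zero_code)
      (metis \<open>hor N xs * N + x = hor N zs * N + y\<close> \<open>x < N\<close> \<open>y < N\<close> mod_less mod_mult_self3)
  then show ?case using snoc ys by auto
qed simp

text \<open>Tape layout: \<open>0\<close> is the input, \<open>1\<close> the truth value computed last, \<open>2\<close> and \<open>3\<close> are scratch, \<open>4\<close>
  holds \<open>N\<close>, and \<open>5\<close> and \<open>6\<close> are used to compute \<open>N\<close>. Variable \<open>j\<close> lives on tape \<open>xt j\<close>, and \<open>lt j\<close>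
  holds a copy of \<open>N\<close> to control the loop over its values. Relation \<open>i\<close> is a bit table on tape \<open>rt i\<close>,
  addressed by \<open>hor N\<close>.\<close>

definition xt :: "nat \<Rightarrow> nat" where "xt j = 7 + 3 * j"
definition lt :: "nat \<Rightarrow> nat" where "lt j = 8 + 3 * j"
definition rt :: "nat \<Rightarrow> nat" where "rt j = 9 + 3 * j"

lemma tapes_distinct [simp]:
  "xt i = xt j \<longleftrightarrow> i = j" "lt i = lt j \<longleftrightarrow> i = j" "rt i = rt j \<longleftrightarrow> i = j"
  "xt i \<noteq> lt j" "xt i \<noteq> rt j" "lt i \<noteq> rt j" "lt i \<noteq> xt j" "rt i \<noteq> xt j" "rt i \<noteq> lt j"
  unfolding xt_def lt_def rt_def by presburger+

lemma tapes_ge [simp]: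
  "n < 7 \<Longrightarrow> xt i \<noteq> n" "n < 7 \<Longrightarrow> lt i \<noteq> n" "n < 7 \<Longrightarrow> rt i \<noteq> n"
  "n < 7 \<Longrightarrow> n \<noteq> xt i" "n < 7 \<Longrightarrow> n \<noteq> lt i" "n < 7 \<Longrightarrow> n \<noteq> rt i"
  "xt i \<noteq> Suc 0" "lt i \<noteq> Suc 0" "rt i \<noteq> Suc 0" "Suc 0 \<noteq> xt i" "Suc 0 \<noteq> lt i" "Suc 0 \<noteq> rt i"
  unfolding xt_def lt_def rt_def by auto

text \<open>Multiplies tape 2 by \<open>N\<close>: the step of Horner's scheme, and also the way to
  the table length \<open>N ^ D\<close>.\<close>

definition mulN :: prog where
  "mulN = Sq (For 2 (addto 4 3)) (Sq (clear 2) (Sq (addto 3 2) (clear 3)))"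

fun addr :: "nat list \<Rightarrow> prog" where
  "addr [] = skip"
| "addr (x # xs) = Sq mulN (Sq (addto (xt x) 2) (addr xs))"

abbreviation test :: "nat \<Rightarrow> nat \<Rightarrow> prog" where
  "test i b \<equiv> Cond i {b} (Wr 1 1 Stay) (Wr 1 0 Stay)"

text \<open>For \<open>Add\<close>, tape 2 receives the sum in unary and the loop over
  \<open>z\<close> advances its head. Falling off the sum means that \<open>z\<close> is larger, and
  a head still on a 1 afterwards means that \<open>z\<close> is smaller. For \<open>Ex\<close>, the
  flag accumulates the disjunction: once it is true the body is skipped, but the variable is still
  incremented.\<close>

fun compile :: "nat \<Rightarrow> fm \<Rightarrow> prog" where
  "compile k (Bit b x) = Sq (For (xt x) (Mv 0 Move_Right))
     (Sq (test 0 (if b then 2 else 1)) (For (xt x) (Mv 0 Move_Left)))"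
| "compile k (Add x y z) = Sq (addto (xt x) 2) (Sq (addto (xt y) 2) (Sq (Wr 1 1 Stay)
     (Sq (For (xt z) (Cond 2 {1} (Mv 2 Move_Right) (Wr 1 0 Stay)))
     (Sq (Cond 2 {1} (Wr 1 0 Stay) skip) (Sq (rewind 2) (clear 2))))))"
| "compile k (Rel i xs) = Sq (addr xs) (Sq (For 2 (Mv (rt i) Move_Right))
     (Sq (test (rt i) 1) (Sq (For 2 (Mv (rt i) Move_Left)) (clear 2))))"
| "compile k (Neg \<phi>) = Sq (compile k \<phi>) (Cond 1 {1} (Wr 1 0 Stay) (Wr 1 1 Stay))"
| "compile k (Conj \<phi> \<psi>) = Sq (compile k \<phi>) (Cond 1 {1} (compile k \<psi>) skip)"
| "compile k (Ex \<phi>) = Sq (Wr 1 0 Stay)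
     (Sq (For (lt k) (Sq (Cond 1 {1} skip (compile (Suc k) \<phi>)) (inc (xt k)))) (clear (xt k)))"

text \<open>The exponent of \<open>M\<close> in the time bound.\<close>

fun cost :: "fm \<Rightarrow> nat" where
  "cost (Bit b x) = 10"
| "cost (Add x y z) = 15"
| "cost (Rel i xs) = 3 * length xs + 20"
| "cost (Neg \<phi>) = cost \<phi> + 3"
| "cost (Conj \<phi> \<psi>) = cost \<phi> + cost \<psi> + 3"
| "cost (Ex \<phi>) = cost \<phi> + 10"

lemma det_mulN:
  assumes "16 \<le> M" "\<sigma> 2 = num a" "\<sigma> 3 = num 0" "\<sigma> 4 = num N" "a * N \<le> M" "a \<le> M" "N \<ge> 1"
  shows "det mulN \<sigma> (M ^ 9) (\<sigma>(2 := num (a * N)))"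
proof -
  have 1: "det (For 2 (addto 4 3)) \<sigma> (M ^ 6) (\<sigma>(3 := num (a * N)))"
  proof (rule det_ForM[where s = "\<lambda>t. \<sigma>(3 := num (t * N))" and v = a and c = 4])
    fix t assume t: "t < a"
    then have "N + t * N \<le> a * N" by (metis Suc_leI mult_Suc mult_le_mono1)
    then show "det (addto 4 3) ((\<sigma>(3 := num (t * N)))(2 := nump (int t) a)) (M ^ 4)
        ((\<sigma>(3 := num (Suc t * N)))(2 := nump (int t) a))"
      using det_addto[of M 4 3 "(\<sigma>(3 := num (t * N)))(2 := nump (int t) a)" N "t * N"] assms
      by (simp add: fun_upd_twist)
  qed (use assms in \<open>auto simp: fun_eq_iff\<close>)
  have 2: "det (clear 2) (\<sigma>(3 := num (a * N))) (M ^ 2) (\<sigma>(3 := num (a * N), 2 := num 0))"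
    using assms by (intro det_clear[where v = a]) auto
  have 3: "det (addto 3 2) (\<sigma>(3 := num (a * N), 2 := num 0)) (M ^ 4)
      (\<sigma>(3 := num (a * N), 2 := num (a * N)))"
    using det_addto[of M 3 2 "\<sigma>(3 := num (a * N), 2 := num 0)" "a * N" 0] assms by simp
  have "\<sigma>(3 := num (a * N), 2 := num (a * N), 3 := num 0) = \<sigma>(2 := num (a * N))"
    using assms by (auto simp: fun_eq_iff)
  then have 4: "det (clear 3) (\<sigma>(3 := num (a * N), 2 := num (a * N))) (M ^ 2) (\<sigma>(2 := num (a * N)))"
    using det_clear[of M "\<sigma>(3 := num (a * N), 2 := num (a * N))" 3 "a * N"] assms by simp
  show ?thesis
    unfolding mulN_def
    by (rule run_SqM[OF assms(1) 1 run_SqM[OF assms(1) 2 run_SqM[OF assms(1) 3 4, of 5], of 6]]) auto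
qed

lemma det_addr:
  assumes M: "16 \<le> M" "N ^ D * 2 \<le> M" and N: "N \<ge> 1"
    and s: "\<sigma> 3 = num 0" "\<sigma> 4 = num N" "\<forall>x \<in> set xs. \<sigma> (xt x) = num (e ! x) \<and> e ! x < N"
    and ys: "\<sigma> 2 = num (hor N ys)" "\<forall>y \<in> set ys. y < N" "length ys + length xs \<le> D"
  shows "det (addr xs) \<sigma> (M ^ (2 * length xs + 10)) (\<sigma>(2 := num (hor N (ys @ map (nth e) xs))))"
  using s ys
proof (induction xs arbitrary: ys \<sigma>)
  case Nil
  then have "\<sigma>(2 := num (hor N ys)) = \<sigma>" by auto
  then show ?case using det_Op1[OF M(1) det_skip, of 10] by simp
next
  case (Cons x xs)
  let ?z = "hor N (ys @ [e ! x])"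
  have x: "e ! x < N" "\<sigma> (xt x) = num (e ! x)" using Cons.prems by auto
  have "?z < N ^ Suc (length ys)" using hor_less[of "ys @ [e ! x]" N] Cons.prems by auto
  also have "\<dots> \<le> N ^ D" using Cons.prems N by (intro power_increasing) auto
  finally have z: "?z < M" using M by simp
  have "hor N ys < N ^ length ys" using Cons.prems by (intro hor_less)
  also have "\<dots> \<le> N ^ D" using Cons.prems N by (intro power_increasing) auto
  finally have y: "hor N ys < M" using M by simp
  have 1: "det mulN \<sigma> (M ^ 9) (\<sigma>(2 := num (hor N ys * N)))"
    using det_mulN[of M \<sigma> "hor N ys" N] Cons.prems z y M N by (simp add: hor_snoc)
  have 2: "det (addto (xt x) 2) (\<sigma>(2 := num (hor N ys * N))) (M ^ 4) (\<sigma>(2 := num ?z))"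
    using det_addto[of M "xt x" 2 "\<sigma>(2 := num (hor N ys * N))" "e ! x" "hor N ys * N"] x z M
    by (simp add: hor_snoc add.commute)
  have "det (addr xs) (\<sigma>(2 := num ?z)) (M ^ (2 * length xs + 10))
      (\<sigma>(2 := num ?z, 2 := num (hor N ((ys @ [e ! x]) @ map (nth e) xs))))"
    by (rule Cons.IH) (use Cons.prems in auto)
  then have 3: "det (addr xs) (\<sigma>(2 := num ?z)) (M ^ (2 * length xs + 10))
      (\<sigma>(2 := num (hor N (ys @ map (nth e) (x # xs)))))"
    by (simp only: fun_upd_upd append_assoc append.simps list.map)
  show ?case unfolding addr.simps
    by (rule run_SqM[OF M(1) 1 run_SqM[OF M(1) 2 3, of "2 * length xs + 11"]]) auto
qed

text \<open>Tapes of variables not yet in scope are ready for use, with value 0 and loop control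
  \<open>N\<close>. A table is constrained only at addresses of tuples of the right length with
  entries below \<open>N\<close>.\<close>

definition invar :: "(nat \<Rightarrow> nat) \<Rightarrow> nat \<Rightarrow> nat \<Rightarrow> bool list \<Rightarrow> nat \<Rightarrow> (nat \<Rightarrow> nat list \<Rightarrow> bool) \<Rightarrow>
    nat list \<Rightarrow> store \<Rightarrow> bool" where
  "invar ar r K w N I e \<sigma> \<longleftrightarrow> \<sigma> 0 = input_tape w \<and> (\<exists>b \<le> 1. \<sigma> 1 = num b) \<and>
     \<sigma> 2 = num 0 \<and> \<sigma> 3 = num 0 \<and> \<sigma> 4 = num N \<and>
     (\<forall>j < length e. \<sigma> (xt j) = num (e ! j) \<and> e ! j < N) \<and>
     (\<forall>j. length e \<le> j \<longrightarrow> j < K \<longrightarrow> \<sigma> (xt j) = num 0 \<and> \<sigma> (lt j) = num N) \<and>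
     (\<forall>i < r. \<exists>g. \<sigma> (rt i) = (0, g) \<and>
        (\<forall>xs. length xs = ar i \<longrightarrow> (\<forall>x \<in> set xs. x < N) \<longrightarrow> g (int (hor N xs)) = of_bool (I i xs)))"

lemma invar_flag: "invar ar r K w N I e \<sigma> \<Longrightarrow> b \<le> 1 \<Longrightarrow> invar ar r K w N I e (\<sigma>(1 := num b))"
  unfolding invar_def by auto

lemma invar_flagD: "invar ar r K w N I e \<sigma> \<Longrightarrow> \<exists>b \<le> 1. \<sigma> 1 = num b"
  unfolding invar_def by auto

lemma det_flag_if:
  assumes "16 \<le> M" "\<sigma> 1 = num a" "a \<le> 1" "c \<ge> 2"
  shows "det (test i b) \<sigma> (M ^ c) (\<sigma>(1 := num (of_bool (reads \<sigma> i = b))))"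
  using assms
  by (intro det_CondM[where a = 1]) (auto intro!: det_write_flag[OF _ _ _ _ order_refl, simplified])

lemma det_shift:
  assumes M: "16 \<le> M" "v \<le> M" "\<sigma> i = num v" and i: "i \<noteq> j"
    and \<tau>: "\<tau> = \<sigma>(j := (fst (\<sigma> j) + int v * offset d, snd (\<sigma> j)))"
  shows "det (For i (Mv j d)) \<sigma> (M ^ 3) \<tau>"
proof (rule det_ForM[where s = "\<lambda>t. \<sigma>(j := (fst (\<sigma> j) + int t * offset d, snd (\<sigma> j)))" and v = v and c = 1])
  fix t assume "t < v"
  show "det (Mv j d) ((\<sigma>(j := (fst (\<sigma> j) + int t * offset d, snd (\<sigma> j))))(i := nump (int t) v)) (M ^ 1)
    ((\<sigma>(j := (fst (\<sigma> j) + int (Suc t) * offset d, snd (\<sigma> j))))(i := nump (int t) v))"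
    using i M by (intro det_Op1[OF M(1) det_Mv]) (auto simp: fun_eq_iff algebra_simps)
qed (use assms in auto)

text \<open>Every tape except the flag is restored. This makes the induction work, as subformulas
  run in sequence and repeatedly on the same tapes.\<close>

theorem det_compile:
  assumes "16 \<le> M" "N ^ D * 2 \<le> M" "N \<ge> 1" "D \<ge> 1" "\<forall>i < r. ar i \<le> D"
    and "wf_fm ar r (length e) \<phi>" "length e + rank \<phi> \<le> K" "invar ar r K w N I e \<sigma>"
  shows "det (compile (length e) \<phi>) \<sigma> (M ^ cost \<phi>) (\<sigma>(1 := num (of_bool (sat N w I e \<phi>))))"
  using assms(6-)
proof (induction \<phi> arbitrary: e \<sigma>)
  have "N ^ 1 \<le> N ^ D" using assms(3,4) by (intro power_increasing) auto
  then have NM: "2 * N \<le> M" using assms(2) by simp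
  note M = assms(1)
  {
    case (Bit b x)
    let ?n = "e ! x"
    obtain a where a: "a \<le> 1" "\<sigma> 1 = num a" using invar_flagD[OF Bit(3)] by blast
    have x: "\<sigma> (xt x) = num ?n" "?n < N" "\<sigma> 0 = input_tape w" using Bit unfolding invar_def by auto
    let ?t = "(int ?n, snd (input_tape w))"
    have 1: "det (For (xt x) (Mv 0 Move_Right)) \<sigma> (M ^ 3) (\<sigma>(0 := ?t))"
      using x NM by (intro det_shift[OF M]) (auto simp: input_tape_def)
    have "of_bool (reads (\<sigma>(0 := ?t)) 0 = (if b then 2 else 1)) =
        (of_bool (sat N w I e (Bit b x)) :: nat)"
      by (auto simp: reads_def read_tape_def input_tape_def)
    then have 2: "det (test 0 (if b then 2 else 1)) (\<sigma>(0 := ?t)) (M ^ 3)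
        (\<sigma>(0 := ?t, 1 := num (of_bool (sat N w I e (Bit b x)))))"
      using det_flag_if[OF M, of "\<sigma>(0 := ?t)" a 3 0 "if b then 2 else 1"] a by simp
    have 3: "det (For (xt x) (Mv 0 Move_Left)) (\<sigma>(0 := ?t, 1 := num (of_bool (sat N w I e (Bit b x)))))
       (M ^ 3) (\<sigma>(1 := num (of_bool (sat N w I e (Bit b x)))))"
      using x NM by (intro det_shift[OF M]) (auto simp: input_tape_def fun_eq_iff)
    show ?case unfolding compile.simps cost.simps
      by (rule run_SqM[OF M 1 run_SqM[OF M 2 3, of 4]]) auto
  next
    case (Add x y z)
    let ?a = "e ! x + e ! y"
    obtain a where a: "a \<le> 1" "\<sigma> 1 = num a" using invar_flagD[OF Add(3)] by blast
    have x: "\<sigma> (xt x) = num (e ! x)" "e ! x < N" "\<sigma> (xt y) = num (e ! y)" "e ! y < N"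
      "\<sigma> (xt z) = num (e ! z)" "e ! z < N" "\<sigma> 2 = num 0" using Add unfolding invar_def by auto
    have 1: "det (addto (xt x) 2) \<sigma> (M ^ 4) (\<sigma>(2 := num (e ! x)))"
      using det_addto[OF M, of "xt x" 2 \<sigma> "e ! x" 0] x NM by simp
    have 2: "det (addto (xt y) 2) (\<sigma>(2 := num (e ! x))) (M ^ 4) (\<sigma>(2 := num ?a))"
      using det_addto[OF M, of "xt y" 2 "\<sigma>(2 := num (e ! x))" "e ! y" "e ! x"] x NM
      by (simp add: add.commute)
    have 3: "det (Wr 1 1 Stay) (\<sigma>(2 := num ?a)) (M ^ 4) (\<sigma>(2 := num ?a, 1 := num 1))"
      using a by (intro det_write_flag[OF M]) auto
    \<comment> \<open>After \<open>t\<close> rounds the head of tape 2 is at \<open>t\<close> or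
      stuck at the first blank, and the flag is cleared in the first round that finds the
      blank.\<close>
    let ?s = "\<lambda>t. \<sigma>(2 := nump (int (min t ?a)) ?a, 1 := num (of_bool (t \<le> ?a)))"
    have 4: "det (For (xt z) (Cond 2 {1} (Mv 2 Move_Right) (Wr 1 0 Stay)))
        (\<sigma>(2 := num ?a, 1 := num 1)) (M ^ 4) (?s (e ! z))"
    proof (rule det_ForM[where s = ?s and v = "e ! z" and c = 2])
      fix t assume t: "t < e ! z"
      let ?u = "(?s t)(xt z := nump (int t) (e ! z))"
      let ?u' = "(?s (Suc t))(xt z := nump (int t) (e ! z))"
      show "det (Cond 2 {1} (Mv 2 Move_Right) (Wr 1 0 Stay)) ?u (M ^ 2) ?u'"
      proof (cases "t < ?a")
        case True
        then have "det (Mv 2 Move_Right) ?u 1 ?u'"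
          by (intro det_Mv_nump[where v = ?a and h = t]) (auto simp: fun_eq_iff add.commute)
        then show ?thesis using True
          by (intro det_CondM[OF M, where a = 1]) (auto simp: reads_nump intro: det_Op1[OF M, of _ _ _ 1, simplified])
      next
        case False
        then have u': "?u' = ?u(1 := num 0)" by (auto simp: fun_eq_iff)
        have "det (Wr 1 0 Stay) ?u (M ^ 1) ?u'"
          unfolding u' by (rule det_write_flag[OF M]) auto
        then show ?thesis using False
          by (intro det_CondM[OF M, where a = 1]) (auto simp: reads_nump)
      qed
    qed (use M x NM in \<open>auto simp: fun_eq_iff\<close>)
    let ?f = "num (of_bool (sat N w I e (Add x y z)))"
    let ?r = "\<sigma>(2 := nump (int (min (e ! z) ?a)) ?a, 1 := ?f)"
    have 5: "det (Cond 2 {1} (Wr 1 0 Stay) skip) (?s (e ! z)) (M ^ 4) ?r"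
    proof (cases "e ! z < ?a")
      case True
      have "?r = (?s (e ! z))(1 := num 0)" using True by (auto simp: fun_eq_iff)
      then have "det (Wr 1 0 Stay) (?s (e ! z)) (M ^ 3) ?r"
        using det_write_flag[OF M, of "?s (e ! z)" 1 "of_bool (e ! z \<le> ?a)" 0 3] by simp
      then show ?thesis using True by (intro det_CondM[OF M, where a = 3]) (auto simp: reads_nump)
    next
      case False
      have "?r = ?s (e ! z)" using False by (auto simp: fun_eq_iff)
      then have "det skip (?s (e ! z)) (M ^ 3) ?r" using det_Op1[OF M det_skip, of 3] by simp
      then show ?thesis using False by (intro det_CondM[OF M, where a = 3]) (auto simp: reads_nump)
    qed
    have "2 * m + 5 < 16 * M" if "m \<le> e ! z" for m using that x(6) NM M by simp
    then have "2 * min (e ! z) ?a + 5 < 16 * M" by simp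
    also have "16 * M \<le> M ^ 4" using M mult_mono[OF M, of M "M ^ 3"]
      by (simp add: numeral_eq_Suc)
    finally have 6: "det (rewind 2) ?r (M ^ 4) (\<sigma>(2 := num ?a, 1 := ?f))"
      using det_rewind[of ?r 2 "min (e ! z) ?a" ?a "M ^ 4"] by (simp add: fun_upd_twist)
    have 7: "det (clear 2) (\<sigma>(2 := num ?a, 1 := ?f)) (M ^ 2) (\<sigma>(1 := ?f))"
    proof -
      have "\<sigma>(2 := num ?a, 1 := ?f, 2 := num 0) = \<sigma>(1 := ?f)" using x by (auto simp: fun_eq_iff)
      then show ?thesis using det_clear[OF M, of "\<sigma>(2 := num ?a, 1 := ?f)" 2 ?a] x NM by simp
    qed
    show ?case unfolding compile.simps cost.simps
      by (rule run_SqM[OF M 1 run_SqM[OF M 2 run_SqM[OF M 3 run_SqM[OF M 4 run_SqM[OF M 5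
        run_SqM[OF M 6 7, of 5], of 6], of 7], of 8], of 9]]) auto
  next
    case (Rel i xs)
    let ?a = "hor N (map (nth e) xs)" and ?f = "num (of_bool (sat N w I e (Rel i xs)))"
    obtain a where a: "a \<le> 1" "\<sigma> 1 = num a" using invar_flagD[OF Rel(3)] by blast
    have i: "i < r" "length xs = ar i" "\<forall>x \<in> set xs. x < length e" using Rel by auto
    have x: "\<sigma> 2 = num 0" "\<sigma> 3 = num 0" "\<sigma> 4 = num N"
      "\<forall>x \<in> set xs. \<sigma> (xt x) = num (e ! x) \<and> e ! x < N"
      using Rel unfolding invar_def by auto
    obtain g where g: "\<sigma> (rt i) = (0, g)" "g (int ?a) = of_bool (I i (map (nth e) xs))"
      using Rel(3) i x(4) unfolding invar_def by (metis (mono_tags, lifting) imageE length_map list.set_map)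
    have "?a < N ^ length xs" using hor_less[of "map (nth e) xs" N] x by auto
    also have "\<dots> \<le> N ^ D" using assms(3,5) i by (intro power_increasing) auto
    finally have aM: "?a < M" using assms(2) by simp
    have 1: "det (addr xs) \<sigma> (M ^ (2 * length xs + 10)) (\<sigma>(2 := num ?a))"
      using det_addr[OF M assms(2,3) x(2,3,4), of "[]"] x i assms(5) by (simp add: hor_def)
    have 2: "det (For 2 (Mv (rt i) Move_Right)) (\<sigma>(2 := num ?a)) (M ^ 3) (\<sigma>(2 := num ?a, rt i := (int ?a, g)))"
      using aM g by (intro det_shift[OF M]) auto
    have "of_bool (reads (\<sigma>(2 := num ?a, rt i := (int ?a, g))) (rt i) = 1) =
        (of_bool (sat N w I e (Rel i xs)) :: nat)"
      using g by (auto simp: reads_def read_tape_def)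
    then have 3: "det (test (rt i) 1) (\<sigma>(2 := num ?a, rt i := (int ?a, g))) (M ^ 3)
       (\<sigma>(2 := num ?a, rt i := (int ?a, g), 1 := ?f))"
      using det_flag_if[OF M, of "\<sigma>(2 := num ?a, rt i := (int ?a, g))" a 3 "rt i" 1] a by simp
    have 4: "det (For 2 (Mv (rt i) Move_Left)) (\<sigma>(2 := num ?a, rt i := (int ?a, g), 1 := ?f)) (M ^ 3)
        (\<sigma>(2 := num ?a, 1 := ?f))"
      using aM g by (intro det_shift[OF M]) (auto simp: fun_eq_iff)
    have 5: "det (clear 2) (\<sigma>(2 := num ?a, 1 := ?f)) (M ^ 2) (\<sigma>(1 := ?f))"
    proof -
      have "\<sigma>(2 := num ?a, 1 := ?f, 2 := num 0) = \<sigma>(1 := ?f)" using x by (auto simp: fun_eq_iff)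
      then show ?thesis using det_clear[OF M, of "\<sigma>(2 := num ?a, 1 := ?f)" 2 ?a] aM by simp
    qed
    show ?case unfolding compile.simps cost.simps
      by (rule run_SqM[OF M 1 run_SqM[OF M 2 run_SqM[OF M 3 run_SqM[OF M 4 5, of 4], of 5], of 6]]) auto
  next
    case (Neg \<phi>)
    let ?b = "sat N w I e \<phi>"
    have 1: "det (compile (length e) \<phi>) \<sigma> (M ^ cost \<phi>) (\<sigma>(1 := num (of_bool ?b)))"
      by (rule Neg.IH) (use Neg.prems in auto)
    have "det (if ?b then Wr 1 0 Stay else Wr 1 1 Stay) (\<sigma>(1 := num (of_bool ?b))) (M ^ 1)
        (\<sigma>(1 := num (of_bool (\<not> ?b))))"
      using det_write_flag[OF M, of "\<sigma>(1 := num (of_bool ?b))" 1 "of_bool ?b" "of_bool (\<not> ?b)" 1] by auto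
    then have 2: "det (Cond 1 {1} (Wr 1 0 Stay) (Wr 1 1 Stay)) (\<sigma>(1 := num (of_bool ?b))) (M ^ 2)
        (\<sigma>(1 := num (of_bool (\<not> ?b))))"
      by (intro det_CondM[OF M, where a = 1]) (auto simp: reads_nump)
    show ?case unfolding compile.simps cost.simps sat.simps
      by (rule run_SqM[OF M 1 2]) auto
  next
    case (Conj \<phi> \<psi>)
    let ?b = "sat N w I e \<phi>" and ?f = "num (of_bool (sat N w I e (Conj \<phi> \<psi>)))"
    have 1: "det (compile (length e) \<phi>) \<sigma> (M ^ cost \<phi>) (\<sigma>(1 := num (of_bool ?b)))"
      by (rule Conj.IH(1)) (use Conj.prems in auto)
    have i: "invar ar r K w N I e (\<sigma>(1 := num (of_bool ?b)))"
      using Conj.prems(3) by (intro invar_flag) auto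
    have "det (compile (length e) \<psi>) (\<sigma>(1 := num (of_bool ?b))) (M ^ cost \<psi>)
        (\<sigma>(1 := num (of_bool ?b), 1 := num (of_bool (sat N w I e \<psi>))))"
      by (rule Conj.IH(2)[OF _ _ i]) (use Conj.prems in auto)
    then have "det (compile (length e) \<psi>) (\<sigma>(1 := num (of_bool ?b))) (M ^ (cost \<psi> + 1))
        (\<sigma>(1 := num (of_bool (sat N w I e \<psi>))))"
      by (intro det_mono[OF _ M le_add1]) (simp only: fun_upd_upd)
    moreover have "det skip (\<sigma>(1 := num (of_bool ?b))) (M ^ (cost \<psi> + 1)) (\<sigma>(1 := num (of_bool ?b)))"
      by (rule det_Op1[OF M det_skip]) simp
    ultimately have "det (if ?b then compile (length e) \<psi> else skip) (\<sigma>(1 := num (of_bool ?b)))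
        (M ^ (cost \<psi> + 1)) (\<sigma>(1 := ?f))"
      by auto
    then have 2: "det (Cond 1 {1} (compile (length e) \<psi>) skip) (\<sigma>(1 := num (of_bool ?b)))
        (M ^ (cost \<psi> + 2)) (\<sigma>(1 := ?f))"
      by (intro det_CondM[OF M, where a = "cost \<psi> + 1"]) (auto simp: reads_nump)
    show ?case unfolding compile.simps cost.simps
      by (rule run_SqM[OF M 1 2]) auto
  next
    case (Ex \<phi>)
    let ?k = "length e" and ?f = "num (of_bool (sat N w I e (Ex \<phi>)))"
    obtain a where a: "a \<le> 1" "\<sigma> 1 = num a" using invar_flagD[OF Ex.prems(3)] by blast
    have k: "\<sigma> (xt ?k) = num 0" "\<sigma> (lt ?k) = num N" using Ex.prems unfolding invar_def by auto
    let ?s = "\<lambda>t. \<sigma>(1 := num (of_bool (\<exists>v < t. sat N w I (e @ [v]) \<phi>)), xt ?k := num t)"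
    have 1: "det (Wr 1 0 Stay) \<sigma> (M ^ 1) (\<sigma>(1 := num 0))"
      using a by (intro det_write_flag[OF M]) auto
    have 2: "det (For (lt ?k) (Sq (Cond 1 {1} skip (compile (Suc ?k) \<phi>)) (inc (xt ?k))))
        (\<sigma>(1 := num 0)) (M ^ (cost \<phi> + 7)) (?s N)"
    proof (rule det_ForM[where s = ?s and v = N and c = "cost \<phi> + 5"])
      fix t assume t: "t < N"
      let ?u = "(?s t)(lt ?k := nump (int t) N)" and ?b = "\<exists>v < t. sat N w I (e @ [v]) \<phi>"
        and ?u' = "(?s (Suc t))(lt ?k := nump (int t) N)"
      let ?m = "?u(1 := num (of_bool (\<exists>v < Suc t. sat N w I (e @ [v]) \<phi>)))"
      have i: "invar ar r K w N I (e @ [t]) ?u"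
        using Ex.prems(3) t unfolding invar_def by (auto simp: nth_append less_Suc_eq)
      have "det (if ?b then skip else compile (Suc ?k) \<phi>) ?u (M ^ (cost \<phi> + 1)) ?m"
      proof (cases ?b)
        case True
        then have "?m = ?u" by (auto simp: fun_eq_iff less_Suc_eq)
        then show ?thesis using True det_Op1[OF M det_skip, of "cost \<phi> + 1" ?u] by simp
      next
        case False
        then have "?m = ?u(1 := num (of_bool (sat N w I (e @ [t]) \<phi>)))"
          by (auto simp: fun_eq_iff less_Suc_eq)
        moreover have "det (compile (length (e @ [t])) \<phi>) ?u (M ^ cost \<phi>)
            (?u(1 := num (of_bool (sat N w I (e @ [t]) \<phi>))))"
          by (rule Ex.IH[OF _ _ i]) (use Ex.prems in auto)
        ultimately have "det (compile (Suc ?k) \<phi>) ?u (M ^ cost \<phi>) ?m" by simp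
        from det_mono[OF this M le_add1] show ?thesis by (simp only: False if_False)
      qed
      note d = this
      have r: "reads ?u 1 \<in> {1} \<longleftrightarrow> ?b" by (simp add: reads_nump)
      have "det (if reads ?u 1 \<in> {1} then skip else compile (Suc ?k) \<phi>) ?u
          (M ^ (cost \<phi> + 1)) ?m" by (subst r) (rule d)
      then have c: "det (Cond 1 {1} skip (compile (Suc ?k) \<phi>)) ?u (M ^ (cost \<phi> + 2)) ?m"
        by (rule det_CondM[OF M]) simp
      have "?u' = ?m(xt ?k := num (Suc t))" by (auto simp: fun_eq_iff)
      then have "det (inc (xt ?k)) ?m (M ^ 2) ?u'"
        using det_inc[OF M, of ?m "xt ?k" t] t NM by simp
      then show "det (Sq (Cond 1 {1} skip (compile (Suc ?k) \<phi>)) (inc (xt ?k))) ?u (M ^ (cost \<phi> + 5)) ?u'"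
        by (intro run_SqM[OF M c]) auto
    qed (use M k NM in \<open>auto simp: fun_eq_iff\<close>)
    have "(?s N)(xt ?k := num 0) = \<sigma>(1 := ?f)" using k by (auto simp: fun_eq_iff)
    then have 3: "det (clear (xt ?k)) (?s N) (M ^ 2) (\<sigma>(1 := ?f))"
      using det_clear[OF M, of "?s N" "xt ?k" N] NM by simp
    show ?case unfolding compile.simps cost.simps
      by (rule run_SqM[OF M 1 run_SqM[OF M 2 3, of "cost \<phi> + 8"]]) auto
  }
qed

section \<open>Computing N, guessing the tables, and the whole machine\<close>

definition copy_input :: prog where
  "copy_input = Sq (Loop 0 {1, 2} (Sq (Wr 5 1 Move_Right) (Sq (Wr 6 1 Move_Right) (Mv 0 Move_Right))))
     (Sq (Sq (Mv 0 Move_Left) (Sq (Loop 0 {1, 2} (Mv 0 Move_Left)) (Mv 0 Move_Right)))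
     (Sq (rewind 5) (rewind 6)))"

definition double :: prog where
  "double = Sq (For 4 (Sq (inc 3) (inc 3))) (Sq (clear 4) (Sq (addto 3 4) (clear 3)))"

text \<open>Two copies of the input length, each raised by one, control two nested loops around a
  doubling: (n + 1)^2 doublings of 1. One copy could not control both loops.\<close>

definition set_N :: prog where
  "set_N = Sq (inc 5) (Sq (inc 6) (Sq (inc 4) (For 5 (For 6 double))))"

definition set_limits :: "nat list \<Rightarrow> prog" where
  "set_limits js = seqs (map (\<lambda>j. addto 4 (lt j)) js)"

text \<open>Tape 2 holds \<open>N ^ D\<close> at this point, so every table gets the same length,
  enough for each arity.\<close>

definition guess :: "nat \<Rightarrow> prog" where
  "guess i = Sq (For 2 (Guess (rt i))) (For 2 (Mv (rt i) Move_Left))"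

definition decide :: "nat \<Rightarrow> nat \<Rightarrow> nat \<Rightarrow> fm \<Rightarrow> prog" where
  "decide r D K \<phi> = Sq copy_input (Sq set_N (Sq (set_limits [0..<K]) (Sq (inc 2) (Sq (seqs (replicate D mulN))
     (Sq (seqs (map guess [0..<r])) (Sq (clear 2) (Sq (compile 0 \<phi>) (Cond 1 {1} skip (Op 0 (\<lambda>_. {}))))))))))"

lemma blank_num: "blank_tape = num 0"
  by (auto simp: blank_tape_def nump_def fun_eq_iff)

lemma det_copy_input:
  assumes M: "16 \<le> M" "length w < M"
  shows "det copy_input (init_store w) (M ^ 5)
    ((init_store w)(5 := num (length w), 6 := num (length w)))"
proof -
  let ?n = "length w" and ?\<sigma> = "init_store w"
  define s where "s = (\<lambda>t. ?\<sigma>(5 := nump (int t) t, 6 := nump (int t) t, 0 := (int t, snd (input_tape w))))"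
  define u where "u = (\<lambda>t. ?\<sigma>(5 := nump (int ?n) ?n, 6 := nump (int ?n) ?n,
    0 := (int ?n - 1 - int t, snd (input_tape w))))"
  have init: "?\<sigma> 5 = num 0" "?\<sigma> 6 = num 0" "?\<sigma> 0 = (0, snd (input_tape w))"
    by (auto simp: init_store_def blank_num input_tape_def)
  have M2: "16 * M \<le> M ^ 2" using M by (simp add: power2_eq_square)
  have "det (Loop 0 {1, 2} (Sq (Wr 5 1 Move_Right) (Sq (Wr 6 1 Move_Right) (Mv 0 Move_Right))))
      ?\<sigma> (6 * ?n + 1) (s ?n)"
  proof (rule det_Loop[where s = s and v = ?n and T = 5])
    fix j assume "j < ?n"
    have "det (Wr 5 1 Move_Right) (s j) 1 ((s j)(5 := nump (int (Suc j)) (Suc j)))"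
      by (rule det_Op) (auto simp: s_def nump_def fun_eq_iff)
    moreover have "det (Wr 6 1 Move_Right) ((s j)(5 := nump (int (Suc j)) (Suc j))) 1
        ((s j)(5 := nump (int (Suc j)) (Suc j), 6 := nump (int (Suc j)) (Suc j)))"
      by (rule det_Op) (auto simp: s_def nump_def fun_eq_iff)
    moreover have "det (Mv 0 Move_Right)
        ((s j)(5 := nump (int (Suc j)) (Suc j), 6 := nump (int (Suc j)) (Suc j))) 1 (s (Suc j))"
      by (rule det_Mv) (auto simp: s_def fun_eq_iff)
    ultimately show "det (Sq (Wr 5 1 Move_Right) (Sq (Wr 6 1 Move_Right) (Mv 0 Move_Right))) (s j) 5 (s (Suc j))"
      by (intro run_Sq[OF _ run_Sq]) auto
  next
    show "s 0 = ?\<sigma>" using init by (auto simp: s_def fun_eq_iff)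
  qed (auto simp: s_def reads_def read_tape_def input_tape_def)
  moreover have "6 * ?n + 1 \<le> M ^ 2" using M M2 by simp
  ultimately have 1: "det (Loop 0 {1, 2} (Sq (Wr 5 1 Move_Right) (Sq (Wr 6 1 Move_Right) (Mv 0 Move_Right))))
      ?\<sigma> (M ^ 2) (s ?n)" by (rule run_mono)
  let ?v = "?\<sigma>(5 := nump (int ?n) ?n, 6 := nump (int ?n) ?n)"
  have "det (Mv 0 Move_Left) (s ?n) 1 (u 0)"
    by (rule det_Mv) (auto simp: s_def u_def fun_eq_iff)
  moreover have "det (Loop 0 {1, 2} (Mv 0 Move_Left)) (u 0) (2 * ?n + 1) (u ?n)"
    by (rule det_Loop[where s = u and v = ?n and T = 1, OF det_Mv])
      (auto simp: u_def reads_def read_tape_def input_tape_def fun_eq_iff)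
  moreover have "det (Mv 0 Move_Right) (u ?n) 1 ?v"
    using init by (intro det_Mv) (auto simp: u_def fun_eq_iff)
  ultimately have "det (Sq (Mv 0 Move_Left) (Sq (Loop 0 {1, 2} (Mv 0 Move_Left)) (Mv 0 Move_Right)))
      (s ?n) (2 * ?n + 5) ?v"
    by (intro run_Sq[OF _ run_Sq]) auto
  moreover have "2 * ?n + 5 \<le> M ^ 2" using M M2 by simp
  ultimately have 2: "det (Sq (Mv 0 Move_Left) (Sq (Loop 0 {1, 2} (Mv 0 Move_Left)) (Mv 0 Move_Right)))
      (s ?n) (M ^ 2) ?v" by (rule run_mono)
  have t: "2 * ?n + 5 < M ^ 2" using M M2 by simp
  have 3: "det (rewind 5) ?v (M ^ 2) (?\<sigma>(5 := num ?n, 6 := nump (int ?n) ?n))"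
    using det_rewind[of ?v 5 ?n ?n "M ^ 2"] t by (simp add: fun_upd_twist)
  have 4: "det (rewind 6) (?\<sigma>(5 := num ?n, 6 := nump (int ?n) ?n)) (M ^ 2) (?\<sigma>(5 := num ?n, 6 := num ?n))"
    using det_rewind[of "?\<sigma>(5 := num ?n, 6 := nump (int ?n) ?n)" 6 ?n ?n "M ^ 2"] t by simp
  show ?thesis unfolding copy_input_def
    by (rule run_SqM[OF M(1) 1 run_SqM[OF M(1) 2 run_SqM[OF M(1) 3 4, of 3], of 4]]) auto
qed

lemma det_double:
  assumes M: "16 \<le> M" "2 * v \<le> M" and s: "\<sigma> 4 = num v" "\<sigma> 3 = num 0"
  shows "det double \<sigma> (M ^ 8) (\<sigma>(4 := num (2 * v)))"
proof -
  have 1: "det (For 4 (Sq (inc 3) (inc 3))) \<sigma> (M ^ 5) (\<sigma>(3 := num (2 * v)))"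
  proof (rule det_ForM[where s = "\<lambda>t. \<sigma>(3 := num (2 * t))" and v = v and c = 3])
    fix t assume t: "t < v"
    let ?u = "(\<sigma>(3 := num (2 * t)))(4 := nump (int t) v)"
    have "det (inc 3) ?u (M ^ 2) (?u(3 := num (Suc (2 * t))))"
      using t M by (intro det_inc) auto
    moreover have "det (inc 3) (?u(3 := num (Suc (2 * t)))) (M ^ 2)
        (?u(3 := num (Suc (2 * t)), 3 := num (Suc (Suc (2 * t)))))"
      using t M by (intro det_inc) auto
    moreover have "?u(3 := num (Suc (2 * t)), 3 := num (Suc (Suc (2 * t)))) =
        (\<sigma>(3 := num (2 * Suc t)))(4 := nump (int t) v)"
      by (auto simp: fun_eq_iff)
    ultimately show "det (Sq (inc 3) (inc 3)) ?u (M ^ 3) ((\<sigma>(3 := num (2 * Suc t)))(4 := nump (int t) v))"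
      using run_SqM[OF M(1), of "inc 3" _ 2 _ "inc 3" 2 _ 3] by auto
  qed (use M s in \<open>auto simp: fun_eq_iff\<close>)
  have 2: "det (clear 4) (\<sigma>(3 := num (2 * v))) (M ^ 2) (\<sigma>(3 := num (2 * v), 4 := num 0))"
    using M s by (intro det_clear[where v = v]) auto
  have 3: "det (addto 3 4) (\<sigma>(3 := num (2 * v), 4 := num 0)) (M ^ 4) (\<sigma>(3 := num (2 * v), 4 := num (2 * v)))"
    using det_addto[of M 3 4 "\<sigma>(3 := num (2 * v), 4 := num 0)" "2 * v" 0] M by simp
  have "\<sigma>(3 := num (2 * v), 4 := num (2 * v), 3 := num 0) = \<sigma>(4 := num (2 * v))"
    using s by (auto simp: fun_eq_iff)
  then have 4: "det (clear 3) (\<sigma>(3 := num (2 * v), 4 := num (2 * v))) (M ^ 2) (\<sigma>(4 := num (2 * v)))"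
    using det_clear[of M "\<sigma>(3 := num (2 * v), 4 := num (2 * v))" 3 "2 * v"] M by simp
  show ?thesis unfolding double_def
    by (rule run_SqM[OF M(1) 1 run_SqM[OF M(1) 2 run_SqM[OF M(1) 3 4, of 5], of 6]]) auto
qed

lemma det_set_N:
  assumes M: "16 \<le> M" "2 ^ ((n + 1)\<^sup>2) \<le> M"
    and s: "\<sigma> 3 = num 0" "\<sigma> 4 = num 0" "\<sigma> 5 = num n" "\<sigma> 6 = num n"
  shows "det set_N \<sigma> (M ^ 15) (\<sigma>(5 := num (n + 1), 6 := num (n + 1), 4 := num (2 ^ ((n + 1)\<^sup>2))))"
proof -
  let ?m = "n + 1"
  have "?m < 2 ^ ?m" by (rule less_exp)
  also have "\<dots> \<le> 2 ^ (?m\<^sup>2)" by (intro power_increasing) (auto simp: power2_eq_square)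
  finally have m: "?m < M" using M by simp
  have 1: "det (inc 5) \<sigma> (M ^ 2) (\<sigma>(5 := num ?m))"
    using det_inc[OF M(1), of \<sigma> 5 n] s m by simp
  have 2: "det (inc 6) (\<sigma>(5 := num ?m)) (M ^ 2) (\<sigma>(5 := num ?m, 6 := num ?m))"
    using det_inc[OF M(1), of "\<sigma>(5 := num ?m)" 6 n] s m by simp
  have 3: "det (inc 4) (\<sigma>(5 := num ?m, 6 := num ?m)) (M ^ 2) (\<sigma>(5 := num ?m, 6 := num ?m, 4 := num 1))"
    using det_inc[OF M(1), of "\<sigma>(5 := num ?m, 6 := num ?m)" 4 0] s m by simp
  let ?\<tau> = "\<sigma>(5 := num ?m, 6 := num ?m)"
  have inner: "det (For 6 double) (\<rho>(4 := num (2 ^ j))) (M ^ 10) (\<rho>(4 := num (2 ^ (j + ?m))))"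
    if "\<rho> 3 = num 0" "\<rho> 6 = num ?m" "j + ?m \<le> ?m\<^sup>2" for \<rho> j
  proof (rule det_ForM[where s = "\<lambda>t. \<rho>(4 := num (2 ^ (j + t)))" and v = ?m and c = 8])
    fix t assume t: "t < ?m"
    have "2 * 2 ^ (j + t) = (2 :: nat) ^ (j + Suc t)" by simp
    also have "\<dots> \<le> 2 ^ (?m\<^sup>2)" using t that(3) by (intro power_increasing) auto
    finally have "2 * 2 ^ (j + t) \<le> M" using M by simp
    then have "det double (\<rho>(4 := num (2 ^ (j + t)), 6 := nump (int t) ?m)) (M ^ 8)
        (\<rho>(4 := num (2 ^ (j + t)), 6 := nump (int t) ?m, 4 := num (2 * 2 ^ (j + t))))"
      using that by (intro det_double[OF M(1)]) auto
    moreover have "\<rho>(4 := num (2 ^ (j + t)), 6 := nump (int t) ?m, 4 := num (2 * 2 ^ (j + t))) =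
        \<rho>(4 := num (2 ^ (j + Suc t)), 6 := nump (int t) ?m)" by (auto simp: fun_eq_iff)
    ultimately show "det double ((\<rho>(4 := num (2 ^ (j + t))))(6 := nump (int t) ?m)) (M ^ 8)
        ((\<rho>(4 := num (2 ^ (j + Suc t))))(6 := nump (int t) ?m))"
      by simp
  qed (use M m that in auto)
  have 4: "det (For 5 (For 6 double)) (\<sigma>(5 := num ?m, 6 := num ?m, 4 := num 1)) (M ^ 12)
      (?\<tau>(4 := num (2 ^ (?m\<^sup>2))))"
  proof (rule det_ForM[where s = "\<lambda>t. ?\<tau>(4 := num (2 ^ (t * ?m)))" and v = ?m and c = 10])
    fix t assume t: "t < ?m"
    have "t * ?m + ?m = Suc t * ?m" by simp
    also have "\<dots> \<le> ?m\<^sup>2" using t unfolding power2_eq_square by (intro mult_right_mono) auto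
    finally have "det (For 6 double) ((?\<tau>(5 := nump (int t) ?m))(4 := num (2 ^ (t * ?m)))) (M ^ 10)
        ((?\<tau>(5 := nump (int t) ?m))(4 := num (2 ^ (t * ?m + ?m))))"
      using s by (intro inner) auto
    moreover have "t * ?m + ?m = Suc t * ?m" by simp
    ultimately show "det (For 6 double) ((?\<tau>(4 := num (2 ^ (t * ?m))))(5 := nump (int t) ?m)) (M ^ 10)
        ((?\<tau>(4 := num (2 ^ (Suc t * ?m))))(5 := nump (int t) ?m))"
      by (simp only: fun_upd_twist[of 4 5, simplified])
  qed (use M m s in \<open>auto simp: power2_eq_square\<close>)
  show ?thesis unfolding set_N_def
    by (rule run_SqM[OF M(1) 1 run_SqM[OF M(1) 2 run_SqM[OF M(1) 3 4, of 13], of 14]]) auto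
qed

lemma det_set_limits:
  assumes M: "16 \<le> M" "N \<le> M"
  shows "distinct js \<Longrightarrow> \<sigma> 4 = num N \<Longrightarrow> \<forall>j \<in> set js. \<sigma> (lt j) = num 0 \<Longrightarrow>
    det (set_limits js) \<sigma> (M ^ (length js + 5)) (\<lambda>t. if t \<in> lt ` set js then num N else \<sigma> t)"
proof (induction js arbitrary: \<sigma>)
  case Nil
  have "det skip \<sigma> (M ^ 5) \<sigma>" using M by (intro det_Op1 det_skip) auto
  then show ?case by (simp add: set_limits_def)
next
  case (Cons j js)
  let ?\<tau> = "\<sigma>(lt j := num N)"
  have 1: "det (addto 4 (lt j)) \<sigma> (M ^ 4) ?\<tau>"
    using det_addto[OF M(1), of 4 "lt j" \<sigma> N 0] Cons.prems M by simp
  have "det (set_limits js) ?\<tau> (M ^ (length js + 5)) (\<lambda>t. if t \<in> lt ` set js then num N else ?\<tau> t)"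
    by (rule Cons.IH) (use Cons.prems in auto)
  moreover have "(\<lambda>t. if t \<in> lt ` set js then num N else ?\<tau> t) =
      (\<lambda>t. if t \<in> lt ` set (j # js) then num N else \<sigma> t)" by auto
  ultimately have 2: "det (set_limits js) ?\<tau> (M ^ (length js + 5))
      (\<lambda>t. if t \<in> lt ` set (j # js) then num N else \<sigma> t)" by metis
  have "set_limits (j # js) = Sq (addto 4 (lt j)) (set_limits js)" by (simp add: set_limits_def)
  then show ?case using run_SqM[OF M(1) 1 2, of "length (j # js) + 5"] by simp
qed

lemma det_powers:
  assumes M: "16 \<le> M" "N \<ge> 1" "a * N ^ D \<le> M" "N \<le> M" "\<sigma> 3 = num 0" "\<sigma> 4 = num N"
  shows "det (seqs (replicate D mulN)) (\<sigma>(2 := num a)) (M ^ (D + 10)) (\<sigma>(2 := num (a * N ^ D)))"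
  using M(3)
proof (induction D arbitrary: a)
  case 0
  have "det skip (\<sigma>(2 := num a)) (M ^ 10) (\<sigma>(2 := num a))" using M by (intro det_Op1 det_skip) auto
  then show ?case by (simp only: replicate_0 seqs.simps power_0 mult_1_right add_0)
next
  case (Suc D)
  have "a * N * 1 \<le> a * N * N ^ D" "a * 1 \<le> a * N" using M by (auto intro!: mult_left_mono)
  moreover have "a * N * N ^ D \<le> M" using Suc.prems by (simp add: mult.assoc)
  ultimately have a: "a * N \<le> M" "a \<le> M" by linarith+
  have 1: "det mulN (\<sigma>(2 := num a)) (M ^ 9) (\<sigma>(2 := num (a * N)))"
    using det_mulN[OF M(1), of "\<sigma>(2 := num a)" a N] M a by simp
  have "det (seqs (replicate D mulN)) (\<sigma>(2 := num (a * N))) (M ^ (D + 10)) (\<sigma>(2 := num (a * N * N ^ D)))"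
    by (rule Suc.IH) (use Suc.prems in \<open>simp add: mult.assoc\<close>)
  then have 2: "det (seqs (replicate D mulN)) (\<sigma>(2 := num (a * N))) (M ^ (D + 10))
      (\<sigma>(2 := num (a * N ^ Suc D)))" by (simp add: mult.assoc)
  show ?case unfolding replicate_Suc seqs.simps by (rule run_SqM[OF M(1) 1 2]) auto
qed

text \<open>A table given by a set of positions. Stores after guessing are then indexed by arbitrary
  sets, which keeps the set of final stores exact.\<close>

definition bits :: "nat \<Rightarrow> int set \<Rightarrow> int \<Rightarrow> nat" where
  "bits a S p = of_bool (0 \<le> p \<and> p < int a \<and> p \<in> S)"

lemma run_guess:
  assumes M: "16 \<le> M" "a \<le> M" and s: "\<sigma> 2 = num a" "\<sigma> (rt i) = num 0"
  shows "run (guess i) {\<sigma>} (M ^ 4) (range (\<lambda>S. \<sigma>(rt i := (0, bits a S))))"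
proof -
  define X where "X = (\<lambda>j. range (\<lambda>S. \<sigma>(rt i := (int j, bits j S))))"
  have "run (For 2 (Guess (rt i))) (X 0) (M ^ (1 + 2)) (X a)"
  proof (rule run_ForM)
    fix j assume "j < a"
    have bits: "(bits j S)(int j := b) = bits (Suc j) (if b = 1 then insert (int j) S else S - {int j})"
      if "b = 0 \<or> b = 1" for b S
      using that by (auto simp: bits_def fun_eq_iff)
    have "run (Guess (rt i)) ((\<lambda>\<sigma>. \<sigma>(2 := nump (int j) a)) ` X j) 1
        ((\<lambda>\<sigma>. \<sigma>(2 := nump (int j) a)) ` X (Suc j))"
    proof (rule run_Op, intro equalityI subsetI)
      fix \<tau> assume "\<tau> \<in> (\<lambda>\<sigma>. \<sigma>(2 := nump (int j) a)) ` X (Suc j)"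
      then obtain S where \<tau>: "\<tau> = \<sigma>(rt i := (int (Suc j), bits (Suc j) S), 2 := nump (int j) a)"
        by (auto simp: X_def)
      let ?\<rho> = "\<sigma>(rt i := (int j, bits j S), 2 := nump (int j) a)" and ?b = "of_bool (int j \<in> S) :: nat"
      have "(bits j S)(int j := ?b) = bits (Suc j) S" by (auto simp: bits_def fun_eq_iff)
      then have "\<tau> = ?\<rho>(rt i := perform (?b, Move_Right) (?\<rho> (rt i)))"
        unfolding \<tau> by (auto simp: fun_eq_iff)
      moreover have "?\<rho> \<in> (\<lambda>\<sigma>. \<sigma>(2 := nump (int j) a)) ` X j" by (auto simp: X_def)
      ultimately show "\<tau> \<in> {\<sigma>(rt i := perform x (\<sigma> (rt i))) |\<sigma> x.
          \<sigma> \<in> (\<lambda>\<sigma>. \<sigma>(2 := nump (int j) a)) ` X j \<and> x \<in> {0, 1} \<times> {Move_Right}}"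
        by (intro CollectI exI[of _ ?\<rho>] exI[of _ "(?b, Move_Right)"]) auto
    next
      fix \<tau> assume "\<tau> \<in> {\<sigma>(rt i := perform x (\<sigma> (rt i))) |\<sigma> x.
          \<sigma> \<in> (\<lambda>\<sigma>. \<sigma>(2 := nump (int j) a)) ` X j \<and> x \<in> {0, 1} \<times> {Move_Right}}"
      then obtain \<rho> x where \<rho>: "\<tau> = \<rho>(rt i := perform x (\<rho> (rt i)))"
          "\<rho> \<in> (\<lambda>\<sigma>. \<sigma>(2 := nump (int j) a)) ` X j" and x: "x \<in> {0, 1} \<times> {Move_Right}"
        by blast
      obtain S where S: "\<rho> = \<sigma>(rt i := (int j, bits j S), 2 := nump (int j) a)"
        using \<rho>(2) unfolding X_def by blast
      obtain b where b: "b = 0 \<or> b = 1" and x': "x = (b, Move_Right)"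
        using x by auto
      have \<tau>: "\<tau> = \<sigma>(rt i := (int j, bits j S), 2 := nump (int j) a,
          rt i := (int j + 1, (bits j S)(int j := b)))"
        unfolding \<rho>(1) S x' by simp
      have "\<tau> = \<sigma>(rt i := (int (Suc j), (bits j S)(int j := b)), 2 := nump (int j) a)"
        unfolding \<tau> by (auto simp: fun_eq_iff)
      then show "\<tau> \<in> (\<lambda>\<sigma>. \<sigma>(2 := nump (int j) a)) ` X (Suc j)"
        unfolding bits[OF b] X_def by auto
    qed
    then show "run (Guess (rt i)) ((\<lambda>\<sigma>. \<sigma>(2 := nump (int j) a)) ` X j) (M ^ 1)
        ((\<lambda>\<sigma>. \<sigma>(2 := nump (int j) a)) ` X (Suc j))"
      by (rule run_mono) (use M in auto)
  qed (use M s in \<open>auto simp: X_def\<close>)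
  moreover have "X 0 = {\<sigma>}" using s by (auto simp: X_def fun_eq_iff bits_def nump_def)
  ultimately have 1: "run (For 2 (Guess (rt i))) {\<sigma>} (M ^ 3) (X a)"
    by (simp add: eval_nat_numeral)
  have 2: "run (For 2 (Mv (rt i) Move_Left)) (X a) (M ^ 3) (range (\<lambda>S. \<sigma>(rt i := (0, bits a S))))"
    unfolding X_def
    by (rule run_image) (use M s in \<open>auto intro!: det_shift[where v = a] simp: fun_eq_iff\<close>)
  show ?thesis unfolding guess_def by (rule run_SqM[OF M(1) 1 2]) auto
qed

text \<open>The term \<open>(t - 9) div 3\<close> recovers \<open>i\<close> from the tape number
  \<open>rt i\<close>.\<close>

lemma run_guesses:
  assumes M: "16 \<le> M" "a \<le> M"
  shows "distinct js \<Longrightarrow> \<sigma> 2 = num a \<Longrightarrow> \<forall>i \<in> set js. \<sigma> (rt i) = num 0 \<Longrightarrow>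
    run (seqs (map guess js)) {\<sigma>} (M ^ (length js + 5))
      (range (\<lambda>S t. if t \<in> rt ` set js then (0, bits a (S ((t - 9) div 3))) else \<sigma> t))"
proof (induction js arbitrary: \<sigma>)
  case Nil
  have "det skip \<sigma> (M ^ 5) \<sigma>" using M by (intro det_Op1 det_skip) auto
  then show ?case by (simp add: image_constant_conv)
next
  case (Cons j js)
  have rt: "(rt i - 9) div 3 = i" for i by (simp add: rt_def)
  let ?F = "\<lambda>js \<sigma> S t. if t \<in> rt ` set js then (0, bits a (S ((t - 9) div 3))) else \<sigma> t"
  let ?\<tau> = "\<lambda>S. \<sigma>(rt j := (0, bits a S))"
  have 1: "run (guess j) {\<sigma>} (M ^ 4) (range ?\<tau>)"
    using Cons.prems by (intro run_guess[OF M]) auto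
  have IH: "run (seqs (map guess js)) {?\<tau> S} (M ^ (length js + 5)) (range (?F js (?\<tau> S)))" for S
    by (rule Cons.IH) (use Cons.prems in auto)
  have "(\<Union>S. range (?F js (?\<tau> S))) = range (?F (j # js) \<sigma>)"
  proof (intro equalityI subsetI)
    fix \<rho> assume "\<rho> \<in> (\<Union>S. range (?F js (?\<tau> S)))"
    then obtain S S' where "\<rho> = ?F js (?\<tau> S) S'" by auto
    then have "\<rho> = ?F (j # js) \<sigma> (S'(j := S))"
      using Cons.prems(1) by (auto simp: fun_eq_iff rt)
    then show "\<rho> \<in> range (?F (j # js) \<sigma>)" by blast
  next
    fix \<rho> assume "\<rho> \<in> range (?F (j # js) \<sigma>)"
    then obtain S where "\<rho> = ?F (j # js) \<sigma> S" by auto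
    then have "\<rho> = ?F js (?\<tau> (S j)) S"
      using Cons.prems(1) by (auto simp: fun_eq_iff rt)
    then show "\<rho> \<in> (\<Union>S. range (?F js (?\<tau> S)))" by blast
  qed
  then have 2: "run (seqs (map guess js)) (range ?\<tau>) (M ^ (length js + 5)) (range (?F (j # js) \<sigma>))"
    using run_UN[of UNIV "seqs (map guess js)" "\<lambda>S. {?\<tau> S}" _ "\<lambda>S. range (?F js (?\<tau> S))", OF IH]
    by (simp add: UNION_singleton_eq_range)
  show ?case unfolding list.map seqs.simps
    by (rule run_SqM[OF M(1) 1 2]) auto
qed

lemma wf_prog_compile:
  assumes "wf_fm ar r k \<phi>" "k + rank \<phi> \<le> K" "T \<ge> 10 + 3 * K" "T \<ge> 10 + 3 * r"
  shows "wf_prog T (compile k \<phi>)"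
proof -
  have addr: "wf_prog T (addr xs)" if "\<forall>x \<in> set xs. x < K" for xs
    using that assms(3) by (induction xs) (auto simp: mulN_def addto_def For_def rewind_def clear_def inc_def xt_def)
  show ?thesis
    using assms(1,2)
  proof (induction \<phi> arbitrary: k)
    case (Rel i xs)
    then have "wf_prog T (addr xs)" by (intro addr) auto
    then show ?case using Rel assms(3,4) by (auto simp: For_def rewind_def clear_def inc_def rt_def)
  qed (use assms(3) in \<open>auto simp: addto_def For_def rewind_def clear_def inc_def xt_def lt_def rt_def\<close>)
qed

lemma wf_prog_seqs: "T > 0 \<Longrightarrow> \<forall>p \<in> set ps. wf_prog T p \<Longrightarrow> wf_prog T (seqs ps)"
  by (induction ps) auto

theorem definable_NEXP:
  assumes wf: "wf_fm ar r 0 \<phi>"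
  shows "{w. \<exists>I. sat (2 ^ ((length w + 1)\<^sup>2)) w I [] \<phi>} \<in> NEXP"
proof -
  define D where "D = Max (insert 1 (ar ` {..<r}))"
  have D: "D \<ge> 1" "\<forall>i < r. ar i \<le> D" by (auto simp: D_def)
  define K where "K = rank \<phi>"
  define T where "T = 10 + 3 * K + 3 * r"
  define c where "c = cost \<phi> + D + K + r + 40"
  \<comment> \<open>The running time is \<open>M ^ c\<close> with \<open>M = N ^ (D + 5)\<close>,
    and the exponent of 2 in it is \<open>(D + 5) * c\<close> times the square of
    \<open>length w + 1\<close>.\<close>
  define p where "p = smult ((D + 5) * c) ([:1, 1:]\<^sup>2)"
  have wfp: "wf_prog T (decide r D K \<phi>)"
  proof -
    have "wf_prog T (compile 0 \<phi>)" using wf by (rule wf_prog_compile) (auto simp: K_def T_def)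
    then show ?thesis
      unfolding decide_def copy_input_def set_N_def set_limits_def double_def guess_def
      by (auto simp: T_def mulN_def addto_def For_def rewind_def clear_def inc_def lt_def rt_def
          intro!: wf_prog_seqs)
  qed
  have "\<exists>Y. run (decide r D K \<phi>) {init_store w} (2 ^ poly p (length w)) Y \<and>
      (Y \<noteq> {} \<longleftrightarrow> (\<exists>I. sat (2 ^ ((length w + 1)\<^sup>2)) w I [] \<phi>))" for w
  proof -
    let ?n = "length w"
    define N :: nat where "N = 2 ^ ((?n + 1)\<^sup>2)"
    \<comment> \<open>As \<open>N\<close> is at least 2, the five additional factors give 32 * N^D
      <= M, which covers both bounds on \<open>M\<close> required by the evaluator.\<close>
    define M where "M = N ^ (D + 5)"
    have "2 ^ 1 \<le> N" unfolding N_def by (intro power_increasing) auto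
    then have N2: "N \<ge> 2" by simp
    have "2 ^ 5 * N ^ D \<le> N ^ 5 * N ^ D" using N2 by (intro mult_right_mono power_mono) auto
    then have "32 * N ^ D \<le> M" by (simp add: M_def power_add mult.commute)
    moreover have "N ^ 1 \<le> N ^ D" using N2 D by (intro power_increasing) auto
    ultimately have M: "16 \<le> M" "N ^ D * 2 \<le> M" "1 * N ^ D \<le> M" "N \<le> M" using N2 by auto
    have "?n + 1 < 2 ^ (?n + 1)" by (rule less_exp)
    also have "\<dots> \<le> N" unfolding N_def by (intro power_increasing) (auto simp: power2_eq_square)
    finally have n: "?n + 1 < N" .
    have init: "init_store w i = num 0" if "i > 0" for i
      using that by (simp add: init_store_def blank_num)
    define \<sigma>1 where "\<sigma>1 = (init_store w)(5 := num ?n, 6 := num ?n)"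
    define \<sigma>2 where "\<sigma>2 = \<sigma>1(5 := num (?n + 1), 6 := num (?n + 1), 4 := num N)"
    define \<sigma>3 where "\<sigma>3 = (\<lambda>t. if t \<in> lt ` set [0..<K] then num N else \<sigma>2 t)"
    define A where "A = N ^ D"
    define F where "F = (\<lambda>(S :: nat \<Rightarrow> int set) t. if t \<in> rt ` set [0..<r] then (0, bits A (S ((t - 9) div 3)))
      else (\<sigma>3(2 := num A)) t)"
    define J where "J = (\<lambda>(S :: nat \<Rightarrow> int set) i xs. int (hor N xs) \<in> S i)"
    have rt: "(rt i - 9) div 3 = i" for i by (simp add: rt_def)
    have r1: "det copy_input (init_store w) (M ^ 5) \<sigma>1"
      unfolding \<sigma>1_def using M n by (intro det_copy_input) auto
    have r2: "det set_N \<sigma>1 (M ^ 15) \<sigma>2"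
      unfolding \<sigma>2_def N_def using M by (intro det_set_N) (auto simp: \<sigma>1_def init N_def)
    have r3: "det (set_limits [0..<K]) \<sigma>2 (M ^ (K + 5)) \<sigma>3"
      unfolding \<sigma>3_def using det_set_limits[OF M(1,4), of "[0..<K]" \<sigma>2]
      by (simp add: \<sigma>2_def \<sigma>1_def init lt_def)
    have s3: "\<sigma>3 2 = num 0" "\<sigma>3 3 = num 0" "\<sigma>3 4 = num N" "\<sigma>3 1 = num 0" "\<sigma>3 0 = input_tape w"
      "\<sigma>3 (xt j) = num 0" "\<sigma>3 (rt j) = num 0" "j < K \<Longrightarrow> \<sigma>3 (lt j) = num N" for j
      by (auto simp: \<sigma>3_def \<sigma>2_def \<sigma>1_def init init_store_def[of w, THEN fun_cong, of 0] xt_def lt_def rt_def)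
        (presburger)+
    have r4: "det (inc 2) \<sigma>3 (M ^ 2) (\<sigma>3(2 := num 1))"
      using det_inc[OF M(1), of \<sigma>3 2 0] s3 M by simp
    have r5: "det (seqs (replicate D mulN)) (\<sigma>3(2 := num 1)) (M ^ (D + 10)) (\<sigma>3(2 := num A))"
      using det_powers[OF M(1) _ M(3,4), of \<sigma>3] s3 N2 by (simp add: A_def del: One_nat_def)
    have r6: "run (seqs (map guess [0..<r])) {\<sigma>3(2 := num A)} (M ^ (r + 5)) (range F)"
      unfolding F_def using run_guesses[OF M(1), of A "[0..<r]" "\<sigma>3(2 := num A)"] M s3
      by (simp add: A_def)
    have r7: "run (clear 2) (range F) (M ^ 2) (range (\<lambda>S. (F S)(2 := num 0)))"
      using M by (intro run_image det_clear[where v = A]) (auto simp: F_def A_def rt_def)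
    have r8: "run (Sq (compile 0 \<phi>) (Cond 1 {1} skip (Op 0 (\<lambda>_. {})))) {(F S)(2 := num 0)} (M ^ (cost \<phi> + 3))
        (if sat N w (J S) [] \<phi> then {(F S)(2 := num 0, 1 := num 1)} else {})" for S
    proof -
      let ?\<tau> = "(F S)(2 := num 0)"
      let ?\<rho> = "?\<tau>(1 := num (of_bool (sat N w (J S) [] \<phi>)))"
      have "bits A (S i) (int (hor N xs)) = of_bool (J S i xs)"
        if "i < r" "length xs = ar i" "\<forall>x \<in> set xs. x < N" for i xs
      proof -
        have "hor N xs < N ^ length xs" using that by (intro hor_less)
        also have "\<dots> \<le> A" unfolding A_def using that D N2 by (intro power_increasing) auto
        finally show ?thesis by (simp add: bits_def J_def)
      qed
      then have "invar ar r K w N (J S) [] ?\<tau>"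
        unfolding invar_def using s3 by (auto simp: F_def rt image_iff intro!: exI[of _ 0])
      then have 1: "det (compile 0 \<phi>) ?\<tau> (M ^ cost \<phi>) ?\<rho>"
        using det_compile[OF M(1,2) _ D(1) D(2), of "[]" \<phi> K w "J S" ?\<tau>] wf N2 by (simp add: K_def)
      have "run (if sat N w (J S) [] \<phi> then skip else Op 0 (\<lambda>_. {})) {?\<rho>} 1
        (if sat N w (J S) [] \<phi> then {?\<rho>} else {})"
        using det_skip[of ?\<rho>] run_Op[where Y = "{}" and X = "{?\<rho>}" and f = "\<lambda>_. {}" and i = 0] by auto
      then have "run (Cond 1 {1} skip (Op 0 (\<lambda>_. {}))) {?\<rho>} 2 (if sat N w (J S) [] \<phi> then {?\<rho>} else {})"
        by (intro run_Cond[where c = "sat N w (J S) [] \<phi>" and T = 1]) (auto simp: reads_nump)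
      moreover have "2 \<le> M ^ 1" using M by simp
      ultimately have "run (Cond 1 {1} skip (Op 0 (\<lambda>_. {}))) {?\<rho>} (M ^ 1) (if sat N w (J S) [] \<phi> then {?\<rho>} else {})"
        by (rule run_mono)
      then have "run (Cond 1 {1} skip (Op 0 (\<lambda>_. {}))) {?\<rho>} (M ^ 1)
          (if sat N w (J S) [] \<phi> then {(F S)(2 := num 0, 1 := num 1)} else {})"
        by (simp split: if_splits)
      then show ?thesis by (rule run_SqM[OF M(1) 1]) (auto)
    qed
    define Z where "Z = (\<Union>S. if sat N w (J S) [] \<phi> then {(F S)(2 := num 0, 1 := num 1)} else {})"
    have r9: "run (Sq (compile 0 \<phi>) (Cond 1 {1} skip (Op 0 (\<lambda>_. {})))) (range (\<lambda>S. (F S)(2 := num 0)))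
        (M ^ (cost \<phi> + 3)) Z"
      unfolding Z_def using run_UN[of UNIV, OF r8] by (simp add: UNION_singleton_eq_range)
    have "run (decide r D K \<phi>) {init_store w} (M ^ c) Z"
      unfolding decide_def
      by (rule run_SqM[OF M(1) r1 run_SqM[OF M(1) r2 run_SqM[OF M(1) r3 run_SqM[OF M(1) r4 run_SqM[OF M(1) r5
        run_SqM[OF M(1) r6 run_SqM[OF M(1) r7 r9, of "cost \<phi> + 4"], of "cost \<phi> + r + 6"],
        of "cost \<phi> + r + D + 11"], of "cost \<phi> + r + D + 12"], of "cost \<phi> + r + D + K + 13"],
        of "cost \<phi> + r + D + K + 20"]]) (auto simp: c_def)
    moreover have "M ^ c = 2 ^ poly p ?n"
      by (simp add: M_def N_def p_def power_mult [symmetric] algebra_simps)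
    moreover have "Z \<noteq> {} \<longleftrightarrow> (\<exists>I. sat N w I [] \<phi>)"
    proof
      assume "\<exists>I. sat N w I [] \<phi>"
      then obtain I where I: "sat N w I [] \<phi>" by blast
      \<comment> \<open>Any interpretation can be tabulated. The formula evaluates relations only at
        tuples of the right length with entries below \<open>N\<close>, and on these
        \<open>hor\<close> is injective, so the table answers as \<open>I\<close> does.\<close>
      define S where "S = (\<lambda>i. {int (hor N xs) | xs. length xs = ar i \<and> (\<forall>x \<in> set xs. x < N) \<and> I i xs})"
      have JS: "J S i zs \<longleftrightarrow> I i zs" if "length zs = ar i" "\<forall>x \<in> set zs. x < N" for i zs
      proof
        assume "J S i zs"
        then obtain xs where xs: "hor N zs = hor N xs" "length xs = ar i" "\<forall>x \<in> set xs. x < N" "I i xs"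
          by (auto simp: J_def S_def)
        then have "zs = xs" using hor_inj[of zs xs N] that by simp
        then show "I i zs" using xs(4) by simp
      next
        assume "I i zs"
        then show "J S i zs" using that unfolding J_def S_def by blast
      qed
      have "sat N w (J S) e \<psi> = sat N w I e \<psi>"
        if "wf_fm ar r (length e) \<psi>" "\<forall>x \<in> set e. x < N" for e \<psi>
        using that
      proof (induction \<psi> arbitrary: e)
        case (Rel i xs)
        have "\<forall>x \<in> set (map (nth e) xs). x < N" using Rel by auto
        then show ?case using Rel JS[of "map (nth e) xs" i] by simp
      qed auto
      from this[of "[]" \<phi>] have "sat N w (J S) [] \<phi>" using I wf by simp
      then show "Z \<noteq> {}" unfolding Z_def by auto
    qed (auto simp: Z_def split: if_splits)
    ultimately show ?thesis unfolding N_def by metis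
  qed
  then obtain Y where Y: "\<And>w. run (decide r D K \<phi>) {init_store w} (2 ^ poly p (length w)) (Y w)"
    "\<And>w. Y w \<noteq> {} \<longleftrightarrow> (\<exists>I. sat (2 ^ ((length w + 1)\<^sup>2)) w I [] \<phi>)" by metis
  have "{w. Y w \<noteq> {}} \<in> NEXP"
    using wfp Y(1) by (rule NEXP_run[rotated]) (simp add: T_def)
  then show ?thesis unfolding Y(2) .
qed

section \<open>The formula for non-containment\<close>

text \<open>Formulas with named binders: a formula is a function of the number of variables in scope, and
  a binder passes the index of the variable that it introduces.\<close>

type_synonym form = "nat \<Rightarrow> fm"

definition fEX :: "(nat \<Rightarrow> form) \<Rightarrow> form" where "fEX F k = Ex (F k (Suc k))"
definition fAND :: "form \<Rightarrow> form \<Rightarrow> form" (infixr "&&" 35) where "(a && b) k = Conj (a k) (b k)"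
definition fNOT :: "form \<Rightarrow> form" where "fNOT a k = Neg (a k)"
definition fREL :: "nat \<Rightarrow> nat list \<Rightarrow> form" where "fREL i xs k = Rel i xs"
definition fBIT :: "bool \<Rightarrow> nat \<Rightarrow> form" where "fBIT b x k = Bit b x"
definition fADD :: "nat \<Rightarrow> nat \<Rightarrow> nat \<Rightarrow> form" where "fADD x y z k = Add x y z"
definition fIMP :: "form \<Rightarrow> form \<Rightarrow> form" (infixr "==>>" 25) where "(a ==>> b) = fNOT (a && fNOT b)"
definition fOR :: "form \<Rightarrow> form \<Rightarrow> form" where "fOR a b = fNOT (fNOT a && fNOT b)"
definition fALL :: "(nat \<Rightarrow> form) \<Rightarrow> form" where "fALL F = fNOT (fEX (\<lambda>v. fNOT (F v)))"

definition fZERO :: "nat \<Rightarrow> form" where "fZERO x = fADD x x x"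
definition fEQ :: "nat \<Rightarrow> nat \<Rightarrow> form" where "fEQ x y = fEX (\<lambda>z. fZERO z && fADD x z y)"
definition fLE :: "nat \<Rightarrow> nat \<Rightarrow> form" where "fLE x y = fEX (\<lambda>z. fADD x z y)"
definition fLT :: "nat \<Rightarrow> nat \<Rightarrow> form" where "fLT x y = (fLE x y && fNOT (fEQ x y))"
definition fONE :: "nat \<Rightarrow> form" where
  "fONE x = (fNOT (fZERO x) && fALL (\<lambda>z. fLT z x ==>> fZERO z))"
definition fSUC :: "nat \<Rightarrow> nat \<Rightarrow> form" where "fSUC x y = fEX (\<lambda>z. fONE z && fADD x z y)"

primrec fCONST :: "nat \<Rightarrow> nat \<Rightarrow> form" where
  "fCONST 0 x = fZERO x"
| "fCONST (Suc n) x = fEX (\<lambda>y. fCONST n y && fSUC y x)"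

primrec fMEM :: "nat list \<Rightarrow> nat \<Rightarrow> form" where
  "fMEM [] x = (fZERO x && fNOT (fZERO x))"
| "fMEM (n # ns) x = fOR (fCONST n x) (fMEM ns x)"

definition fUN :: "nat \<Rightarrow> nat \<Rightarrow> nat \<Rightarrow> form" where
  "fUN p v q = fEX (\<lambda>y. fADD p v y && fSUC y q && fBIT False y &&
     fALL (\<lambda>z. fLE p z && fLT z y ==>> fBIT True z))"

definition fIN :: "nat \<Rightarrow> form" where "fIN x = fOR (fBIT True x) (fBIT False x)"

text \<open>For an edge code at \<open>p\<close>: \<open>s\<close>, \<open>t\<close> and
  \<open>l\<close> are the values of the unary fields, \<open>b\<close> is the position of the
  interval bits and \<open>q\<close> the position after them.\<close>

definition fEDGE :: "nat \<Rightarrow> nat \<Rightarrow> nat \<Rightarrow> nat \<Rightarrow> nat \<Rightarrow> nat \<Rightarrow> form" where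
  "fEDGE p s t l b q = fEX (\<lambda>p1. fUN p s p1 && fEX (\<lambda>p2. fUN p1 t p2 && fUN p2 l b &&
     fEX (\<lambda>b1. fSUC b b1 && fSUC b1 q && fIN b1)))"

definition fNEXT :: "nat \<Rightarrow> nat \<Rightarrow> form" where
  "fNEXT x q = fEX (\<lambda>s. fEX (\<lambda>t. fEX (\<lambda>l. fEX (\<lambda>b. fEDGE x s t l b q))))"

text \<open>\<open>Rel 0 [p, i, q]\<close> stands for: the \<open>i\<close> edge codes from \<open>p\<close> on are well formed and end at \<open>q\<close>.\<close>

definition fPOS :: form where
  "fPOS = fALL (\<lambda>p. fALL (\<lambda>i. fALL (\<lambda>q.
     (let a = fREL 0 [p, i, q];
        b = fOR (fZERO i && fEQ q p) (fEX (\<lambda>j. fSUC j i && fEX (\<lambda>x. fREL 0 [p, j, x] && fNEXT x q)))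
      in (a ==>> b) && (b ==>> a)))))"

text \<open>For a graph code at \<open>p\<close>: \<open>n\<close> and \<open>m\<close> count nodes
  and edges, \<open>r\<close> is where the edges start and \<open>q\<close> where the code ends. The
  list \<open>ls\<close> holds the codes of the labels.\<close>

definition fCODE :: "nat list \<Rightarrow> nat \<Rightarrow> nat \<Rightarrow> nat \<Rightarrow> nat \<Rightarrow> nat \<Rightarrow> form" where
  "fCODE ls p n m r q = fEX (\<lambda>p1. fUN p n p1 && fUN p1 m r && fREL 0 [r, m, q] &&
     fALL (\<lambda>i. fLT i m ==>> fEX (\<lambda>x. fREL 0 [r, i, x] && fEX (\<lambda>s. fEX (\<lambda>t. fEX (\<lambda>l. fEX (\<lambda>b. fEX (\<lambda>y.
       fEDGE x s t l b y && fLT s n && fLT t n && fMEM ls l))))))))"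

definition fEDAT :: "nat \<Rightarrow> nat \<Rightarrow> nat \<Rightarrow> nat \<Rightarrow> nat \<Rightarrow> nat \<Rightarrow> form" where
  "fEDAT m r f s t l = (fLT f m && fEX (\<lambda>x. fREL 0 [r, f, x] && fEX (\<lambda>b. fEX (\<lambda>y. fEDGE x s t l b y))))"

definition fREQ :: "nat \<Rightarrow> nat \<Rightarrow> nat \<Rightarrow> form" where
  "fREQ m r f = (fLT f m && fEX (\<lambda>x. fREL 0 [r, f, x] && fEX (\<lambda>s. fEX (\<lambda>t. fEX (\<lambda>l. fEX (\<lambda>b. fEX (\<lambda>y.
     fEDGE x s t l b y && fBIT True b)))))))"

definition fUNB :: "nat \<Rightarrow> nat \<Rightarrow> nat \<Rightarrow> form" where
  "fUNB m r f = (fLT f m && fEX (\<lambda>x. fREL 0 [r, f, x] && fEX (\<lambda>s. fEX (\<lambda>t. fEX (\<lambda>l. fEX (\<lambda>b. fEX (\<lambda>y.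
     fEDGE x s t l b y && fEX (\<lambda>b1. fSUC b b1 && fBIT True b1))))))))"

definition fOUT :: "nat \<Rightarrow> nat \<Rightarrow> nat \<Rightarrow> nat \<Rightarrow> form" where
  "fOUT m r k f = fEX (\<lambda>t. fEX (\<lambda>l. fEDAT m r f k t l))"

definition fALLW :: "nat \<Rightarrow> nat \<Rightarrow> nat \<Rightarrow> nat \<Rightarrow> nat \<Rightarrow> nat \<Rightarrow> form" where
  "fALLW m r k a y f = fEX (\<lambda>t. fEDAT m r f k t a && fNOT (fREL 4 [y, t]))"

definition fCEX_H :: "nat \<Rightarrow> nat \<Rightarrow> nat \<Rightarrow> nat \<Rightarrow> nat \<Rightarrow> form" where
  "fCEX_H n m r x h = (fLT h n &&
     fALL (\<lambda>a. fALL (\<lambda>y. fREL 1 [x, a, y] ==>> fEX (\<lambda>f. fREL 3 [x, h, a, y, f] &&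
       fEX (\<lambda>t. fEDAT m r f h t a && fREL 2 [y, t]) && fALL (\<lambda>g. fREL 3 [x, h, a, y, g] ==>> fEQ g f)))) &&
     fALL (\<lambda>f. fOUT m r h f ==>>
       (fREQ m r f ==>> fEX (\<lambda>a. fEX (\<lambda>y. fREL 1 [x, a, y] && fREL 3 [x, h, a, y, f]))) &&
       (fNOT (fUNB m r f) ==>> fALL (\<lambda>a. fALL (\<lambda>y. fALL (\<lambda>b. fALL (\<lambda>z.
          fREL 1 [x, a, y] && fREL 3 [x, h, a, y, f] && fREL 1 [x, b, z] && fREL 3 [x, h, b, z, f] ==>>
          fEQ a b && fEQ y z)))))))"

definition fUNDER :: "nat \<Rightarrow> nat \<Rightarrow> nat \<Rightarrow> nat \<Rightarrow> form" where
  "fUNDER m r x k = (fALL (\<lambda>f. fREL 6 [x, k, f] ==>> fOUT m r k f && fREQ m r f) &&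
     fALL (\<lambda>a. fALL (\<lambda>y. fREL 1 [x, a, y] && fEX (\<lambda>f. fREL 6 [x, k, f] && fALLW m r k a y f) ==>>
       fEX (\<lambda>f. fREL 6 [x, k, f] && fREL 7 [x, k, a, y, f] &&
         fALL (\<lambda>b. fALL (\<lambda>z. fREL 7 [x, k, b, z, f] ==>> fEQ b a && fEQ z y))))) &&
     fEX (\<lambda>f. fREL 6 [x, k, f] && fALL (\<lambda>a. fALL (\<lambda>y. fNOT (fREL 7 [x, k, a, y, f])))))"

definition fINSIDE :: "nat \<Rightarrow> nat \<Rightarrow> nat \<Rightarrow> nat \<Rightarrow> nat \<Rightarrow> nat \<Rightarrow> form" where
  "fINSIDE m r x k a y = (fREL 1 [x, a, y] && fALL (\<lambda>f. fALLW m r k a y f ==>> fREL 6 [x, k, f]))"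

definition fOVER :: "nat \<Rightarrow> nat \<Rightarrow> nat \<Rightarrow> nat \<Rightarrow> form" where
  "fOVER m r x k = (fALL (\<lambda>f. fREL 6 [x, k, f] ==>> fOUT m r k f && fNOT (fUNB m r f)) &&
     fALL (\<lambda>f. fREL 6 [x, k, f] ==>> fEX (\<lambda>a. fEX (\<lambda>y. fINSIDE m r x k a y && fREL 7 [x, k, a, y, f] &&
       fALL (\<lambda>g. fREL 7 [x, k, a, y, g] ==>> fEQ g f)))) &&
     fEX (\<lambda>a. fEX (\<lambda>y. fINSIDE m r x k a y && fALL (\<lambda>f. fNOT (fREL 7 [x, k, a, y, f])))))"

definition fCEX :: "nat \<Rightarrow> nat \<Rightarrow> nat \<Rightarrow> nat \<Rightarrow> nat \<Rightarrow> nat \<Rightarrow> form" where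
  "fCEX n m r n' m' r' = (fALL (\<lambda>x. fALL (\<lambda>h. fREL 2 [x, h] ==>> fCEX_H n m r x h)) &&
     fALL (\<lambda>x. fALL (\<lambda>k. fREL 4 [x, k] ==>>
       fALL (\<lambda>a. fALL (\<lambda>y. fREL 1 [x, a, y] ==>> fLT y x)) &&
       (fREL 5 [x, k] ==>> fUNDER m' r' x k) && (fNOT (fREL 5 [x, k]) ==>> fOVER m' r' x k))) &&
     fEX (\<lambda>x. fEX (\<lambda>h. fREL 2 [x, h]) && fALL (\<lambda>k. fLT k n' ==>> fREL 4 [x, k])))"

definition fALL2 :: "(nat \<Rightarrow> nat \<Rightarrow> form) \<Rightarrow> form" where
  "fALL2 F = fALL (\<lambda>x. fALL (\<lambda>y. F x y))"

text \<open>The parse is quantified universally: it is determined by the input, and an input that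
  does not parse satisfies the formula vacuously. The conjunct with \<open>fIN q'\<close> says that
  nothing follows the second code.\<close>

definition fMAIN :: "nat list \<Rightarrow> form" where
  "fMAIN ls = (fPOS && fALL2 (\<lambda>p q. fALL2 (\<lambda>n m. fALL2 (\<lambda>r n'. fALL2 (\<lambda>m' r'. fALL (\<lambda>q'.
     fZERO p && fCODE ls p n m r q && fCODE ls q n' m' r' q' && fNOT (fIN q') ==>>
     fCEX n m r n' m' r'))))))"

definition arity :: "nat \<Rightarrow> nat" where
  "arity i = [3, 3, 2, 5, 2, 2, 3, 5] ! i"

section \<open>Scopes and arities of the formulas\<close>

definition wfF :: "nat \<Rightarrow> form \<Rightarrow> bool" where
  "wfF k F \<longleftrightarrow> wf_fm arity 8 k (F k)"

lemma wfF_basic [simp]: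
  "wfF k (fEX F) \<longleftrightarrow> wfF (Suc k) (F k)"
  "wfF k (a && b) \<longleftrightarrow> wfF k a \<and> wfF k b"
  "wfF k (fNOT a) \<longleftrightarrow> wfF k a"
  "wfF k (fREL i xs) \<longleftrightarrow> i < 8 \<and> length xs = arity i \<and> (\<forall>x \<in> set xs. x < k)"
  "wfF k (fBIT v x) \<longleftrightarrow> x < k"
  "wfF k (fADD x y z) \<longleftrightarrow> x < k \<and> y < k \<and> z < k"
  by (simp_all add: wfF_def fEX_def fAND_def fNOT_def fREL_def fBIT_def fADD_def)

lemma wfF_derived [simp]:
  "wfF k (a ==>> b) \<longleftrightarrow> wfF k a \<and> wfF k b"
  "wfF k (fOR a b) \<longleftrightarrow> wfF k a \<and> wfF k b"
  "wfF k (fALL F) \<longleftrightarrow> wfF (Suc k) (F k)"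
  "wfF k (fALL2 F') \<longleftrightarrow> wfF (Suc (Suc k)) (F' k (Suc k))"
  by (simp_all add: fIMP_def fOR_def fALL_def fALL2_def)

lemma wfF_arith [simp]:
  "x < k \<Longrightarrow> wfF k (fZERO x)"
  "x < k \<Longrightarrow> y < k \<Longrightarrow> wfF k (fEQ x y)"
  "x < k \<Longrightarrow> y < k \<Longrightarrow> wfF k (fLE x y)"
  by (simp_all add: fZERO_def fEQ_def fLE_def)

lemma wfF_LT [simp]: "x < k \<Longrightarrow> y < k \<Longrightarrow> wfF k (fLT x y)"
  by (simp add: fLT_def)

lemma wfF_ONE [simp]: "x < k \<Longrightarrow> wfF k (fONE x)"
  by (simp add: fONE_def)

lemma wfF_SUC [simp]: "x < k \<Longrightarrow> y < k \<Longrightarrow> wfF k (fSUC x y)"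
  by (simp add: fSUC_def)

lemma wfF_CONST [simp]: "x < k \<Longrightarrow> wfF k (fCONST n x)"
  by (induction n arbitrary: x k) simp_all

lemma wfF_MEM [simp]: "x < k \<Longrightarrow> wfF k (fMEM ns x)"
  by (induction ns) simp_all

lemma wfF_UN [simp]: "p < k \<Longrightarrow> v < k \<Longrightarrow> q < k \<Longrightarrow> wfF k (fUN p v q)"
  by (simp add: fUN_def)

lemma wfF_IN [simp]: "x < k \<Longrightarrow> wfF k (fIN x)"
  by (simp add: fIN_def)

lemma wfF_EDGE [simp]:
  "p < k \<Longrightarrow> s < k \<Longrightarrow> t < k \<Longrightarrow> l < k \<Longrightarrow> b < k \<Longrightarrow> q < k \<Longrightarrow> wfF k (fEDGE p s t l b q)"
  by (simp add: fEDGE_def)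

lemma arity_simps [simp]:
  "arity 0 = 3" "arity 1 = 3" "arity (Suc 0) = 3" "arity 2 = 2" "arity 3 = 5" "arity 4 = 2" "arity 5 = 2"
  "arity 6 = 3" "arity 7 = 5"
  by (simp_all add: arity_def)

lemma wfF_parse [simp]:
  "m < k \<Longrightarrow> r < k \<Longrightarrow> f < k \<Longrightarrow> s < k \<Longrightarrow> t < k \<Longrightarrow> l < k \<Longrightarrow> wfF k (fEDAT m r f s t l)"
  "m < k \<Longrightarrow> r < k \<Longrightarrow> f < k \<Longrightarrow> wfF k (fREQ m r f)"
  "m < k \<Longrightarrow> r < k \<Longrightarrow> f < k \<Longrightarrow> wfF k (fUNB m r f)"
  "p < k \<Longrightarrow> n < k \<Longrightarrow> m < k \<Longrightarrow> r < k \<Longrightarrow> q < k \<Longrightarrow> wfF k (fCODE ls p n m r q)"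
  "wfF k fPOS"
  by (simp_all add: fEDAT_def fREQ_def fUNB_def fCODE_def fPOS_def fNEXT_def Let_def)

lemma wfF_out [simp]:
  "m < k' \<Longrightarrow> r < k' \<Longrightarrow> k < k' \<Longrightarrow> f < k' \<Longrightarrow> wfF k' (fOUT m r k f)"
  "m < k' \<Longrightarrow> r < k' \<Longrightarrow> k < k' \<Longrightarrow> a < k' \<Longrightarrow> y < k' \<Longrightarrow> f < k' \<Longrightarrow> wfF k' (fALLW m r k a y f)"
  by (simp_all add: fOUT_def fALLW_def)

lemma wfF_INSIDE [simp]:
  "m < k' \<Longrightarrow> r < k' \<Longrightarrow> x < k' \<Longrightarrow> k < k' \<Longrightarrow> a < k' \<Longrightarrow> y < k' \<Longrightarrow> wfF k' (fINSIDE m r x k a y)"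
  by (simp add: fINSIDE_def)

lemma wfF_evidence [simp]:
  "n < k' \<Longrightarrow> m < k' \<Longrightarrow> r < k' \<Longrightarrow> x < k' \<Longrightarrow> k < k' \<Longrightarrow> wfF k' (fCEX_H n m r x k)"
  "m < k' \<Longrightarrow> r < k' \<Longrightarrow> x < k' \<Longrightarrow> k < k' \<Longrightarrow> wfF k' (fUNDER m r x k)"
  "m < k' \<Longrightarrow> r < k' \<Longrightarrow> x < k' \<Longrightarrow> k < k' \<Longrightarrow> wfF k' (fOVER m r x k)"
  by (simp_all add: fCEX_H_def fUNDER_def fOVER_def)

lemma wf_MAIN: "wf_fm arity 8 0 (fMAIN ls 0)"
proof -
  have "wfF 0 (fMAIN ls)" by (simp add: fMAIN_def fCEX_def)
  then show ?thesis by (simp add: wfF_def)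
qed

section \<open>Meaning of the arithmetic and parsing formulas\<close>

lemma ulen_char:
  "p + v < length w \<and> \<not> w ! (p + v) \<and> (\<forall>z. p \<le> z \<and> z < p + v \<longrightarrow> w ! z) \<longleftrightarrow>
    v = ulen w p \<and> after w p \<le> length w"
proof
  assume *: "p + v < length w \<and> \<not> w ! (p + v) \<and> (\<forall>z. p \<le> z \<and> z < p + v \<longrightarrow> w ! z)"
  have "v \<le> ulen w p"
    unfolding ulen_def using * by (intro length_takeWhile_less_P_nth) (auto simp: less_diff_conv)
  moreover have "\<not> v < ulen w p"
  proof
    assume "v < ulen w p"
    then have l: "v < length (takeWhile (\<lambda>b. b) (drop p w))" by (simp add: ulen_def)
    have "takeWhile (\<lambda>b. b) (drop p w) ! v = w ! (p + v)"
      using takeWhile_nth[OF l] * by simp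
    then show False using set_takeWhileD[OF nth_mem[OF l]] * by simp
  qed
  ultimately show "v = ulen w p \<and> after w p \<le> length w" using * by (auto simp: after_def)
next
  assume *: "v = ulen w p \<and> after w p \<le> length w"
  then have d: "drop p w = unary v @ drop (after w p) w" using drop_ulen by blast
  have v: "p + v < length w" using * by (simp add: after_def)
  have "w ! (p + i) = (unary v @ drop (after w p) w) ! i" if "i \<le> v" for i
    using nth_drop[of p w i] v d by simp
  then have i: "w ! (p + i) = (i < v)" if "i \<le> v" for i
    using that by (simp add: unary_def nth_append)
  then show "p + v < length w \<and> \<not> w ! (p + v) \<and> (\<forall>z. p \<le> z \<and> z < p + v \<longrightarrow> w ! z)"
  proof (intro conjI allI impI)
    show "\<not> w ! (p + v)" using i[of v] by simp
    fix z assume z: "p \<le> z \<and> z < p + v"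
    then have "z - p < v" by linarith
    then show "w ! z" using i[of "z - p"] z by simp
  qed (rule v)
qed

text \<open>\<open>pos\<close> yields a position even on garbage; here the edge codes passed on the
  way must be well formed.\<close>

definition steps :: "bool list \<Rightarrow> nat \<Rightarrow> nat \<Rightarrow> nat \<Rightarrow> bool" where
  "steps w p i q \<longleftrightarrow> q = pos w p i \<and> (\<forall>j < i. is_edge w (pos w p j))"

text \<open>The bound puts every position of \<open>w\<close>, the one just past its end, and the
  number 1 into the universe.\<close>

locale model =
  fixes N :: nat and w :: "bool list" and I :: "nat \<Rightarrow> nat list \<Rightarrow> bool"
  assumes wN: "length w + 1 < N"
begin

definition sem :: "nat list \<Rightarrow> form \<Rightarrow> bool" where
  "sem e F \<longleftrightarrow> sat N w I e (F (length e))"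

definition ok :: "nat list \<Rightarrow> bool" where
  "ok e \<longleftrightarrow> (\<forall>x \<in> set e. x < N)"

lemma ok_append [simp]: "ok (e @ xs) \<longleftrightarrow> ok e \<and> (\<forall>x \<in> set xs. x < N)"
  by (auto simp: ok_def)

lemma ok_nth: "ok e \<Longrightarrow> x < length e \<Longrightarrow> e ! x < N"
  by (simp add: ok_def)

lemma nth_old [simp]: "x < length e \<Longrightarrow> (e @ xs) ! x = e ! x"
  and nth_new [simp]: "(e @ a # xs) ! length e = a" "(e @ a # b # xs) ! Suc (length e) = b"
    "(e @ a # b # c # xs) ! Suc (Suc (length e)) = c"
    "(e @ a # b # c # d # xs) ! Suc (Suc (Suc (length e))) = d"
    "(e @ a # b # c # d # f # xs) ! Suc (Suc (Suc (Suc (length e)))) = f"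
    "(e @ a # b # c # d # f # g # xs) ! Suc (Suc (Suc (Suc (Suc (length e))))) = g"
    "(e @ a # b # c # d # f # g # h # xs) ! Suc (Suc (Suc (Suc (Suc (Suc (length e)))))) = h"
    "(e @ a # b # c # d # f # g # h # i # xs) ! Suc (Suc (Suc (Suc (Suc (Suc (Suc (length e))))))) = i"
    "(e @ a # b # c # d # f # g # h # i # j # xs) !
      Suc (Suc (Suc (Suc (Suc (Suc (Suc (Suc (length e)))))))) = j"
  by (simp_all add: nth_append)

lemma sem_basic [simp]:
  "sem e (fEX F) \<longleftrightarrow> (\<exists>v < N. sem (e @ [v]) (F (length e)))"
  "sem e (a && b) \<longleftrightarrow> sem e a \<and> sem e b"
  "sem e (fNOT a) \<longleftrightarrow> \<not> sem e a"
  "sem e (fREL i xs) \<longleftrightarrow> I i (map (nth e) xs)"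
  "sem e (fBIT v x) \<longleftrightarrow> e ! x < length w \<and> w ! (e ! x) = v"
  "sem e (fADD x y z) \<longleftrightarrow> e ! x + e ! y = e ! z"
  "sem e (a ==>> b) \<longleftrightarrow> (sem e a \<longrightarrow> sem e b)"
  "sem e (fOR a b) \<longleftrightarrow> sem e a \<or> sem e b"
  "sem e (fALL F) \<longleftrightarrow> (\<forall>v < N. sem (e @ [v]) (F (length e)))"
  by (simp_all add: sem_def fEX_def fAND_def fNOT_def fREL_def fBIT_def fADD_def fIMP_def fOR_def fALL_def)

lemma sem_ALL2 [simp]:
  "sem e (fALL2 F) \<longleftrightarrow> (\<forall>u < N. \<forall>v < N. sem (e @ [u, v]) (F (length e) (Suc (length e))))"
  by (simp add: fALL2_def)

lemma sem_ZERO [simp]: "sem e (fZERO x) \<longleftrightarrow> e ! x = 0"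
  by (simp add: fZERO_def)

lemma sem_EQ [simp]: "x < length e \<Longrightarrow> y < length e \<Longrightarrow> sem e (fEQ x y) \<longleftrightarrow> e ! x = e ! y"
  using wN by (auto simp: fEQ_def intro!: exI[of _ 0])

lemma sem_LE [simp]: "ok e \<Longrightarrow> x < length e \<Longrightarrow> y < length e \<Longrightarrow> sem e (fLE x y) \<longleftrightarrow> e ! x \<le> e ! y"
  using ok_nth[of e y] by (auto simp: fLE_def intro!: exI[of _ "e ! y - e ! x"])

lemma sem_LT [simp]: "ok e \<Longrightarrow> x < length e \<Longrightarrow> y < length e \<Longrightarrow> sem e (fLT x y) \<longleftrightarrow> e ! x < e ! y"
  by (auto simp: fLT_def)

lemma sem_ONE [simp]: "ok e \<Longrightarrow> x < length e \<Longrightarrow> sem e (fONE x) \<longleftrightarrow> e ! x = 1"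
proof -
  assume e: "ok e" "x < length e"
  have "e ! x \<le> 1" if "\<forall>v < N. v < e ! x \<longrightarrow> v = 0"
    using that[rule_format, of 1] wN by linarith
  then have "(\<forall>v < N. v < e ! x \<longrightarrow> v = 0) \<longleftrightarrow> e ! x \<le> 1" by auto
  then show ?thesis using e by (auto simp: fONE_def)
qed

lemma sem_SUC [simp]:
  "ok e \<Longrightarrow> x < length e \<Longrightarrow> y < length e \<Longrightarrow> sem e (fSUC x y) \<longleftrightarrow> e ! y = Suc (e ! x)"
  using wN by (auto simp: fSUC_def cong: conj_cong)

lemma sem_CONST [simp]: "ok e \<Longrightarrow> x < length e \<Longrightarrow> sem e (fCONST n x) \<longleftrightarrow> e ! x = n"
proof (induction n arbitrary: e x)
  case (Suc n)
  have "e ! x < N" using ok_nth Suc.prems by blast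
  then show ?case using Suc by (auto cong: conj_cong)
qed simp

lemma sem_MEM [simp]: "ok e \<Longrightarrow> x < length e \<Longrightarrow> sem e (fMEM ns x) \<longleftrightarrow> e ! x \<in> set ns"
  by (induction ns) auto

lemma sem_IN [simp]: "sem e (fIN x) \<longleftrightarrow> e ! x < length w"
  by (auto simp: fIN_def)

lemma sem_UN [simp]:
  assumes "ok e" "p < length e" "v < length e" "q < length e"
  shows "sem e (fUN p v q) \<longleftrightarrow>
    e ! v = ulen w (e ! p) \<and> e ! q = after w (e ! p) \<and> after w (e ! p) \<le> length w"
proof -
  have "sem e (fUN p v q) \<longleftrightarrow> e ! q = Suc (e ! p + e ! v) \<and> e ! p + e ! v < length w \<and>
      \<not> w ! (e ! p + e ! v) \<and> (\<forall>z. e ! p \<le> z \<and> z < e ! p + e ! v \<longrightarrow> w ! z)"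
    unfolding fUN_def using assms wN by (auto cong: conj_cong)
  then show ?thesis using ulen_char[of "e ! p" "e ! v" w] by (auto simp: after_def)
qed

lemma sem_EDGE [simp]:
  assumes "ok e" "p < length e" "s < length e" "t < length e" "l < length e" "b < length e" "q < length e"
  shows "sem e (fEDGE p s t l b q) \<longleftrightarrow> is_edge w (e ! p) \<and> e ! s = ulen w (e ! p) \<and>
    e ! t = ulen w (fld2 w (e ! p)) \<and> e ! l = ulen w (fld3 w (e ! p)) \<and> e ! b = fldb w (e ! p) \<and>
    e ! q = fldb w (e ! p) + 2"
proof -
  have "sem e (fEDGE p s t l b q) \<longleftrightarrow> (\<exists>p1 < N. e ! s = ulen w (e ! p) \<and> p1 = after w (e ! p) \<and>
      after w (e ! p) \<le> length w \<and> (\<exists>p2 < N. e ! t = ulen w p1 \<and> p2 = after w p1 \<and> after w p1 \<le> length w \<and>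
      e ! l = ulen w p2 \<and> e ! b = after w p2 \<and> after w p2 \<le> length w \<and>
      (\<exists>b1 < N. b1 = Suc (e ! b) \<and> e ! q = Suc b1 \<and> b1 < length w)))"
    unfolding fEDGE_def using assms by (simp cong: conj_cong)
  also have "\<dots> \<longleftrightarrow> is_edge w (e ! p) \<and> e ! s = ulen w (e ! p) \<and>
    e ! t = ulen w (fld2 w (e ! p)) \<and> e ! l = ulen w (fld3 w (e ! p)) \<and> e ! b = fldb w (e ! p) \<and>
    e ! q = fldb w (e ! p) + 2"
    using wN after_gt[of "e ! p" w] after_gt[of "fld2 w (e ! p)" w] after_gt[of "fld3 w (e ! p)" w]
    unfolding is_edge_def by auto
  finally show ?thesis .
qed

end

lemma code_end_le:
  assumes "valid \<Sigma> c w p"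
  shows "code_end w p \<le> length w"
proof (cases "ulen w (fld2 w p)")
  case 0
  then show ?thesis using assms by (simp add: code_end_def pos_simps valid_def)
next
  case (Suc i)
  then have "is_edge w (pos w (fld3 w p) i)" using assms unfolding valid_def by simp
  then show ?thesis unfolding code_end_def Suc pos_simps is_edge_def by simp
qed

context model begin

lemma edge_bounds:
  assumes "is_edge w x"
  shows "x < N" "ulen w x < N" "ulen w (fld2 w x) < N" "ulen w (fld3 w x) < N" "fldb w x < N"
    "fldb w x + 2 < N" "fldb w x + 1 < length w"
  using fields_less[OF assms] assms wN unfolding is_edge_def by linarith+

lemma sem_NEXT [simp]:
  assumes "ok e" "x < length e" "q < length e"
  shows "sem e (fNEXT x q) \<longleftrightarrow> is_edge w (e ! x) \<and> e ! q = fldb w (e ! x) + 2"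
proof -
  have "sem e (fNEXT x q) \<longleftrightarrow> (\<exists>s < N. \<exists>t < N. \<exists>l < N. \<exists>b < N. is_edge w (e ! x) \<and> s = ulen w (e ! x) \<and>
      t = ulen w (fld2 w (e ! x)) \<and> l = ulen w (fld3 w (e ! x)) \<and> b = fldb w (e ! x) \<and>
      e ! q = fldb w (e ! x) + 2)"
    unfolding fNEXT_def using assms by (simp cong: conj_cong)
  then show ?thesis using edge_bounds[of "e ! x"] by blast
qed

text \<open>Bounding \<open>j\<close> and \<open>x\<close> loses nothing: \<open>j\<close> is less
  than \<open>i\<close>, and an edge code that starts at \<open>x\<close> lies inside
  \<open>w\<close>.\<close>

lemma steps_rec:
  assumes "i < N"
  shows "steps w p i q \<longleftrightarrow> (i = 0 \<and> q = p) \<or>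
    (\<exists>j < N. i = Suc j \<and> (\<exists>x < N. steps w p j x \<and> is_edge w x \<and> q = fldb w x + 2))"
proof (cases i)
  case (Suc k)
  have "steps w p (Suc k) q \<longleftrightarrow> (\<exists>x. steps w p k x \<and> is_edge w x \<and> q = fldb w x + 2)"
    unfolding steps_def pos_simps by (auto simp: less_Suc_eq)
  then show ?thesis using Suc assms edge_bounds(1) by auto
qed (simp add: steps_def pos_simps)

text \<open>The formula is a recursion on \<open>i\<close>, so it has exactly one solution below
  \<open>N\<close>. A guessed relation that satisfies it must be the true parse.\<close>

lemma sem_POS: "sem [] fPOS \<longleftrightarrow> (\<forall>p < N. \<forall>i < N. \<forall>q < N. I 0 [p, i, q] \<longleftrightarrow> steps w p i q)"
proof -
  let ?rec = "\<lambda>R p i q. (i = 0 \<and> q = p) \<or> (\<exists>j < N. i = Suc j \<and> (\<exists>x < N. R j x \<and> is_edge w x \<and> q = fldb w x + 2))"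
  have "sem [] fPOS \<longleftrightarrow> (\<forall>p < N. \<forall>i < N. \<forall>q < N. I 0 [p, i, q] \<longleftrightarrow> ?rec (\<lambda>j x. I 0 [p, j, x]) p i q)"
  proof -
    have "sem [p, i, q] (fOR (fZERO 1 && fEQ 2 0) (fEX (\<lambda>j. fSUC j 1 && fEX (\<lambda>x. fREL 0 [0, j, x] && fNEXT x 2))))
      \<longleftrightarrow> ?rec (\<lambda>j x. I 0 [p, j, x]) p i q" if "p < N" "i < N" "q < N" for p i q
      using that by (simp add: ok_def numeral_2_eq_2 cong: conj_cong)
    then show ?thesis unfolding fPOS_def Let_def
      by (simp add: numeral_2_eq_2 cong: conj_cong imp_cong) blast
  qed
  also have "\<dots> \<longleftrightarrow> (\<forall>p < N. \<forall>i < N. \<forall>q < N. I 0 [p, i, q] \<longleftrightarrow> steps w p i q)"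
  proof
    assume *: "\<forall>p < N. \<forall>i < N. \<forall>q < N. I 0 [p, i, q] \<longleftrightarrow> ?rec (\<lambda>j x. I 0 [p, j, x]) p i q"
    have "\<forall>q < N. I 0 [p, i, q] \<longleftrightarrow> steps w p i q" if p: "p < N" and i: "i < N" for p i
      using i
    proof (induction i)
      case 0
      then show ?case using * p by (simp add: steps_def pos_simps)
    next
      case (Suc i)
      have IH: "\<forall>q < N. I 0 [p, i, q] \<longleftrightarrow> steps w p i q" using Suc by simp
      have "I 0 [p, Suc i, q] \<longleftrightarrow> (\<exists>x < N. I 0 [p, i, x] \<and> is_edge w x \<and> q = fldb w x + 2)" if "q < N" for q
        using * p Suc.prems that by simp
      then show ?case using IH Suc.prems steps_rec[OF Suc.prems] by auto
    qed
    then show "\<forall>p < N. \<forall>i < N. \<forall>q < N. I 0 [p, i, q] \<longleftrightarrow> steps w p i q" by blast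
  next
    assume *: "\<forall>p < N. \<forall>i < N. \<forall>q < N. I 0 [p, i, q] \<longleftrightarrow> steps w p i q"
    show "\<forall>p < N. \<forall>i < N. \<forall>q < N. I 0 [p, i, q] \<longleftrightarrow> ?rec (\<lambda>j x. I 0 [p, j, x]) p i q"
    proof (intro allI impI)
      fix p i q assume b: "p < N" "i < N" "q < N"
      then have "I 0 [p, i, q] \<longleftrightarrow> ?rec (\<lambda>j x. steps w p j x) p i q" using * steps_rec by simp
      also have "\<dots> \<longleftrightarrow> ?rec (\<lambda>j x. I 0 [p, j, x]) p i q" using * b(1) by (simp cong: conj_cong)
      finally show "I 0 [p, i, q] \<longleftrightarrow> ?rec (\<lambda>j x. I 0 [p, j, x]) p i q" .
    qed
  qed
  finally show ?thesis .
qed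

end

section \<open>Meaning of the formulas about the decoded graphs\<close>

locale parsed = model N w I for N w I +
  fixes \<Sigma> :: "'l set" and c :: "'l \<Rightarrow> nat" and ls :: "nat list"
  assumes ls: "set ls = c ` \<Sigma>"
    and I0: "\<And>p i q. p < N \<Longrightarrow> i < N \<Longrightarrow> q < N \<Longrightarrow> I 0 [p, i, q] \<longleftrightarrow> steps w p i q"
begin

lemma sem_CODE:
  assumes e: "ok e" "p < length e" "n < length e" "m < length e" "r < length e" "q < length e"
  shows "sem e (fCODE ls p n m r q) \<longleftrightarrow> valid \<Sigma> c w (e ! p) \<and> e ! n = ulen w (e ! p) \<and>
    e ! m = ulen w (fld2 w (e ! p)) \<and> e ! r = fld3 w (e ! p) \<and> e ! q = code_end w (e ! p)"
proof -
  let ?p = "e ! p" and ?n = "e ! n" and ?m = "e ! m" and ?r = "e ! r" and ?q = "e ! q"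
  have lt: "?r < N" "?m < N" "?q < N" using e ok_nth by auto
  define Q where "Q = (\<lambda>x. is_edge w x \<and> ulen w x < ?n \<and> ulen w (fld2 w x) < ?n \<and> ulen w (fld3 w x) \<in> c ` \<Sigma>)"
  have inner: "(\<exists>s < N. \<exists>t < N. \<exists>l < N. \<exists>b < N. \<exists>y < N. (is_edge w x \<and> s = ulen w x \<and> t = ulen w (fld2 w x) \<and>
      l = ulen w (fld3 w x) \<and> b = fldb w x \<and> y = fldb w x + 2) \<and> s < ?n \<and> t < ?n \<and> l \<in> c ` \<Sigma>) \<longleftrightarrow> Q x" for x
    unfolding Q_def using edge_bounds[of x] by auto
  have "sem e (fCODE ls p n m r q) \<longleftrightarrow> (\<exists>p1 < N. (?n = ulen w ?p \<and> p1 = after w ?p \<and> after w ?p \<le> length w) \<and>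
      (?m = ulen w p1 \<and> ?r = after w p1 \<and> after w p1 \<le> length w) \<and> steps w ?r ?m ?q \<and>
      (\<forall>i < N. i < ?m \<longrightarrow> (\<exists>x < N. steps w ?r i x \<and> (\<exists>s < N. \<exists>t < N. \<exists>l < N. \<exists>b < N. \<exists>y < N.
        (is_edge w x \<and> s = ulen w x \<and> t = ulen w (fld2 w x) \<and> l = ulen w (fld3 w x) \<and> b = fldb w x \<and>
         y = fldb w x + 2) \<and> s < ?n \<and> t < ?n \<and> l \<in> c ` \<Sigma>))))"
    unfolding fCODE_def using e lt by (simp add: ls I0 cong: conj_cong)
  also have "\<dots> \<longleftrightarrow> (\<exists>p1 < N. (?n = ulen w ?p \<and> p1 = after w ?p \<and> after w ?p \<le> length w) \<and>
      (?m = ulen w p1 \<and> ?r = after w p1 \<and> after w p1 \<le> length w) \<and> steps w ?r ?m ?q \<and>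
      (\<forall>i < N. i < ?m \<longrightarrow> (\<exists>x < N. steps w ?r i x \<and> Q x)))"
    by (simp only: inner)
  also have "\<dots> \<longleftrightarrow> after w ?p < N \<and> ?n = ulen w ?p \<and> after w ?p \<le> length w \<and> ?m = ulen w (fld2 w ?p) \<and>
      ?r = fld3 w ?p \<and> fld3 w ?p \<le> length w \<and> steps w ?r ?m ?q \<and>
      (\<forall>i < N. i < ?m \<longrightarrow> (\<exists>x < N. steps w ?r i x \<and> Q x))"
    by auto
  also have "\<dots> \<longleftrightarrow> valid \<Sigma> c w ?p \<and> ?n = ulen w ?p \<and> ?m = ulen w (fld2 w ?p) \<and> ?r = fld3 w ?p \<and>
      ?q = code_end w ?p" (is "?L \<longleftrightarrow> ?R")
  proof
    assume L: ?L
    then have 1: "?n = ulen w ?p" "?m = ulen w (fld2 w ?p)" "?r = fld3 w ?p" "fld3 w ?p \<le> length w"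
      by (elim conjE; simp)+
    have s: "steps w ?r ?m ?q" using L by (elim conjE)
    have i: "\<exists>x. steps w ?r i x \<and> Q x" if "i < N" "i < ?m" for i
      using L that by blast
    have "is_edge w (pos w ?r i) \<and> ulen w (pos w ?r i) < ?n \<and> ulen w (fld2 w (pos w ?r i)) < ?n \<and>
        ulen w (fld3 w (pos w ?r i)) \<in> c ` \<Sigma>" if "i < ?m" for i
      using i[of i] that lt(2) unfolding steps_def Q_def by auto
    then show ?R using 1 s unfolding valid_def steps_def code_end_def by simp
  next
    assume R: ?R
    then have v: "fld3 w ?p \<le> length w" "\<And>i. i < ?m \<Longrightarrow> is_edge w (pos w ?r i) \<and> ulen w (pos w ?r i) < ?n \<and>
        ulen w (fld2 w (pos w ?r i)) < ?n \<and> ulen w (fld3 w (pos w ?r i)) \<in> c ` \<Sigma>"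
      unfolding valid_def by auto
    have "steps w ?r i (pos w ?r i)" if "i \<le> ?m" for i using v(2) that unfolding steps_def by auto
    then have s: "steps w ?r ?m ?q" "\<And>i. i < ?m \<Longrightarrow> steps w ?r i (pos w ?r i)"
      using R unfolding code_end_def by auto
    have "\<exists>x < N. steps w ?r i x \<and> Q x" if "i < ?m" for i
      using s(2)[OF that] v(2)[OF that] edge_bounds(1)[of "pos w ?r i"] unfolding Q_def by blast
    moreover have "after w ?p < N" "after w ?p \<le> length w"
      using v(1) after_gt[of "fld2 w ?p" w] wN by linarith+
    ultimately show ?L using R v(1) s(1) by auto
  qed
  finally show ?thesis .
qed

end

text \<open>\<open>n\<close>, \<open>m\<close> and \<open>r\<close> are indices of variables;
  \<open>binds\<close> says that they hold the parse of the graph at position \<open>p\<close>. The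
  formulas are interpreted for one graph at a time, so the same lemmas serve \<open>H\<close> and
  \<open>K\<close>.\<close>

locale bound_graph = parsed N w I \<Sigma> c ls for N w I and \<Sigma> :: "'l set" and c ls +
  fixes n m r p :: nat
  assumes valid: "valid \<Sigma> c w p"
begin

abbreviation "gr \<equiv> dec \<Sigma> c w p"

definition binds :: "nat list \<Rightarrow> bool" where
  "binds e \<longleftrightarrow> ok e \<and> n < length e \<and> m < length e \<and> r < length e \<and> e ! n = ulen w p \<and>
     e ! m = ulen w (fld2 w p) \<and> e ! r = fld3 w p"

lemma binds_append [simp]: "binds e \<Longrightarrow> binds (e @ xs) \<longleftrightarrow> (\<forall>x \<in> set xs. x < N)"
  by (auto simp: binds_def)

lemma bindsD [simp]: "binds e \<Longrightarrow> ok e" "binds e \<Longrightarrow> n < length e" "binds e \<Longrightarrow> m < length e"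
  "binds e \<Longrightarrow> r < length e" "binds e \<Longrightarrow> e ! n = ulen w p" "binds e \<Longrightarrow> e ! m = ulen w (fld2 w p)"
  "binds e \<Longrightarrow> e ! r = fld3 w p"
  by (simp_all add: binds_def)

lemma edge_valid:
  assumes "f < ulen w (fld2 w p)"
  shows "is_edge w (pos w (fld3 w p) f)" "ulen w (fld3 w (pos w (fld3 w p) f)) \<in> c ` \<Sigma>"
    "steps w (fld3 w p) f x \<longleftrightarrow> x = pos w (fld3 w p) f" "fld3 w p < N" "f < N"
proof -
  show "is_edge w (pos w (fld3 w p) f)" "ulen w (fld3 w (pos w (fld3 w p) f)) \<in> c ` \<Sigma>"
    using valid assms unfolding valid_def by blast+
  show "steps w (fld3 w p) f x \<longleftrightarrow> x = pos w (fld3 w p) f"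
    using valid assms unfolding valid_def steps_def by auto
  show "fld3 w p < N" using valid wN unfolding valid_def by simp
  show "f < N" using small_dec(1)[OF valid, of N] assms wN unfolding small_def by (auto simp: dec_simps)
qed

lemma sem_EDAT [simp]:
  assumes b: "binds e" and i: "f < length e" "s < length e" "t < length e" "l < length e"
  shows "sem e (fEDAT m r f s t l) \<longleftrightarrow> edat c gr (e ! f) (e ! s) (e ! t) (e ! l)"
proof (cases "e ! f < ulen w (fld2 w p)")
  case True
  note E = edge_valid[OF True] and B = edge_bounds[OF edge_valid(1)[OF True]]
  have "sem e (fEDAT m r f s t l) \<longleftrightarrow> (\<exists>x < N. steps w (fld3 w p) (e ! f) x \<and> (\<exists>b < N. \<exists>y < N.
      is_edge w x \<and> e ! s = ulen w x \<and> e ! t = ulen w (fld2 w x) \<and> e ! l = ulen w (fld3 w x) \<and>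
      b = fldb w x \<and> y = fldb w x + 2))"
    unfolding fEDAT_def using b i True E(4,5) by (simp add: I0 cong: conj_cong)
  also have "\<dots> \<longleftrightarrow> e ! s = ulen w (pos w (fld3 w p) (e ! f)) \<and> e ! t = ulen w (fld2 w (pos w (fld3 w p) (e ! f))) \<and>
      e ! l = ulen w (fld3 w (pos w (fld3 w p) (e ! f)))"
    unfolding E(3) using E(1) B by auto
  also have "\<dots> \<longleftrightarrow> edat c gr (e ! f) (e ! s) (e ! t) (e ! l)"
    using True E(2) unfolding edat_def by (auto simp: dec_simps f_inv_into_f)
  finally show ?thesis .
next
  case False
  then show ?thesis unfolding fEDAT_def using b i by (simp add: edat_def dec_simps)
qed

lemma sem_REQ [simp]:
  assumes b: "binds e" and i: "f < length e"
  shows "sem e (fREQ m r f) \<longleftrightarrow> req gr (e ! f)"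
proof (cases "e ! f < ulen w (fld2 w p)")
  case True
  note E = edge_valid[OF True] and B = edge_bounds[OF edge_valid(1)[OF True]]
  have "sem e (fREQ m r f) \<longleftrightarrow> (\<exists>x < N. steps w (fld3 w p) (e ! f) x \<and> (\<exists>s < N. \<exists>t < N. \<exists>l < N. \<exists>b < N. \<exists>y < N.
      (is_edge w x \<and> s = ulen w x \<and> t = ulen w (fld2 w x) \<and> l = ulen w (fld3 w x) \<and>
      b = fldb w x \<and> y = fldb w x + 2) \<and> b < length w \<and> w ! b))"
    unfolding fREQ_def using b i True E(4,5) by (simp add: I0 cong: conj_cong)
  also have "\<dots> \<longleftrightarrow> w ! fldb w (pos w (fld3 w p) (e ! f))"
    unfolding E(3) using E(1) B by auto
  also have "\<dots> \<longleftrightarrow> req gr (e ! f)" using True by (simp add: req_def dec_simps)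
  finally show ?thesis .
next
  case False
  then show ?thesis unfolding fREQ_def using b i by (simp add: req_def dec_simps)
qed

lemma sem_UNB [simp]:
  assumes b: "binds e" and i: "f < length e"
  shows "sem e (fUNB m r f) \<longleftrightarrow> unb gr (e ! f)"
proof (cases "e ! f < ulen w (fld2 w p)")
  case True
  note E = edge_valid[OF True] and B = edge_bounds[OF edge_valid(1)[OF True]]
  have "sem e (fUNB m r f) \<longleftrightarrow> (\<exists>x < N. steps w (fld3 w p) (e ! f) x \<and> (\<exists>s < N. \<exists>t < N. \<exists>l < N. \<exists>b < N. \<exists>y < N.
      (is_edge w x \<and> s = ulen w x \<and> t = ulen w (fld2 w x) \<and> l = ulen w (fld3 w x) \<and>
      b = fldb w x \<and> y = fldb w x + 2) \<and> (\<exists>b1 < N. b1 = Suc b \<and> b1 < length w \<and> w ! b1)))"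
    unfolding fUNB_def using b i True E(4,5) by (simp add: I0 cong: conj_cong)
  also have "\<dots> \<longleftrightarrow> w ! (fldb w (pos w (fld3 w p) (e ! f)) + 1)"
    unfolding E(3) using E(1) B by auto
  also have "\<dots> \<longleftrightarrow> unb gr (e ! f)" using True by (simp add: unb_def dec_simps)
  finally show ?thesis .
next
  case False
  then show ?thesis unfolding fUNB_def using b i by (simp add: unb_def dec_simps)
qed

lemma sem_OUT [simp]:
  "binds e \<Longrightarrow> k < length e \<Longrightarrow> f < length e \<Longrightarrow> sem e (fOUT m r k f) \<longleftrightarrow> outf c N gr (e ! k) (e ! f)"
  unfolding fOUT_def outf_def by (simp cong: conj_cong)

lemma sem_ALLW [simp]:
  "binds e \<Longrightarrow> k < length e \<Longrightarrow> a < length e \<Longrightarrow> y < length e \<Longrightarrow> f < length e \<Longrightarrow>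
    sem e (fALLW m r k a y f) \<longleftrightarrow> allw c N gr I (e ! k) (e ! a) (e ! y) (e ! f)"
  unfolding fALLW_def allw_def by (simp cong: conj_cong)

lemma sem_INSIDE [simp]:
  "binds e \<Longrightarrow> x < length e \<Longrightarrow> k < length e \<Longrightarrow> a < length e \<Longrightarrow> y < length e \<Longrightarrow>
    sem e (fINSIDE m r x k a y) \<longleftrightarrow> inside c N gr I (e ! x) (e ! k) (e ! a) (e ! y)"
  unfolding fINSIDE_def inside_def by (simp cong: conj_cong)

lemma sem_CEX_H [simp]:
  "binds e \<Longrightarrow> x < length e \<Longrightarrow> h < length e \<Longrightarrow>
    sem e (fCEX_H n m r x h) \<longleftrightarrow> cex_H c N gr I (e ! x) (e ! h)"
  unfolding fCEX_H_def cex_H_def by (simp add: dec_simps cong: conj_cong)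

lemma sem_UNDER [simp]:
  "binds e \<Longrightarrow> x < length e \<Longrightarrow> k < length e \<Longrightarrow>
    sem e (fUNDER m r x k) \<longleftrightarrow> cex_under c N gr I (e ! x) (e ! k)"
  unfolding fUNDER_def cex_under_def by (simp cong: conj_cong)

lemma sem_OVER [simp]:
  "binds e \<Longrightarrow> x < length e \<Longrightarrow> k < length e \<Longrightarrow>
    sem e (fOVER m r x k) \<longleftrightarrow> cex_over c N gr I (e ! x) (e ! k)"
  unfolding fOVER_def cex_over_def by (simp cong: conj_cong)

lemma sem_simulates:
  "binds e \<Longrightarrow> sem e (fALL (\<lambda>x. fALL (\<lambda>h. fREL 2 [x, h] ==>> fCEX_H n m r x h))) \<longleftrightarrow>
    (\<forall>x < N. \<forall>h < N. I 2 [x, h] \<longrightarrow> cex_H c N gr I x h)"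
  by simp

lemma sem_evidence:
  "binds e \<Longrightarrow> sem e (fALL (\<lambda>x. fALL (\<lambda>k. fREL 4 [x, k] ==>>
       fALL (\<lambda>a. fALL (\<lambda>y. fREL 1 [x, a, y] ==>> fLT y x)) &&
       (fREL 5 [x, k] ==>> fUNDER m r x k) && (fNOT (fREL 5 [x, k]) ==>> fOVER m r x k)))) \<longleftrightarrow>
    (\<forall>x < N. \<forall>k < N. I 4 [x, k] \<longrightarrow> (\<forall>a < N. \<forall>y < N. I 1 [x, a, y] \<longrightarrow> y < x) \<and>
        (I 5 [x, k] \<longrightarrow> cex_under c N gr I x k) \<and> (\<not> I 5 [x, k] \<longrightarrow> cex_over c N gr I x k))"
  by simp

lemma sem_root:
  "binds e \<Longrightarrow> sem e (fEX (\<lambda>x. fEX (\<lambda>h. fREL 2 [x, h]) && fALL (\<lambda>k. fLT k n ==>> fREL 4 [x, k]))) \<longleftrightarrow>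
    (\<exists>x < N. (\<exists>h < N. I 2 [x, h]) \<and> (\<forall>k < N. k \<in> nodes gr \<longrightarrow> I 4 [x, k]))"
  by (simp add: dec_simps less_SucI cong: conj_cong)

end

context parsed begin

lemma sem_CEX:
  assumes v: "valid \<Sigma> c w p" "valid \<Sigma> c w q" and e: "ok e"
    "n < length e" "e ! n = ulen w p" "m < length e" "e ! m = ulen w (fld2 w p)"
    "r < length e" "e ! r = fld3 w p"
    "n' < length e" "e ! n' = ulen w q" "m' < length e" "e ! m' = ulen w (fld2 w q)"
    "r' < length e" "e ! r' = fld3 w q"
  shows "sem e (fCEX n m r n' m' r') \<longleftrightarrow> cex c N (dec \<Sigma> c w p) (dec \<Sigma> c w q) I"
proof -
  have H: "bound_graph N w I \<Sigma> c ls p" by unfold_locales (rule v)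
  have K: "bound_graph N w I \<Sigma> c ls q" by unfold_locales (rule v)
  have bH: "bound_graph.binds N w n m r p e"
    unfolding bound_graph.binds_def[OF H] by (intro conjI e)
  have bK: "bound_graph.binds N w n' m' r' q e"
    unfolding bound_graph.binds_def[OF K] by (intro conjI e)
  show ?thesis
    unfolding fCEX_def cex_def sem_basic(2) bound_graph.sem_simulates[OF H bH]
      bound_graph.sem_evidence[OF K bK] bound_graph.sem_root[OF K bK] ..
qed

lemma sem_ALL9:
  "sem [] (fALL2 (\<lambda>p q. fALL2 (\<lambda>n m. fALL2 (\<lambda>r n'. fALL2 (\<lambda>m' r'. fALL (\<lambda>q'. F p q n m r n' m' r' q')))))) \<longleftrightarrow>
    (\<forall>p < N. \<forall>q < N. \<forall>n < N. \<forall>m < N. \<forall>r < N. \<forall>n' < N. \<forall>m' < N. \<forall>r' < N. \<forall>q' < N.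
      sem [p, q, n, m, r, n', m', r', q'] (F 0 1 2 3 4 5 6 7 8))"
  by (simp add: eval_nat_numeral)

lemma sem_MAIN_parsed:
  "sem [] (fMAIN ls) \<longleftrightarrow> sem [] fPOS \<and>
    (valid \<Sigma> c w 0 \<and> valid \<Sigma> c w (code_end w 0) \<and> length w \<le> code_end w (code_end w 0) \<longrightarrow>
     cex c N (dec \<Sigma> c w 0) (dec \<Sigma> c w (code_end w 0)) I)"
proof -
  let ?q = "code_end w 0" and ?q' = "code_end w (code_end w 0)"
  let ?body = "\<lambda>p q n m r n' m' r' q'. p = 0 \<and>
    (valid \<Sigma> c w p \<and> n = ulen w p \<and> m = ulen w (fld2 w p) \<and> r = fld3 w p \<and> q = code_end w p) \<and>
    (valid \<Sigma> c w q \<and> n' = ulen w q \<and> m' = ulen w (fld2 w q) \<and> r' = fld3 w q \<and> q' = code_end w q) \<and>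
    \<not> q' < length w"
  have 1: "sem [p, q, n, m, r, n', m', r', q'] (fZERO 0 && fCODE ls 0 2 3 4 1 && fCODE ls 1 5 6 7 8 &&
      fNOT (fIN 8) ==>> fCEX 2 3 4 5 6 7) \<longleftrightarrow>
    (?body p q n m r n' m' r' q' \<longrightarrow> cex c N (dec \<Sigma> c w p) (dec \<Sigma> c w q) I)"
    if "p < N" "q < N" "n < N" "m < N" "r < N" "n' < N" "m' < N" "r' < N" "q' < N" for p q n m r n' m' r' q'
  proof -
    let ?e = "[p, q, n, m, r, n', m', r', q']"
    have e: "ok ?e" using that by (simp add: ok_def)
    have A: "sem ?e (fZERO 0 && fCODE ls 0 2 3 4 1 && fCODE ls 1 5 6 7 8 && fNOT (fIN 8)) \<longleftrightarrow>
        ?body p q n m r n' m' r' q'"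
      using e by (simp add: sem_CODE)
    have B: "sem ?e (fCEX 2 3 4 5 6 7) \<longleftrightarrow> cex c N (dec \<Sigma> c w p) (dec \<Sigma> c w q) I"
      if "?body p q n m r n' m' r' q'"
      by (rule sem_CEX) (use that e in auto)
    show ?thesis unfolding sem_basic(7) A by (rule imp_cong[OF refl]) (rule B)
  qed
  have "sem [] (fMAIN ls) \<longleftrightarrow> sem [] fPOS \<and> (\<forall>p < N. \<forall>q < N. \<forall>n < N. \<forall>m < N. \<forall>r < N. \<forall>n' < N. \<forall>m' < N.
      \<forall>r' < N. \<forall>q' < N. sem [p, q, n, m, r, n', m', r', q'] (fZERO 0 && fCODE ls 0 2 3 4 1 &&
        fCODE ls 1 5 6 7 8 && fNOT (fIN 8) ==>> fCEX 2 3 4 5 6 7))"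
    unfolding fMAIN_def sem_basic(2) sem_ALL9 ..
  also have "\<dots> \<longleftrightarrow> sem [] fPOS \<and> (\<forall>p < N. \<forall>q < N. \<forall>n < N. \<forall>m < N. \<forall>r < N. \<forall>n' < N. \<forall>m' < N.
      \<forall>r' < N. \<forall>q' < N. ?body p q n m r n' m' r' q' \<longrightarrow> cex c N (dec \<Sigma> c w p) (dec \<Sigma> c w q) I)"
    using 1 by (simp only: cong: imp_cong)
  also have "\<dots> \<longleftrightarrow> sem [] fPOS \<and>
    (valid \<Sigma> c w 0 \<and> valid \<Sigma> c w ?q \<and> length w \<le> ?q' \<longrightarrow> cex c N (dec \<Sigma> c w 0) (dec \<Sigma> c w ?q) I)"
  proof -
    have "cex c N (dec \<Sigma> c w 0) (dec \<Sigma> c w ?q) I"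
      if *: "\<forall>p < N. \<forall>q < N. \<forall>n < N. \<forall>m < N. \<forall>r < N. \<forall>n' < N. \<forall>m' < N. \<forall>r' < N. \<forall>q' < N.
        ?body p q n m r n' m' r' q' \<longrightarrow> cex c N (dec \<Sigma> c w p) (dec \<Sigma> c w q) I"
        and v: "valid \<Sigma> c w 0" "valid \<Sigma> c w ?q" "length w \<le> ?q'"
    proof -
      \<comment> \<open>All parse values of a valid code are below \<open>N\<close>, so the nine
        universal quantifiers can be instantiated with the actual parse.\<close>
      have s: "ulen w p < N" "ulen w (fld2 w p) < N" "fld3 w p < N" "code_end w p < N" if "valid \<Sigma> c w p" for p
        using small_dec(2)[OF that, of N] code_end_le[OF that] wN that[unfolded valid_def, THEN conjunct1]
        by (simp_all add: dec_simps)
      show ?thesis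
        using * s[OF v(1)] s[OF v(2)] v wN by (simp add: not_less)
    qed
    then show ?thesis by (auto simp: not_less)
  qed
  finally show ?thesis .
qed

end

text \<open>If \<open>fPOS\<close> fails, so do both sides; if it holds, relation 0 is the true
  parse and the formulas about graphs have their intended meaning.\<close>

lemma (in model) sem_MAIN:
  assumes ls: "set ls = c ` \<Sigma>"
  shows "sem [] (fMAIN ls) \<longleftrightarrow> (\<forall>p < N. \<forall>i < N. \<forall>q < N. I 0 [p, i, q] \<longleftrightarrow> steps w p i q) \<and>
    (valid \<Sigma> c w 0 \<and> valid \<Sigma> c w (code_end w 0) \<and> length w \<le> code_end w (code_end w 0) \<longrightarrow>
     cex c N (dec \<Sigma> c w 0) (dec \<Sigma> c w (code_end w 0)) I)"
proof (cases "sem [] fPOS")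
  case True
  then interpret parsed N w I \<Sigma> c ls using ls by unfold_locales (auto simp: sem_POS)
  show ?thesis using sem_MAIN_parsed by (simp only: sem_POS)
next
  case False
  then show ?thesis unfolding fMAIN_def sem_basic(2) using sem_POS by blast
qed

text \<open>Relation 0 is reserved for the parse, and certificates speak of relations 1 to 7, so the
  two can be chosen independently and then combined.\<close>

lemma cex_upd0: "cex c N H K (J(0 := S)) = cex c N H K J"
  by (simp add: cex_def cex_H_def cex_under_def cex_over_def inside_def allw_def)

theorem theorem6:
  fixes \<Sigma> :: "'l set" and c :: "'l \<Rightarrow> nat"
  assumes "finite \<Sigma>" and "inj_on c \<Sigma>"
  shows "shape_containment \<Sigma> c \<in> coNEXP"
proof -
  obtain ls where ls: "set ls = c ` \<Sigma>" by (rule exE[OF finite_list[OF finite_imageI[OF assms(1)]]])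
  have "w \<notin> shape_containment \<Sigma> c \<longleftrightarrow> (\<exists>I. sat (2 ^ ((length w + 1)\<^sup>2)) w I [] (fMAIN ls 0))" for w
  proof -
    let ?N = "2 ^ ((length w + 1)\<^sup>2) :: nat" and ?q = "code_end w 0"
    let ?H = "dec \<Sigma> c w 0" and ?K = "dec \<Sigma> c w ?q"
    have "length w + 1 < 2 ^ (length w + 1)" by (rule less_exp)
    also have "\<dots> \<le> ?N" by (rule power_increasing) (simp_all add: power2_eq_square)
    finally have wN: "length w + 1 < ?N" .
    have model: "model ?N w" using wN by (simp add: model_def)
    have sat: "sat ?N w I [] (fMAIN ls 0) \<longleftrightarrow>
      (\<forall>p < ?N. \<forall>i < ?N. \<forall>q < ?N. I 0 [p, i, q] \<longleftrightarrow> steps w p i q) \<and>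
      (valid \<Sigma> c w 0 \<and> valid \<Sigma> c w ?q \<and> length w \<le> code_end w ?q \<longrightarrow> cex c ?N ?H ?K I)" for I
      using model.sem_MAIN[OF model ls, of I] model.sem_def[OF model, of I "[]"] by simp
    show ?thesis
    proof
      assume nw: "w \<notin> shape_containment \<Sigma> c"
      let ?S = "\<lambda>xs. steps w (xs ! 0) (xs ! 1) (xs ! 2)"
      have "\<exists>J. valid \<Sigma> c w 0 \<and> valid \<Sigma> c w ?q \<and> length w \<le> code_end w ?q \<longrightarrow> cex c ?N ?H ?K J"
      proof (cases "valid \<Sigma> c w 0 \<and> valid \<Sigma> c w ?q \<and> length w \<le> code_end w ?q")
        case True
        then have v: "valid \<Sigma> c w 0" "valid \<Sigma> c w ?q" and fin: "length w \<le> code_end w ?q" by blast+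
        obtain u where u: "drop 0 w = u @ drop ?q w" "encodes c u ?H" using drop_code[OF v(1)] by blast
        obtain u' where u': "drop ?q w = u' @ drop (code_end w ?q) w" "encodes c u' ?K"
          using drop_code[OF v(2)] by blast
        have "w = u @ u'" using u(1) u'(1) fin by simp
        then have "\<not> lang \<Sigma> ?H \<subseteq> lang \<Sigma> ?K"
          using nw u(2) u'(2) shape_dec[OF v(1)] shape_dec[OF v(2)] unfolding shape_containment_def by blast
        then obtain G :: "(nat, nat, 'l) graph" where G: "simple_graph \<Sigma> G" "G \<preceq> ?H" "\<not> G \<preceq> ?K" unfolding lang_def by blast
        then obtain R where R: "embedding G ?H R" unfolding embeds_def by blast
        let ?a = "card (nodes ?H)" and ?b = "card (edges ?H)" and ?a' = "card (nodes ?K)" and ?b' = "card (edges ?K)"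
        let ?l = "length w"
        have l: "?a \<le> ?l" "?b \<le> ?l" "?a' + 1 \<le> ?l" "?b' + 1 \<le> ?l"
          using small_dec(2)[OF v(1), of ?N] small_dec(2)[OF v(2), of ?N] wN by linarith+
        have "counterexample \<Sigma> c ?N ?H ?K G R"
        proof
          \<comment> \<open>Both parts of the number of copies are at most \<open>?l * ?l\<close>,
            which is below 2^(l*l). With 2^(2l) kinds the exponents add up to 2l + 1 + l*l, the
            square that defines \<open>?N\<close>.\<close>
          have "?a * ?b \<le> ?l * ?l" using l by (intro mult_mono) auto
          moreover have "?a' * (?b' + 1) + 1 \<le> (?a' + 1) * (?b' + 1)" by simp
          moreover have "(?a' + 1) * (?b' + 1) \<le> ?l * ?l" using l by (intro mult_mono) auto
          moreover have "?l * ?l < 2 ^ (?l * ?l)" by (rule less_exp)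
          ultimately have "?a * ?b + ?a' * (?b' + 1) + 1 \<le> 2 * 2 ^ (?l * ?l)" by linarith
          moreover have "(2 :: nat) ^ (?a + ?a') \<le> 2 ^ (2 * ?l)" using l by (intro power_increasing) auto
          ultimately have "2 ^ (?a + ?a') * (?a * ?b + ?a' * (?b' + 1) + 1) \<le> 2 ^ (2 * ?l) * (2 * 2 ^ (?l * ?l))"
            by (intro mult_mono) auto
          also have "\<dots> = 2 ^ (2 * ?l + 1 + ?l * ?l)" by (simp add: power_add)
          also have "2 * ?l + 1 + ?l * ?l = (?l + 1)\<^sup>2" by (simp add: power2_eq_square)
          finally show "2 ^ (?a + ?a') * (?a * ?b + ?a' * (?b' + 1) + 1) \<le> ?N" .
          show "small c ?N ?H" "small c ?N ?K" using small_dec(1)[OF v(1)] small_dec(1)[OF v(2)] wN by simp_all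
        qed (fact assms(2) shape_dec[OF v(1)] shape_dec[OF v(2)] G(1,3) R)+
        then show ?thesis using counterexample.cex_cert by blast
      qed blast
      then obtain J where "valid \<Sigma> c w 0 \<and> valid \<Sigma> c w ?q \<and> length w \<le> code_end w ?q \<longrightarrow>
        cex c ?N ?H ?K J" by blast
      then have "sat ?N w (J(0 := ?S)) [] (fMAIN ls 0)"
        unfolding sat cex_upd0 by simp
      then show "\<exists>I. sat ?N w I [] (fMAIN ls 0)" by blast
    next
      assume "\<exists>I. sat ?N w I [] (fMAIN ls 0)"
      then obtain I where I: "valid \<Sigma> c w 0 \<and> valid \<Sigma> c w ?q \<and> length w \<le> code_end w ?q \<longrightarrow> cex c ?N ?H ?K I"
        unfolding sat by blast
      show "w \<notin> shape_containment \<Sigma> c"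
      proof
        assume "w \<in> shape_containment \<Sigma> c"
        then obtain u u' and H K :: "(nat, nat, 'l) graph" where w: "w = u @ u'"
          and HK: "shape_graph \<Sigma> H" "shape_graph \<Sigma> K" "encodes c u H" "encodes c u' K"
            "lang \<Sigma> H \<subseteq> lang \<Sigma> K"
          unfolding shape_containment_def by blast
        have "drop 0 w = u @ u'" using w by simp
        note H = encodes_valid[OF assms(2) HK(1,3) this]
        \<comment> \<open>With an empty remainder, \<open>encodes_valid\<close> also shows that the
          second code reaches the end of \<open>w\<close>, the last premise for the
          certificate.\<close>
        have "drop ?q w = u' @ []" using H(2) by simp
        note K = encodes_valid[OF assms(2) HK(2,4) this]
        have "cex c ?N ?H ?K I" using I H(1) K(1,2) by simp
        then have "certificate \<Sigma> c ?N ?H ?K I"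
          using assms(2) shape_dec[OF H(1)] shape_dec[OF K(1)] small_dec(1)[OF H(1), of ?N]
            small_dec(1)[OF K(1), of ?N] wN by (simp add: certificate_def)
        then have "\<not> lang \<Sigma> ?H \<subseteq> lang \<Sigma> ?K" by (rule certificate.not_contained)
        then show False using HK(5) H(3) K(3) by simp
      qed
    qed
  qed
  then have "- shape_containment \<Sigma> c = {w. \<exists>I. sat (2 ^ ((length w + 1)\<^sup>2)) w I [] (fMAIN ls 0)}"
    by blast
  also have "\<dots> \<in> NEXP" by (rule definable_NEXP[OF wf_MAIN])
  finally show ?thesis unfolding coNEXP_def by simp
qed

end
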